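(* Let $G_j$ be locally compact second countable groups for $j=1,\ldots,k$ with $k\ge 2$, each with property $(T)$. Set $G = G_1 \times \cdots \times G_k$ and let $(X,\nu)$ be an ergodic measure-preserving $G$-space. Assume that there exist closed subgroups $H_j < G_j$ such that, for each $j$, the space of $\prod_{\ell\ne j}G_\ell$-ergodic components of $(X,\nu)$ is isomorphic to $(G_j/H_j,\mathrm{Haar})$, and such that any nontrivial normal subgroup of $H_j$ has finite index in $H_j$. Then either at least one $G_j$ acts essentially freely on $(X,\nu)$ or the action of $G$ on $(X,\nu)$ is essentially transitive.
   Context: A $G$-space is a (standard) probability space $(X,\nu)$ with a measurable action of $G$ preserving the class of $\nu$-null sets; it is measure-preserving when $g\nu=\nu$ for all $g\in G$. For a closed normal subgroup $N$ of $G$, the space of $N$-ergodic components of $(X,\nu)$ is the $G$-space $(Y,\eta)$ that is the (Mackey) point realization of the algebra of $N$-invariant functions in $L^\infty(X,\nu)$, i.e. there is a $G$-equivariant measurable map $\pi:X\to Y$ with $\pi_*\nu=\eta$ and $\{f\circ\pi: f\in L^\infty(Y,\eta)\}$ equal to that algebra; $N$ acts trivially on $Y$, so for $N=\prod_{\ell\neq j}G_\ell$ it is a $G_j$-space, and the isomorphism with $G_j/H_j$ is as $G_j$-spaces, where Haar denotes the normalized $G_j$-invariant probability measure on $G_j/H_j$. An action of a group $L$ is essentially free when $\{g\in L: gx=x\}=\{e\}$ for almost every $x$, and essentially transitive when there exists $x_0\in X$ with $\nu(L\cdot x_0)=1$. *)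

theory Defs
  imports
    "HOL-Probability.Probability_Measure"
    "HOL-Algebra.Product_Groups"
    "HOL-Algebra.Group_Action"
    "HOL-Algebra.Left_Coset"
    "HOL-Algebra.Module"
    "HOL-Algebra.Algebraic_Closure_Type"
begin

section \<open>Locally compact second countable groups\<close>

definition lcsc_group :: "'g monoid \<Rightarrow> 'g topology \<Rightarrow> bool" where
  "lcsc_group G T \<longleftrightarrow>
     group G \<and> topspace T = carrier G \<and>
     continuous_map (prod_topology T T) T (\<lambda>(x, y). x \<otimes>\<^bsub>G\<^esub> y) \<and>
     continuous_map T T (\<lambda>x. inv\<^bsub>G\<^esub> x) \<and>
     Hausdorff_space T \<and> locally_compact_space T \<and> second_countable T"

definition borel_of :: "'a topology \<Rightarrow> 'a measure" where
  "borel_of T = sigma (topspace T) {U. openin T U}"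


section \<open>Unitary representations and property (T)\<close>

text \<open>A complex Hilbert space is a module \<open>V\<close> over the field of complex numbers together with an
  inner product \<open>ip\<close>, linear in the first argument. The multiplicative part of the record \<open>V\<close>
  is not used.\<close>

definition hilbert_dist ::
  "(complex, 'v) module \<Rightarrow> ('v \<Rightarrow> 'v \<Rightarrow> complex) \<Rightarrow> 'v \<Rightarrow> 'v \<Rightarrow> real" where
  "hilbert_dist V ip x y = sqrt (Re (ip (x \<ominus>\<^bsub>V\<^esub> y) (x \<ominus>\<^bsub>V\<^esub> y)))"

definition hilbert_space :: "(complex, 'v) module \<Rightarrow> ('v \<Rightarrow> 'v \<Rightarrow> complex) \<Rightarrow> bool" where
  "hilbert_space V ip \<longleftrightarrow>
     Module.module (ring_of_type_algebra :: complex ring) V \<and>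
     (\<forall>x\<in>carrier V. \<forall>y\<in>carrier V. \<forall>z\<in>carrier V. ip (x \<oplus>\<^bsub>V\<^esub> y) z = ip x z + ip y z) \<and>
     (\<forall>a. \<forall>x\<in>carrier V. \<forall>y\<in>carrier V. ip (a \<odot>\<^bsub>V\<^esub> x) y = a * ip x y) \<and>
     (\<forall>x\<in>carrier V. \<forall>y\<in>carrier V. ip y x = cnj (ip x y)) \<and>
     (\<forall>x\<in>carrier V. x \<noteq> \<zero>\<^bsub>V\<^esub> \<longrightarrow> Re (ip x x) > 0) \<and>
     Metric_space.mcomplete (carrier V) (hilbert_dist V ip)"

text \<open>Strongly continuous unitary representations. That each \<open>\<pi> g\<close> is a bijection of \<open>carrier V\<close>
  is part of \<open>group_action\<close>.\<close>

definition unitary_rep ::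
  "'g monoid \<Rightarrow> 'g topology \<Rightarrow> (complex, 'v) module \<Rightarrow> ('v \<Rightarrow> 'v \<Rightarrow> complex)
     \<Rightarrow> ('g \<Rightarrow> 'v \<Rightarrow> 'v) \<Rightarrow> bool" where
  "unitary_rep G T V ip \<pi> \<longleftrightarrow>
     hilbert_space V ip \<and> group_action G (carrier V) \<pi> \<and>
     (\<forall>g\<in>carrier G. \<forall>x\<in>carrier V. \<forall>y\<in>carrier V. \<pi> g (x \<oplus>\<^bsub>V\<^esub> y) = \<pi> g x \<oplus>\<^bsub>V\<^esub> \<pi> g y) \<and>
     (\<forall>g\<in>carrier G. \<forall>a. \<forall>x\<in>carrier V. \<pi> g (a \<odot>\<^bsub>V\<^esub> x) = a \<odot>\<^bsub>V\<^esub> \<pi> g x) \<and>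
     (\<forall>g\<in>carrier G. \<forall>x\<in>carrier V. \<forall>y\<in>carrier V. ip (\<pi> g x) (\<pi> g y) = ip x y) \<and>
     (\<forall>x\<in>carrier V.
        continuous_map T (Metric_space.mtopology (carrier V) (hilbert_dist V ip)) (\<lambda>g. \<pi> g x))"

text \<open>Existence of a compact Kazhdan set. The representation spaces range over all Hilbert space
  structures on subsets of \<^typ>\<open>nat \<Rightarrow> complex\<close>. This type has the cardinality of the continuum, so
  every separable Hilbert space is isometric to one of them. For a second countable group nothing is
  lost: the cyclic subrepresentation generated by a \<open>(Q, \<epsilon>)\<close>-invariant vector is separable.\<close>

definition property_T :: "'g monoid \<Rightarrow> 'g topology \<Rightarrow> bool" where
  "property_T G T \<longleftrightarrow>
     (\<exists>Q \<epsilon>. compactin T Q \<and> \<epsilon> > 0 \<and>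
        (\<forall>(V :: (complex, nat \<Rightarrow> complex) module) ip \<pi>.
           unitary_rep G T V ip \<pi> \<and>
           (\<exists>v\<in>carrier V. v \<noteq> \<zero>\<^bsub>V\<^esub> \<and>
              (\<forall>g\<in>Q. hilbert_dist V ip (\<pi> g v) v < \<epsilon> * hilbert_dist V ip v \<zero>\<^bsub>V\<^esub>))
           \<longrightarrow> (\<exists>w\<in>carrier V. w \<noteq> \<zero>\<^bsub>V\<^esub> \<and> (\<forall>g\<in>carrier G. \<pi> g w = w))))"


section \<open>Actions on standard probability spaces\<close>

definition standard_prob_space :: "'x measure \<Rightarrow> bool" where
  "standard_prob_space M \<longleftrightarrow> prob_space M \<and>
     (\<exists>T. completely_metrizable_space T \<and> second_countable T \<and>
          topspace T = space M \<and> sets M = sets (borel_of T))"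

definition G_space ::
  "'g monoid \<Rightarrow> 'g topology \<Rightarrow> 'x measure \<Rightarrow> ('g \<Rightarrow> 'x \<Rightarrow> 'x) \<Rightarrow> bool" where
  "G_space G T M \<phi> \<longleftrightarrow>
     standard_prob_space M \<and> group_action G (space M) \<phi> \<and>
     (\<lambda>(g, x). \<phi> g x) \<in> measurable (borel_of T \<Otimes>\<^sub>M M) M \<and>
     (\<forall>g\<in>carrier G. null_sets (distr M M (\<phi> g)) = null_sets M)"

definition measure_preserving_action :: "'g monoid \<Rightarrow> 'x measure \<Rightarrow> ('g \<Rightarrow> 'x \<Rightarrow> 'x) \<Rightarrow> bool" where
  "measure_preserving_action G M \<phi> \<longleftrightarrow> (\<forall>g\<in>carrier G. distr M M (\<phi> g) = M)"

definition ergodic_action :: "'g monoid \<Rightarrow> 'x measure \<Rightarrow> ('g \<Rightarrow> 'x \<Rightarrow> 'x) \<Rightarrow> bool" where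
  "ergodic_action G M \<phi> \<longleftrightarrow>
     (\<forall>A\<in>sets M. (\<forall>g\<in>carrier G. \<phi> g ` A = A) \<longrightarrow> emeasure M A = 0 \<or> emeasure M (space M - A) = 0)"

definition essentially_free :: "'g monoid \<Rightarrow> 'x measure \<Rightarrow> ('g \<Rightarrow> 'x \<Rightarrow> 'x) \<Rightarrow> bool" where
  "essentially_free L M \<phi> \<longleftrightarrow> (AE x in M. stabilizer L \<phi> x = {\<one>\<^bsub>L\<^esub>})"

text \<open>\<^const>\<open>emeasure\<close> vanishes outside \<^term>\<open>sets M\<close>, so the orbit is in particular measurable.\<close>

definition essentially_transitive :: "'g monoid \<Rightarrow> 'x measure \<Rightarrow> ('g \<Rightarrow> 'x \<Rightarrow> 'x) \<Rightarrow> bool" where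
  "essentially_transitive L M \<phi> \<longleftrightarrow> (\<exists>x\<^sub>0\<in>space M. emeasure M (orbit L \<phi> x\<^sub>0) = 1)"


section \<open>Ergodic components\<close>

definition Linfty :: "'x measure \<Rightarrow> ('x \<Rightarrow> complex) set" where
  "Linfty M = {f \<in> borel_measurable M. \<exists>C. AE x in M. norm (f x) \<le> C}"

text \<open>\<open>(Y, \<psi>)\<close> is, via \<open>p\<close>, the space of \<open>N\<close>-ergodic components of the \<open>G\<close>-space \<open>(M, \<phi>)\<close>. Elements of
  the algebra of bounded functions are classes modulo null sets, so invariance and equality
  of functions, and likewise equivariance of \<open>p\<close>, are understood almost everywhere, for each group
  element.\<close>

definition ergodic_components ::
  "'g monoid \<Rightarrow> 'g topology \<Rightarrow> 'g set \<Rightarrow> 'x measure \<Rightarrow> ('g \<Rightarrow> 'x \<Rightarrow> 'x)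
     \<Rightarrow> 'y measure \<Rightarrow> ('g \<Rightarrow> 'y \<Rightarrow> 'y) \<Rightarrow> ('x \<Rightarrow> 'y) \<Rightarrow> bool" where
  "ergodic_components G T N M \<phi> Y \<psi> p \<longleftrightarrow>
     G_space G T Y \<psi> \<and>
     p \<in> measurable M Y \<and> distr M Y p = Y \<and>
     (\<forall>g\<in>carrier G. AE x in M. p (\<phi> g x) = \<psi> g (p x)) \<and>
     (\<forall>f\<in>Linfty M.
        (\<forall>n\<in>N. AE x in M. f (\<phi> n x) = f x) \<longleftrightarrow> (\<exists>h\<in>Linfty Y. AE x in M. f x = h (p x)))"

text \<open>Isomorphism of \<open>L\<close>-spaces, modulo null sets.\<close>

definition isomorphic_actions ::
  "'g monoid \<Rightarrow> 'y measure \<Rightarrow> ('g \<Rightarrow> 'y \<Rightarrow> 'y) \<Rightarrow> 'z measure \<Rightarrow> ('g \<Rightarrow> 'z \<Rightarrow> 'z) \<Rightarrow> bool" where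
  "isomorphic_actions L Y \<psi> Z \<rho> \<longleftrightarrow>
     (\<exists>F F'. F \<in> measurable Y Z \<and> F' \<in> measurable Z Y \<and> distr Y Z F = Z \<and>
        (AE y in Y. F' (F y) = y) \<and> (AE z in Z. F (F' z) = z) \<and>
        (\<forall>g\<in>carrier L. AE y in Y. F (\<psi> g y) = \<rho> g (F y)))"


section \<open>Homogeneous spaces\<close>

text \<open>\<open>m\<close> is the normalized Haar measure on \<open>G/H\<close>: the left translation invariant probability measure
  on the Borel sets of the quotient topology, in which a set of left cosets is open iff its union is
  open in \<open>G\<close>. For a closed subgroup of a locally compact second countable group it is unique if
  it exists.\<close>

definition Haar_on_cosets :: "'g monoid \<Rightarrow> 'g topology \<Rightarrow> 'g set \<Rightarrow> 'g set measure \<Rightarrow> bool" where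
  "Haar_on_cosets G T H m \<longleftrightarrow>
     prob_space m \<and> space m = lcosets\<^bsub>G\<^esub> H \<and>
     sets m = sets (sigma (lcosets\<^bsub>G\<^esub> H) {U. U \<subseteq> lcosets\<^bsub>G\<^esub> H \<and> openin T (\<Union>U)}) \<and>
     (\<forall>g\<in>carrier G. distr m m (\<lambda>C. g <#\<^bsub>G\<^esub> C) = m)"


section \<open>Direct factors\<close>

definition factor_embed :: "'i set \<Rightarrow> ('i \<Rightarrow> 'g monoid) \<Rightarrow> 'i \<Rightarrow> 'g \<Rightarrow> ('i \<Rightarrow> 'g)" where
  "factor_embed I G j g = (\<lambda>i\<in>I. if i = j then g else \<one>\<^bsub>G i\<^esub>)"

definition complementary_factor :: "'i set \<Rightarrow> ('i \<Rightarrow> 'g monoid) \<Rightarrow> 'i \<Rightarrow> ('i \<Rightarrow> 'g) set" where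
  "complementary_factor I G j = {g \<in> carrier (product_group I G). g j = \<one>\<^bsub>G j\<^esub>}"

end

theory Submission
  imports Defs "HOL-Analysis.Urysohn"
begin

text \<open>Write \<open>G\<close> for the product of the \<open>G j\<close>, \<open>H\<close> for the product of the \<open>H j\<close>, and \<open>S j x\<close> for the
  stabilizer of a point \<open>x\<close> in the factor \<open>G j\<close>. The projections onto the ergodic components
  combine to a \<open>G\<close>-equivariant map \<open>Q\<close> from the space to \<open>G/H\<close>. The complementary factor commutes
  with \<open>G j\<close>, so it does not change \<open>S j x\<close>; hence \<open>S j x\<close> depends only on the \<open>j\<close>-th coordinate
  of \<open>Q x\<close>. Over the base point of \<open>G/H\<close> it is therefore one fixed subgroup. Equivariance
  of \<open>Q\<close> puts this subgroup inside \<open>H j\<close>, and \<open>H j\<close>, which preserves the fibre, normalizes it. So it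
  is trivial or of finite index in \<open>H j\<close>, and by ergodicity its triviality does not depend on the
  point. If it is trivial for some \<open>j\<close>, then \<open>G j\<close> acts essentially freely. If it has finite index for
  every \<open>j\<close>, then \<open>H\<close> has finite orbits on the fibre over the base point. Every \<open>G\<close>-orbit meets this
  fibre in one of these finite sets, finite sets are told apart by countably many measurable tests, and
  an ergodic action on which countably many invariant sets separate the orbits has a conull orbit
  (\<open>essentially_transitive_if_finite_fibres\<close>).\<close>

text \<open>Two difficulties have to be overcome. First, \<open>Q\<close> is equivariant only almost everywhere, for each
  group element separately, whereas the elements of a stabilizer vary with the point and may form an
  uncountable set. Let \<open>G\<close> carry a right invariant measure (\<open>Haar_measure\<close>). By Fubini, for almost every
  \<open>x\<close> there is a coset \<open>c\<close> with \<open>Q (g x) = g c\<close> for almost all \<open>g\<close>, and by right invariance the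
  relation between \<open>x\<close> and \<open>c\<close> is equivariant without exceptional sets; this is the predicate
  \<open>typical\<close>.\<close>

text \<open>Second, statements about stabilizers and orbits quantify over uncountably many group elements, so
  their measurability is not clear. Baire category in \<open>G\<close> provides it. For a countable separating
  family of sets \<open>A\<close>, record on which open sets \<open>U\<close> of \<open>G\<close> the set of \<open>h\<close> with \<open>h x\<close> in \<open>A\<close> is meager
  or comeager. These are measurable conditions on \<open>x\<close>, translation by \<open>g\<close> shifts them by \<open>g\<close>, and two
  distinct points are told apart by one of them. That \<open>g\<close> does not carry \<open>x\<close> to \<open>y\<close> thereby becomes an
  open condition on \<open>g\<close>, and compactness reduces a quantifier over a compact set of group elements to
  finite covers, of which there are only countably many (\<open>compact_orbit_relation\<close>).\<close>

section \<open>Locally compact second countable groups\<close>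

locale lcsc = group G for G :: "'a monoid" (structure) +
  fixes T :: "'a topology"
  assumes lcsc: "lcsc_group G T"
begin

lemma topspace_T [simp]: "topspace T = carrier G"
  and continuous_mult: "continuous_map (prod_topology T T) T (\<lambda>(x, y). x \<otimes> y)"
  and continuous_inv: "continuous_map T T (\<lambda>x. inv x)"
  and Hausdorff_T: "Hausdorff_space T" and locally_compact_T: "locally_compact_space T"
  and second_countable_T: "second_countable T"
  using lcsc by (auto simp: lcsc_group_def)

lemma regular_T: "regular_space T"
  using Hausdorff_T locally_compact_T locally_compact_Hausdorff_imp_regular_space by blast

lemma openin_carrier: "openin T U \<Longrightarrow> U \<subseteq> carrier G"
  using openin_subset by fastforce

lemma compactin_carrier: "compactin T K \<Longrightarrow> K \<subseteq> carrier G"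
  using compactin_subset_topspace by fastforce

text \<open>One countable base is fixed by choice, so that later countable unions are indexed by a constant.\<close>

definition basis :: "'a set set" where
  "basis = (SOME \<B>. countable \<B> \<and> (\<forall>V\<in>\<B>. openin T V) \<and>
     (\<forall>U x. openin T U \<and> x \<in> U \<longrightarrow> (\<exists>V\<in>\<B>. x \<in> V \<and> V \<subseteq> U)))"

lemma basis: "countable basis" "V \<in> basis \<Longrightarrow> openin T V"
    "openin T U \<Longrightarrow> x \<in> U \<Longrightarrow> \<exists>V\<in>basis. x \<in> V \<and> V \<subseteq> U"
  using someI_ex[OF second_countable_T[unfolded second_countable_def], folded basis_def] by auto

lemma continuous_left_mult: "a \<in> carrier G \<Longrightarrow> continuous_map T T (\<lambda>x. a \<otimes> x)"
  using continuous_map_compose[OF _ continuous_mult, of T "\<lambda>x. (a, x)"]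
  by (simp add: continuous_map_pairwise o_def)

lemma continuous_right_mult: "a \<in> carrier G \<Longrightarrow> continuous_map T T (\<lambda>x. x \<otimes> a)"
  using continuous_map_compose[OF _ continuous_mult, of T "\<lambda>x. (x, a)"]
  by (simp add: continuous_map_pairwise o_def)

lemma mem_set_mult: "x \<in> A <#> B \<longleftrightarrow> (\<exists>a\<in>A. \<exists>b\<in>B. x = a \<otimes> b)"
  and mem_r_coset: "x \<in> A #> g \<longleftrightarrow> (\<exists>a\<in>A. x = a \<otimes> g)"
  and mem_l_coset: "x \<in> g <# A \<longleftrightarrow> (\<exists>a\<in>A. x = g \<otimes> a)"
  by (auto simp: set_mult_def r_coset_def l_coset_def)

lemma r_coset_preimage:
  assumes "A \<subseteq> carrier G" "a \<in> carrier G"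
  shows "A #> a = {x \<in> carrier G. x \<otimes> inv a \<in> A}"
proof -
  have "x \<in> A #> a" if "x \<in> carrier G" "x \<otimes> inv a \<in> A" for x
    using that assms by (auto simp: r_coset_def m_assoc intro!: bexI[of _ "x \<otimes> inv a"])
  then show ?thesis using assms by (auto simp: r_coset_def m_assoc subset_iff)
qed

lemma l_coset_preimage:
  assumes "A \<subseteq> carrier G" "a \<in> carrier G"
  shows "a <# A = {x \<in> carrier G. inv a \<otimes> x \<in> A}"
proof -
  have "x \<in> a <# A" if "x \<in> carrier G" "inv a \<otimes> x \<in> A" for x
    using that assms by (auto simp: l_coset_def m_assoc[symmetric] intro!: bexI[of _ "inv a \<otimes> x"])
  then show ?thesis using assms by (auto simp: l_coset_def m_assoc[symmetric] subset_iff)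
qed

lemma openin_r_coset: "openin T U \<Longrightarrow> a \<in> carrier G \<Longrightarrow> openin T (U #> a)"
  using openin_continuous_map_preimage[OF continuous_right_mult, of "inv a" U]
  by (simp add: r_coset_preimage openin_carrier)

lemma openin_l_coset: "openin T U \<Longrightarrow> a \<in> carrier G \<Longrightarrow> openin T (a <# U)"
  using openin_continuous_map_preimage[OF continuous_left_mult, of "inv a" U]
  by (simp add: l_coset_preimage openin_carrier)

lemma compactin_r_coset: "compactin T K \<Longrightarrow> a \<in> carrier G \<Longrightarrow> compactin T (K #> a)"
  using image_compactin[OF _ continuous_right_mult, of K a]
  by (simp add: r_coset_def UNION_singleton_eq_range)

lemma openin_set_mult_right: "openin T U \<Longrightarrow> A \<subseteq> carrier G \<Longrightarrow> openin T (U <#> A)"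
proof -
  assume *: "openin T U" "A \<subseteq> carrier G"
  have "U <#> A = (\<Union>a\<in>A. U #> a)" by (auto simp: set_mult_def r_coset_def)
  then show ?thesis using * openin_r_coset by (auto intro!: openin_Union)
qed

lemma continuous_division: "continuous_map (prod_topology T T) T (\<lambda>p. fst p \<otimes> inv (snd p))"
proof -
  have "continuous_map (prod_topology T T) T ((\<lambda>(x, y). x \<otimes> y) \<circ> (\<lambda>p. (fst p, inv (snd p))))"
    using continuous_map_compose[OF continuous_map_snd continuous_inv]
    by (intro continuous_map_compose[OF _ continuous_mult]) (simp add: continuous_map_pairwise o_def continuous_map_fst)
  then show ?thesis by (simp add: o_def)
qed

lemma division_nbhd:
  assumes "openin T W" "\<one> \<in> W"
  obtains U where "openin T U" "\<one> \<in> U" "\<And>u v. u \<in> U \<Longrightarrow> v \<in> U \<Longrightarrow> u \<otimes> inv v \<in> W"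
proof -
  have "openin (prod_topology T T) {p \<in> topspace (prod_topology T T). fst p \<otimes> inv (snd p) \<in> W}"
    using continuous_division assms(1) by (rule openin_continuous_map_preimage)
  moreover have "(\<one>, \<one>) \<in> {p \<in> topspace (prod_topology T T). fst p \<otimes> inv (snd p) \<in> W}"
    using assms(2) by simp
  ultimately obtain A B where AB: "openin T A" "openin T B" "\<one> \<in> A" "\<one> \<in> B"
      "A \<times> B \<subseteq> {p \<in> topspace (prod_topology T T). fst p \<otimes> inv (snd p) \<in> W}"
    unfolding openin_prod_topology_alt by meson
  show ?thesis
    by (rule that[of "A \<inter> B"]) (use AB in auto)
qed

text \<open>A translate \<open>U #> g\<close> that meets both \<open>K\<close> and \<open>L\<close> puts an element of the quotient set of
  \<open>K\<close> by \<open>L\<close> into the quotient set of \<open>U\<close> by itself. The former is compact and misses the unit.\<close>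

lemma separating_nbhd:
  assumes K: "compactin T K" "compactin T L" "K \<inter> L = {}"
  obtains U where "openin T U" "\<one> \<in> U"
    "\<And>g. g \<in> carrier G \<Longrightarrow> (U #> g) \<inter> K = {} \<or> (U #> g) \<inter> L = {}"
proof -
  define D where "D = (\<lambda>p. fst p \<otimes> inv (snd p)) ` (K \<times> L)"
  have "compactin T D"
    unfolding D_def using K by (intro image_compactin[OF _ continuous_division]) (simp add: compactin_Times)
  then have "closedin T D" using Hausdorff_T compactin_imp_closedin by blast
  moreover have sub: "K \<subseteq> carrier G" "L \<subseteq> carrier G" using K compactin_carrier by auto
  have "\<one> \<notin> D"
  proof
    assume "\<one> \<in> D"
    then obtain k l where "k \<in> K" "l \<in> L" "\<one> = k \<otimes> inv l" by (auto simp: D_def)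
    then have "k = l" using sub by (metis inv_equality inv_inv inv_closed subsetD)
    then show False using \<open>k \<in> K\<close> \<open>l \<in> L\<close> K(3) by auto
  qed
  ultimately have "openin T (carrier G - D)" "\<one> \<in> carrier G - D"
    by (auto simp: closedin_def)
  then obtain U where U: "openin T U" "\<one> \<in> U" "\<And>u v. u \<in> U \<Longrightarrow> v \<in> U \<Longrightarrow> u \<otimes> inv v \<in> carrier G - D"
    using division_nbhd by metis
  have "(U #> g) \<inter> K = {} \<or> (U #> g) \<inter> L = {}" if g: "g \<in> carrier G" for g
  proof (rule ccontr)
    assume "\<not> ?thesis"
    then obtain u v where uv: "u \<in> U" "v \<in> U" "u \<otimes> g \<in> K" "v \<otimes> g \<in> L" by (auto simp: r_coset_def)
    then have c: "u \<in> carrier G" "v \<in> carrier G" using U(1) openin_carrier by auto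
    have "(u \<otimes> g) \<otimes> inv (v \<otimes> g) \<in> D" using uv by (force simp: D_def)
    moreover have "(u \<otimes> g) \<otimes> inv (v \<otimes> g) = u \<otimes> inv v"
      using c g by (simp add: inv_mult_group m_assoc) (simp add: m_assoc[symmetric])
    ultimately show False using U(3)[OF uv(1,2)] by auto
  qed
  then show ?thesis using U(1,2) that by blast
qed

end

lemma space_borel_of [simp]: "space (borel_of T) = topspace T"
  unfolding borel_of_def by (rule space_measure_of) (auto dest: openin_subset)

lemma sets_borel_of: "sets (borel_of T) = sigma_sets (topspace T) {U. openin T U}"
  unfolding borel_of_def by (rule sets_measure_of) (auto dest: openin_subset)

lemma openin_sets_borel_of: "openin T U \<Longrightarrow> U \<in> sets (borel_of T)"
  by (simp add: sets_borel_of)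

lemma continuous_map_measurable:
  assumes "continuous_map S T f"
  shows "f \<in> measurable (borel_of S) (borel_of T)"
  unfolding measurable_def
proof (intro CollectI conjI ballI)
  show "f \<in> space (borel_of S) \<rightarrow> space (borel_of T)"
    using assms continuous_map_funspace by fastforce
  fix A assume "A \<in> sets (borel_of T)"
  then show "f -` A \<inter> space (borel_of S) \<in> sets (borel_of S)"
    unfolding sets_borel_of[of T]
  proof induction
    case (Basic U)
    then show ?case
      using openin_continuous_map_preimage[OF assms, of U] openin_sets_borel_of
      by (simp add: vimage_def Int_def conj_commute)
  next
    case (Compl A)
    have "f -` (topspace T - A) \<inter> space (borel_of S) = space (borel_of S) - f -` A \<inter> space (borel_of S)"
      using assms continuous_map_funspace by fastforce
    then show ?case using sets.compl_sets[OF Compl.IH] by simp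
  next
    case (Union A)
    have eq: "f -` (\<Union>i. A i) \<inter> space (borel_of S) = (\<Union>i. f -` A i \<inter> space (borel_of S))" by auto
    show ?case unfolding eq by (rule sets.countable_nat_UN) (use Union.IH in blast)
  qed simp
qed

section \<open>A right Haar measure\<close>

text \<open>The measure is built from covering numbers by right translates of small neighbourhoods of the unit:
  their ratios give, in the limit, an invariant content on compact sets, and the content
  generates an outer measure for which open sets are Caratheodory measurable.\<close>

context lcsc
begin

lemma set_mult_mono: "A \<subseteq> A' \<Longrightarrow> B \<subseteq> B' \<Longrightarrow> A <#> B \<subseteq> A' <#> B'"
  unfolding set_mult_def by (intro UN_mono order_refl)

text \<open>This is the number \<open>(K : U)\<close> of right translates of \<open>U\<close> needed to cover \<open>K\<close>. The value is
  meaningful when some finite cover exists, as it does for compact \<open>K\<close> and open \<open>U\<close> around the unit.\<close>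

definition cover_number :: "'a set \<Rightarrow> 'a set \<Rightarrow> nat" where
  "cover_number U K = (LEAST n. \<exists>S. finite S \<and> S \<subseteq> carrier G \<and> card S = n \<and> K \<subseteq> U <#> S)"

lemma cover_number_le:
  "finite S \<Longrightarrow> S \<subseteq> carrier G \<Longrightarrow> K \<subseteq> U <#> S \<Longrightarrow> cover_number U K \<le> card S"
  unfolding cover_number_def by (rule Least_le) (intro exI[of _ S] conjI refl)

lemma optimal_cover:
  assumes "compactin T K" "openin T U" "\<one> \<in> U"
  obtains S where "finite S" "S \<subseteq> carrier G" "card S = cover_number U K" "K \<subseteq> U <#> S"
proof -
  have K: "K \<subseteq> carrier G" using assms compactin_carrier by auto
  have "\<forall>V\<in>(\<lambda>g. U #> g) ` K. openin T V" using assms K openin_r_coset by auto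
  moreover have "K \<subseteq> \<Union>((\<lambda>g. U #> g) ` K)"
    using K assms(3) by (force simp: r_coset_def)
  ultimately obtain \<F> where "finite \<F>" "\<F> \<subseteq> (\<lambda>g. U #> g) ` K" "K \<subseteq> \<Union>\<F>"
    using assms(1) unfolding compactin_def by meson
  then obtain S where S: "finite S" "S \<subseteq> K" "\<F> = (\<lambda>g. U #> g) ` S"
    by (meson finite_subset_image)
  have "K \<subseteq> U <#> S" using \<open>K \<subseteq> \<Union>\<F>\<close> unfolding S(3) set_mult_def r_coset_def by blast
  then have "\<exists>n S. finite S \<and> S \<subseteq> carrier G \<and> card S = n \<and> K \<subseteq> U <#> S" using S K by blast
  then have "\<exists>S. finite S \<and> S \<subseteq> carrier G \<and> card S = cover_number U K \<and> K \<subseteq> U <#> S"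
    unfolding cover_number_def by (rule LeastI_ex)
  then show ?thesis using that by blast
qed

lemma cover_number_mono:
  assumes "compactin T L" "openin T U" "\<one> \<in> U" "K \<subseteq> L"
  shows "cover_number U K \<le> cover_number U L"
proof -
  obtain S where S: "finite S" "S \<subseteq> carrier G" "card S = cover_number U L" "L \<subseteq> U <#> S"
    using optimal_cover[OF assms(1-3)] .
  then show ?thesis using cover_number_le[OF S(1,2), of K U] assms(4) by auto
qed

lemma cover_number_Un_le:
  assumes "compactin T K" "compactin T L" "openin T U" "\<one> \<in> U"
  shows "cover_number U (K \<union> L) \<le> cover_number U K + cover_number U L"
proof -
  obtain S where S: "finite S" "S \<subseteq> carrier G" "card S = cover_number U K" "K \<subseteq> U <#> S"
    using optimal_cover[OF assms(1,3,4)] .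
  obtain R where R: "finite R" "R \<subseteq> carrier G" "card R = cover_number U L" "L \<subseteq> U <#> R"
    using optimal_cover[OF assms(2,3,4)] .
  have "K \<union> L \<subseteq> U <#> (S \<union> R)" using S(4) R(4) set_mult_mono[of U U S "S \<union> R"] set_mult_mono[of U U R "S \<union> R"] by blast
  then have "cover_number U (K \<union> L) \<le> card (S \<union> R)" using S R cover_number_le by simp
  then show ?thesis using S R card_Un_le[of S R] by simp
qed

text \<open>When no translate of \<open>U\<close> meets both sets, an optimal cover of the union splits into a cover
  of each part. Only this makes the limit content additive.\<close>

lemma cover_number_Un_disjoint:
  assumes "compactin T K" "compactin T L" "openin T U" "\<one> \<in> U"
    and sep: "\<And>g. g \<in> carrier G \<Longrightarrow> (U #> g) \<inter> K = {} \<or> (U #> g) \<inter> L = {}"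
  shows "cover_number U (K \<union> L) = cover_number U K + cover_number U L"
proof (rule antisym)
  obtain S where S: "finite S" "S \<subseteq> carrier G" "card S = cover_number U (K \<union> L)" "K \<union> L \<subseteq> U <#> S"
    using optimal_cover[OF compactin_Un[OF assms(1,2)] assms(3,4)] .
  define A where "A = {g \<in> S. (U #> g) \<inter> K \<noteq> {}}"
  define B where "B = {g \<in> S. (U #> g) \<inter> L \<noteq> {}}"
  have "\<exists>u\<in>U. \<exists>s\<in>S. x = u \<otimes> s" if "x \<in> K \<union> L" for x
    using S(4) that mem_set_mult by blast
  then have "K \<subseteq> U <#> A" "L \<subseteq> U <#> B"
    by (fastforce simp: A_def B_def mem_set_mult mem_r_coset)+
  then have "cover_number U K \<le> card A" "cover_number U L \<le> card B"
    using S by (auto simp: A_def B_def intro!: cover_number_le)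
  moreover have "A \<inter> B = {}" using sep S(2) by (auto simp: A_def B_def)
  then have "card A + card B = card (A \<union> B)"
    using S(1) by (simp add: card_Un_disjoint A_def B_def)
  moreover have "card (A \<union> B) \<le> card S" using S(1) by (intro card_mono) (auto simp: A_def B_def)
  ultimately show "cover_number U K + cover_number U L \<le> cover_number U (K \<union> L)" using S(3) by simp
qed (rule cover_number_Un_le[OF assms(1-4)])

lemma cover_number_r_coset_le:
  assumes "compactin T K" "openin T U" "\<one> \<in> U" "g \<in> carrier G"
  shows "cover_number U (K #> g) \<le> cover_number U K"
proof -
  obtain S where S: "finite S" "S \<subseteq> carrier G" "card S = cover_number U K" "K \<subseteq> U <#> S"
    using optimal_cover[OF assms(1,2,3)] .
  have U: "U \<subseteq> carrier G" using assms openin_carrier by auto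
  have "K #> g \<subseteq> (U <#> S) #> g" using S(4) by (auto simp: r_coset_def)
  also have "\<dots> = U <#> (S #> g)" using U S(2) assms(4) by (simp add: setmult_rcos_assoc)
  finally have "cover_number U (K #> g) \<le> card (S #> g)"
    using S assms(4) r_coset_subset_G by (intro cover_number_le) (auto simp: r_coset_def)
  also have "\<dots> \<le> card S"
    unfolding r_coset_def UNION_singleton_eq_range by (rule card_image_le[OF S(1)])
  finally show ?thesis using S by simp
qed

lemma cover_number_r_coset:
  assumes "compactin T K" "openin T U" "\<one> \<in> U" "g \<in> carrier G"
  shows "cover_number U (K #> g) = cover_number U K"
proof (rule antisym[OF cover_number_r_coset_le[OF assms]])
  have "K #> g #> inv g = K"
    using assms compactin_carrier by (simp add: coset_mult_assoc coset_mult_one)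
  then show "cover_number U K \<le> cover_number U (K #> g)"
    using cover_number_r_coset_le[OF compactin_r_coset[OF assms(1,4)] assms(2,3), of "inv g"] assms(4) by simp
qed

text \<open>Covering the translates of \<open>V\<close> in turn bounds the ratios \<open>(K : U) / (L : U)\<close> independently of \<open>U\<close>, so
  that they stay in a compact interval.\<close>

lemma cover_number_trans:
  assumes "compactin T K" "compactin T L" "openin T U" "\<one> \<in> U" "openin T V" "\<one> \<in> V" "V \<subseteq> L"
  shows "cover_number U K \<le> cover_number V K * cover_number U L"
proof -
  obtain S where S: "finite S" "S \<subseteq> carrier G" "card S = cover_number V K" "K \<subseteq> V <#> S"
    using optimal_cover[OF assms(1,5,6)] .
  obtain R where R: "finite R" "R \<subseteq> carrier G" "card R = cover_number U L" "L \<subseteq> U <#> R"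
    using optimal_cover[OF assms(2-4)] .
  have U: "U \<subseteq> carrier G" using assms openin_carrier by auto
  have RS: "R <#> S = (\<lambda>(r, s). r \<otimes> s) ` (R \<times> S)" by (auto simp: set_mult_def)
  have "K \<subseteq> (U <#> R) <#> S" using S(4) R(4) assms(7) set_mult_mono[of V "U <#> R" S S] by blast
  also have "\<dots> = U <#> (R <#> S)" using U R(2) S(2) by (simp add: set_mult_assoc)
  finally have "cover_number U K \<le> card (R <#> S)"
    using R S by (intro cover_number_le) (auto simp: RS)
  also have "\<dots> \<le> card (R \<times> S)" unfolding RS using R S by (intro card_image_le) auto
  finally show ?thesis using R S by (simp add: card_cartesian_product mult.commute)
qed

lemma compact_nbhd_one:
  obtains V K where "openin T V" "compactin T K" "\<one> \<in> V" "V \<subseteq> K"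
  using locally_compact_T unfolding locally_compact_space_def topspace_T by (meson one_closed)

text \<open>A filter on the sets \<open>U\<close> themselves, not on group elements: eventually means for all sufficiently
  small open neighbourhoods of the unit.\<close>

definition nbhds_one :: "'a set filter" where
  "nbhds_one = (INF W\<in>{W. openin T W \<and> \<one> \<in> W}. principal {U. openin T U \<and> \<one> \<in> U \<and> U \<subseteq> W})"

lemma eventually_nbhds_one:
  "eventually P nbhds_one \<longleftrightarrow>
     (\<exists>W. openin T W \<and> \<one> \<in> W \<and> (\<forall>U. openin T U \<longrightarrow> \<one> \<in> U \<longrightarrow> U \<subseteq> W \<longrightarrow> P U))"
proof -
  let ?B = "{W. openin T W \<and> \<one> \<in> W}" and ?F = "\<lambda>W. principal {U. openin T U \<and> \<one> \<in> U \<and> U \<subseteq> W}"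
  have "carrier G \<in> ?B" using openin_topspace[of T] by simp
  then have "eventually P nbhds_one \<longleftrightarrow>
      (\<exists>W\<in>?B. eventually P (?F W))"
    unfolding nbhds_one_def
  proof (intro eventually_INF_base)
    fix A B assume "A \<in> ?B" "B \<in> ?B"
    then show "\<exists>W\<in>?B. ?F W \<le> inf (?F A) (?F B)"
      by (intro bexI[of _ "A \<inter> B"]) auto
  qed auto
  then show ?thesis by (auto simp: eventually_principal)
qed

lemma nbhds_one_neq_bot: "nbhds_one \<noteq> bot"
  unfolding trivial_limit_def eventually_nbhds_one by blast

text \<open>The normalized covering numbers lie in a product of compact intervals, so by Tychonoff they have a
  cluster point as \<open>U\<close> shrinks to the unit. Any closed condition on finitely many coordinates
  that holds eventually passes to the cluster point. A subsequence would not do, because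
  uncountably many compact sets are involved.\<close>

theorem Haar_content:
  obtains c :: "'a set \<Rightarrow> real" and K0 where
    "\<And>K. 0 \<le> c K"
    "\<And>K L. compactin T K \<Longrightarrow> compactin T L \<Longrightarrow> K \<subseteq> L \<Longrightarrow> c K \<le> c L"
    "\<And>K L. compactin T K \<Longrightarrow> compactin T L \<Longrightarrow> c (K \<union> L) \<le> c K + c L"
    "\<And>K L. compactin T K \<Longrightarrow> compactin T L \<Longrightarrow> K \<inter> L = {} \<Longrightarrow> c (K \<union> L) = c K + c L"
    "\<And>K g. compactin T K \<Longrightarrow> g \<in> carrier G \<Longrightarrow> c (K #> g) = c K"
    "compactin T K0" "c K0 = 1"
proof -
  obtain V K0 where V: "openin T V" "compactin T K0" "\<one> \<in> V" "V \<subseteq> K0" by (rule compact_nbhd_one)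
  define r :: "'a set \<Rightarrow> 'a set \<Rightarrow> real" where
    "r U K = (if compactin T K then cover_number U K / cover_number U K0 else 0)" for U K
  have pos: "cover_number U K0 > 0" if U: "openin T U" "\<one> \<in> U" for U
  proof -
    obtain S where S: "finite S" "card S = cover_number U K0" "K0 \<subseteq> U <#> S"
      using optimal_cover[OF V(2) U] by metis
    have "S \<noteq> {}" using S(3) V(3,4) by (auto simp: set_mult_def)
    then show ?thesis using S by (metis card_gt_0_iff)
  qed
  have ev: "eventually P nbhds_one" if "\<And>U. openin T U \<Longrightarrow> \<one> \<in> U \<Longrightarrow> P U" for P
    unfolding eventually_nbhds_one using that V by blast
  define C where "C = (\<Pi>\<^sub>E K\<in>UNIV. {0..real (cover_number V K)})"
  have "compactin (product_topology (\<lambda>_. euclideanreal) UNIV) C"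
    unfolding C_def by (simp add: compactin_PiE)
  then have "compact C" by (simp add: euclidean_product_topology)
  moreover have "eventually (\<lambda>U. r U \<in> C) nbhds_one"
  proof (rule ev)
    fix U assume U: "openin T U" "\<one> \<in> U"
    have "r U K \<le> cover_number V K" for K
    proof (cases "compactin T K")
      case True
      have "real (cover_number U K) \<le> real (cover_number V K * cover_number U K0)"
        using cover_number_trans[OF True V(2) U V(1,3,4)] of_nat_mono by blast
      then show ?thesis using pos[OF U] by (simp add: r_def divide_le_eq)
    qed (simp add: r_def)
    then show "r U \<in> C" by (auto simp: C_def r_def)
  qed
  then have "eventually (\<lambda>f. f \<in> C) (filtermap r nbhds_one)" by (simp add: eventually_filtermap)
  moreover have "filtermap r nbhds_one \<noteq> bot" using nbhds_one_neq_bot by (simp add: filtermap_bot_iff)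
  ultimately obtain c where c: "inf (nhds c) (filtermap r nbhds_one) \<noteq> bot"
    unfolding compact_filter by blast
  have lim: "P c" if "closed {f. P f}" "eventually (\<lambda>U. P (r U)) nbhds_one" for P
  proof (rule ccontr)
    assume "\<not> P c"
    then have "eventually (\<lambda>f. f \<in> - {f. P f}) (nhds c)"
      using that(1) by (intro eventually_nhds_in_open) auto
    moreover have "eventually P (filtermap r nbhds_one)" using that(2) by (simp add: eventually_filtermap)
    ultimately have "eventually (\<lambda>f. False) (inf (nhds c) (filtermap r nbhds_one))"
      by (auto simp: eventually_inf)
    then show False using c by (simp add: trivial_limit_def)
  qed
  note cont = continuous_on_product_coordinates continuous_on_add continuous_on_const
  show ?thesis
  proof (rule that[of c K0])
    fix K L g
    show "0 \<le> c K"
      by (rule lim, intro closed_Collect_le cont, rule ev) (simp add: r_def)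
    assume K: "compactin T K"
    show "c (K #> g) = c K" if "g \<in> carrier G"
      by (rule lim, intro closed_Collect_eq cont, rule ev)
        (simp add: r_def cover_number_r_coset that K compactin_r_coset)
    assume L: "compactin T L"
    show "c K \<le> c L" if "K \<subseteq> L"
    proof (rule lim)
      show "\<forall>\<^sub>F U in nbhds_one. r U K \<le> r U L"
        using cover_number_mono[OF L _ _ that]
        by (intro ev) (simp add: r_def K L divide_right_mono)
    qed (intro closed_Collect_le cont)
    show "c (K \<union> L) \<le> c K + c L"
    proof (rule lim)
      show "\<forall>\<^sub>F U in nbhds_one. r U (K \<union> L) \<le> r U K + r U L"
      proof (rule ev)
        fix U assume U: "openin T U" "\<one> \<in> U"
        have "real (cover_number U (K \<union> L)) \<le> real (cover_number U K) + real (cover_number U L)"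
          using cover_number_Un_le[OF K L U] by linarith
        then show "r U (K \<union> L) \<le> r U K + r U L"
          by (simp add: r_def K L compactin_Un add_divide_distrib[symmetric] divide_right_mono)
      qed
    qed (intro closed_Collect_le cont)
    show "c (K \<union> L) = c K + c L" if disj: "K \<inter> L = {}"
    proof (rule lim)
      obtain W where W: "openin T W" "\<one> \<in> W"
        "\<And>g. g \<in> carrier G \<Longrightarrow> (W #> g) \<inter> K = {} \<or> (W #> g) \<inter> L = {}"
        using separating_nbhd[OF K L disj] by blast
      have "r U (K \<union> L) = r U K + r U L" if U: "openin T U" "\<one> \<in> U" "U \<subseteq> W" for U
      proof -
        have "U #> g \<subseteq> W #> g" for g using U(3) by (auto simp: r_coset_def)
        then have "cover_number U (K \<union> L) = cover_number U K + cover_number U L"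
          using W(3) by (intro cover_number_Un_disjoint K L U) blast
        then show ?thesis by (simp add: r_def K L compactin_Un add_divide_distrib[symmetric])
      qed
      then show "\<forall>\<^sub>F U in nbhds_one. r U (K \<union> L) = r U K + r U L"
        unfolding eventually_nbhds_one using W by blast
    qed (intro closed_Collect_eq cont)
  next
    show "c K0 = 1"
      by (rule lim, intro closed_Collect_eq cont, rule ev) (simp add: r_def V pos[THEN less_imp_neq, THEN not_sym])
  qed (rule V)
qed

lemma compactin_Diff: "compactin T K \<Longrightarrow> openin T U \<Longrightarrow> compactin T (K - U)"
proof -
  assume K: "compactin T K" "openin T U"
  have "(topspace T - U) \<inter> K = K - U" using compactin_carrier[OF K(1)] by auto
  then show ?thesis using closed_Int_compactin[of T "topspace T - U" K] K by (simp add: closedin_def openin_carrier double_diff)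
qed

text \<open>The parts of \<open>K\<close> outside \<open>U\<close> and outside \<open>V\<close> are disjoint compact sets. Removing disjoint open
  neighbourhoods of them from \<open>K\<close> gives the two pieces.\<close>

lemma compact_split:
  assumes K: "compactin T K" "K \<subseteq> U \<union> V" and U: "openin T U" and V: "openin T V"
  obtains K1 K2 where "compactin T K1" "compactin T K2" "K1 \<subseteq> U" "K2 \<subseteq> V" "K = K1 \<union> K2"
proof -
  have "disjnt (K - U) (K - V)" using K(2) by (auto simp: disjnt_def)
  then obtain P Q where PQ: "openin T P" "openin T Q" "K - U \<subseteq> P" "K - V \<subseteq> Q" "disjnt P Q"
    using Hausdorff_space_compact_separation[OF Hausdorff_T compactin_Diff[OF K(1) U] compactin_Diff[OF K(1) V]]
    by blast
  show ?thesis
    by (rule that[of "K - P" "K - Q"]) (use PQ K compactin_Diff in \<open>auto simp: disjnt_def\<close>)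
qed

text \<open>Inner approximation by compact sets extends the content to open sets, and outer approximation by
  open sets extends it to all sets. Subadditivity comes from splitting compact sets along open covers,
  the Caratheodory condition for open sets from additivity of the content on disjoint compact sets.\<close>

theorem Haar_measure:
  obtains \<mu> where "sets \<mu> = sets (borel_of T)" "sigma_finite_measure \<mu>" "emeasure \<mu> (carrier G) \<noteq> 0"
    "\<And>g. g \<in> carrier G \<Longrightarrow> distr \<mu> \<mu> (\<lambda>x. x \<otimes> g) = \<mu>"
proof -
  obtain c :: "'a set \<Rightarrow> real" and K0 where
    c_nonneg: "\<And>K. 0 \<le> c K" and
    c_mono: "\<And>K L. compactin T K \<Longrightarrow> compactin T L \<Longrightarrow> K \<subseteq> L \<Longrightarrow> c K \<le> c L" and
    c_sub: "\<And>K L. compactin T K \<Longrightarrow> compactin T L \<Longrightarrow> c (K \<union> L) \<le> c K + c L" and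
    c_add: "\<And>K L. compactin T K \<Longrightarrow> compactin T L \<Longrightarrow> K \<inter> L = {} \<Longrightarrow> c (K \<union> L) = c K + c L" and
    c_inv: "\<And>K g. compactin T K \<Longrightarrow> g \<in> carrier G \<Longrightarrow> c (K #> g) = c K" and
    K0: "compactin T K0" "c K0 = 1"
    by (rule Haar_content) (rule that)
  have c_empty: "c {} = 0" using c_add[of "{}" "{}"] by simp
  \<comment> \<open>\<open>o'\<close> is the inner content of open sets, \<open>m\<close> the outer measure.\<close>
  define o' where "o' U = (SUP K\<in>{K. compactin T K \<and> K \<subseteq> U}. ennreal (c K))" for U
  define m where "m A = (INF U\<in>{U. openin T U \<and> A \<subseteq> U}. o' U)" for A
  have o'_ge: "ennreal (c K) \<le> o' U" if "compactin T K" "K \<subseteq> U" for K U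
    unfolding o'_def using that by (intro SUP_upper) auto
  have o'_mono: "o' U \<le> o' V" if "U \<subseteq> V" for U V
    unfolding o'_def using that by (intro SUP_subset_mono) auto
  have m_open: "m U = o' U" if "openin T U" for U
    unfolding m_def using that by (intro antisym INF_lower INF_greatest) (auto intro: o'_mono)
  have m_le: "m A \<le> o' U" if "openin T U" "A \<subseteq> U" for A U
    unfolding m_def using that by (intro INF_lower) auto
  have m_mono: "m A \<le> m B" if "A \<subseteq> B" for A B
    unfolding m_def using that by (intro INF_superset_mono) auto
  have m_approx: "\<exists>U. openin T U \<and> B \<subseteq> U \<and> o' U < y" if "m B < y" for B y
    using that unfolding m_def INF_less_iff by auto
  have o'_Un: "o' (U \<union> V) \<le> o' U + o' V" if "openin T U" "openin T V" for U V
    unfolding o'_def[of "U \<union> V"]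
  proof (rule SUP_least)
    fix K assume "K \<in> {K. compactin T K \<and> K \<subseteq> U \<union> V}"
    then obtain K1 K2 where K: "compactin T K1" "compactin T K2" "K1 \<subseteq> U" "K2 \<subseteq> V" "K = K1 \<union> K2"
      using compact_split[of K U V] \<open>openin T U\<close> \<open>openin T V\<close> by blast
    have "ennreal (c K) \<le> ennreal (c K1 + c K2)" using c_sub[of K1 K2] K by (intro ennreal_leI) simp
    also have "\<dots> = ennreal (c K1) + ennreal (c K2)" using c_nonneg by (simp add: ennreal_plus)
    also have "\<dots> \<le> o' U + o' V" using K by (intro add_mono o'_ge)
    finally show "ennreal (c K) \<le> o' U + o' V" .
  qed
  have m_empty: "m {} = 0"
  proof -
    have "{K. compactin T K \<and> K \<subseteq> {}} = {{}}" by auto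
    then show ?thesis using m_open[of "{}"] by (simp add: o'_def c_empty)
  qed
  have o'_UN_finite: "o' (\<Union>i<n. U i) \<le> (\<Sum>i<n. o' (U i))" if "\<And>i. openin T (U i)" for U :: "nat \<Rightarrow> 'a set" and n
  proof (induction n)
    case 0
    then show ?case using m_open[of "{}"] m_empty by simp
  next
    case (Suc n)
    have "o' (\<Union>i<Suc n. U i) = o' ((\<Union>i<n. U i) \<union> U n)"
      by (rule arg_cong[of _ _ o']) (auto simp: less_Suc_eq)
    also have "\<dots> \<le> o' (\<Union>i<n. U i) + o' (U n)" using that by (intro o'_Un) auto
    also have "\<dots> \<le> (\<Sum>i<Suc n. o' (U i))" using Suc by (simp add: add_right_mono)
    finally show ?case .
  qed
  have o'_UN: "o' (\<Union>i. U i) \<le> (\<Sum>i. o' (U i))" if U: "\<And>i. openin T (U i)" for U :: "nat \<Rightarrow> 'a set"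
    unfolding o'_def[of "\<Union>i. U i"]
  proof (rule SUP_least)
    fix K assume "K \<in> {K. compactin T K \<and> K \<subseteq> (\<Union>i. U i)}"
    then have K: "compactin T K" "K \<subseteq> (\<Union>i. U i)" by auto
    obtain \<F> where \<F>: "finite \<F>" "\<F> \<subseteq> range U" "K \<subseteq> \<Union>\<F>"
      using K U unfolding compactin_def by (metis (no_types, lifting) imageE)
    then obtain J where J: "finite J" "\<F> = U ` J" by (meson finite_subset_image)
    obtain n where n: "J \<subseteq> {..<n}" using J(1) finite_nat_bounded by auto
    have "K \<subseteq> (\<Union>i<n. U i)" using \<F>(3) J(2) n by blast
    then have "ennreal (c K) \<le> o' (\<Union>i<n. U i)" using K by (intro o'_ge)
    also have "\<dots> \<le> (\<Sum>i<n. o' (U i))" using U by (rule o'_UN_finite)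
    also have "\<dots> \<le> (\<Sum>i. o' (U i))" by (intro sum_le_suminf) auto
    finally show "ennreal (c K) \<le> (\<Sum>i. o' (U i))" .
  qed
  have csub: "countably_subadditive (Pow (carrier G)) m"
    unfolding countably_subadditive_def
  proof (intro allI impI)
    fix A :: "nat \<Rightarrow> 'a set" assume A: "range A \<subseteq> Pow (carrier G)"
    show "m (\<Union>i. A i) \<le> (\<Sum>i. m (A i))"
    proof (rule ennreal_le_epsilon)
      fix e :: real assume e: "0 < e" "(\<Sum>i. m (A i)) < Orderings.top"
      then have "m (A n) < m (A n) + e * (1/2)^Suc n" for n
        by (auto simp add: less_top dest!: ennreal_suminf_lessD)
      then have "\<exists>U. openin T U \<and> A n \<subseteq> U \<and> o' U < m (A n) + e * (1/2)^Suc n" for n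
        by (rule m_approx)
      then obtain U where U: "\<And>n. openin T (U n)" "\<And>n. A n \<subseteq> U n" "\<And>n. o' (U n) < m (A n) + e * (1/2)^Suc n"
        by metis
      have "m (\<Union>i. A i) \<le> o' (\<Union>i. U i)" using U(1,2) by (intro m_le) blast+
      also have "\<dots> \<le> (\<Sum>i. o' (U i))" using U(1) by (rule o'_UN)
      also have "\<dots> \<le> (\<Sum>n. m (A n) + e * (1/2) ^ Suc n)"
        by (intro suminf_le allI less_imp_le[OF U(3)]) auto
      also have "... = (\<Sum>n. m (A n)) + (\<Sum>n. ennreal e * ennreal ((1/2) ^ Suc n))"
        using \<open>0 < e\<close> by (subst suminf_add[symmetric])
                       (auto simp del: ennreal_suminf_cmult simp add: ennreal_mult[symmetric])
      also have "\<dots> = (\<Sum>n. m (A n)) + e"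
        unfolding ennreal_suminf_cmult
        by (subst suminf_ennreal_eq[OF zero_le_power power_half_series]) auto
      finally show "m (\<Union>i. A i) \<le> (\<Sum>n. m (A n)) + e" .
    qed
  qed
  have pos: "positive (Pow (carrier G)) m" by (simp add: positive_def m_empty)
  interpret P: sigma_algebra "carrier G" "Pow (carrier G)" by (rule sigma_algebra_Pow)
  have sub: "m (A \<union> B) \<le> m A + m B" if "A \<subseteq> carrier G" "B \<subseteq> carrier G" "A \<inter> B = {}" for A B
    using P.countably_subadditive_subadditive[OF pos csub] that by (auto dest: subadditiveD)
  define L where "L = lambda_system (carrier G) (Pow (carrier G)) m"
  have "outer_measure_space (Pow (carrier G)) m"
    unfolding outer_measure_space_def using pos csub m_mono by (auto simp: increasing_def)
  then have L: "measure_space (carrier G) L m"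
    unfolding L_def by (rule P.caratheodory_lemma)
  have open_L: "U \<in> L" if U: "openin T U" for U
    unfolding L_def P.lambda_system_eq
  proof (safe)
    fix A assume A: "A \<subseteq> carrier G"
    show "m (A \<inter> U) + m (A - U) = m A"
    proof (rule antisym)
      have "m ((A \<inter> U) \<union> (A - U)) \<le> m (A \<inter> U) + m (A - U)" using A by (intro sub) auto
      then show "m A \<le> m (A \<inter> U) + m (A - U)" by (simp add: Int_Diff_Un)
      show "m (A \<inter> U) + m (A - U) \<le> m A"
        unfolding m_def[of A]
      proof (rule INF_greatest)
        fix V assume "V \<in> {V. openin T V \<and> A \<subseteq> V}"
        then have V: "openin T V" "A \<subseteq> V" by auto
        have "m (A \<inter> U) \<le> o' (V \<inter> U)" using V U by (intro m_le) auto
        then have "m (A \<inter> U) + m (A - U) \<le> o' (V \<inter> U) + m (A - U)" by (rule add_right_mono)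
        also have "\<dots> = (SUP K\<in>{K. compactin T K \<and> K \<subseteq> V \<inter> U}. ennreal (c K) + m (A - U))"
          unfolding o'_def by (rule ennreal_SUP_add_left[symmetric]) (auto intro: exI[of _ "{}"])
        also have "\<dots> \<le> o' V"
        proof (rule SUP_least)
          fix K assume "K \<in> {K. compactin T K \<and> K \<subseteq> V \<inter> U}"
          then have K: "compactin T K" "K \<subseteq> V" "K \<subseteq> U" by auto
          have "openin T (V - K)" using V K Hausdorff_T compactin_imp_closedin openin_diff by blast
          then have "m (A - U) \<le> o' (V - K)" using V K by (intro m_le) auto
          then have "ennreal (c K) + m (A - U) \<le> ennreal (c K) + o' (V - K)" by (rule add_left_mono)
          also have "\<dots> = (SUP Q\<in>{Q. compactin T Q \<and> Q \<subseteq> V - K}. ennreal (c K) + ennreal (c Q))"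
            unfolding o'_def by (rule ennreal_SUP_add_right) (auto intro: exI[of _ "{}"])
          also have "\<dots> \<le> o' V"
          proof (rule SUP_least)
            fix Q assume "Q \<in> {Q. compactin T Q \<and> Q \<subseteq> V - K}"
            then have Q: "compactin T Q" "Q \<subseteq> V" "K \<inter> Q = {}" by auto
            have "ennreal (c K) + ennreal (c Q) = ennreal (c (K \<union> Q))"
              using c_add[OF K(1) Q(1,3)] c_nonneg by (simp add: ennreal_plus)
            also have "\<dots> \<le> o' V" using K Q by (intro o'_ge compactin_Un) auto
            finally show "ennreal (c K) + ennreal (c Q) \<le> o' V" .
          qed
          finally show "ennreal (c K) + m (A - U) \<le> o' V" .
        qed
        finally show "m (A \<inter> U) + m (A - U) \<le> o' V" .
      qed
    qed
  qed (use U openin_carrier in auto)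
  define \<mu> where "\<mu> = measure_of (carrier G) {U. openin T U} m"
  have gen: "{U. openin T U} \<subseteq> Pow (carrier G)" using openin_carrier by auto
  then have space: "space \<mu> = carrier G" and sets': "sets \<mu> = sigma_sets (carrier G) {U. openin T U}"
    by (simp_all add: \<mu>_def space_measure_of sets_measure_of)
  then have sets: "sets \<mu> = sets (borel_of T)" by (simp add: sets_borel_of)
  have "sigma_algebra (carrier G) L" using L by (simp add: measure_space_def)
  then have "sigma_sets (carrier G) {U. openin T U} \<subseteq> L"
    using open_L by (intro sigma_algebra.sigma_sets_subset) auto
  then have ms: "measure_space (carrier G) (sigma_sets (carrier G) {U. openin T U}) m"
    using openin_carrier by (intro measure_down[OF L] sigma_algebra_sigma_sets) auto
  have em: "emeasure \<mu> A = m A" if "A \<in> sets \<mu>" for A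
  proof (rule emeasure_measure_of[OF \<mu>_def])
    show "positive (sets \<mu>) m" "countably_additive (sets \<mu>) m"
      using ms by (auto simp: measure_space_def sets')
  qed (use openin_carrier that in auto)
  have open_sets: "U \<in> sets \<mu>" if "openin T U" for U using that by (auto simp: sets')
  have inv_le: "m (A #> g) \<le> m A" if g: "g \<in> carrier G" for A g
    unfolding m_def[of A]
  proof (rule INF_greatest)
    fix U assume "U \<in> {U. openin T U \<and> A \<subseteq> U}"
    then have U: "openin T U" "A \<subseteq> U" by auto
    have "m (A #> g) \<le> o' (U #> g)" using U g by (intro m_le openin_r_coset) (auto simp: r_coset_def)
    also have "\<dots> \<le> o' U"
      unfolding o'_def[of "U #> g"]
    proof (rule SUP_least)
      fix K assume "K \<in> {K. compactin T K \<and> K \<subseteq> U #> g}"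
      then have K: "compactin T K" "K \<subseteq> U #> g" by auto
      have "K #> inv g \<subseteq> (U #> g) #> inv g" using K(2) by (auto simp: r_coset_def)
      also have "\<dots> = U" using g openin_carrier[OF U(1)] by (simp add: coset_mult_assoc coset_mult_one)
      finally have "ennreal (c (K #> inv g)) \<le> o' U" using K g by (intro o'_ge compactin_r_coset) auto
      then show "ennreal (c K) \<le> o' U" using c_inv[OF K(1), of "inv g"] g by simp
    qed
    finally show "m (A #> g) \<le> o' U" .
  qed
  show ?thesis
  proof (rule that[OF sets])
    have "ennreal 1 \<le> o' (carrier G)" using o'_ge[OF K0(1) compactin_carrier[OF K0(1)]] K0(2) by simp
    then show "emeasure \<mu> (carrier G) \<noteq> 0"
      using em[of "carrier G"] open_sets[of "carrier G"] m_open[of "carrier G"] openin_topspace[of T] by auto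
    show "sigma_finite_measure \<mu>"
    proof
      define \<A> where "\<A> = {V \<in> basis. \<exists>K. compactin T K \<and> V \<subseteq> K}"
      have fin: "emeasure \<mu> V \<noteq> \<infinity>" if V: "V \<in> \<A>" for V
      proof -
        obtain K where K: "openin T V" "compactin T K" "V \<subseteq> K" using V basis(2) unfolding \<A>_def by blast
        have "o' V \<le> ennreal (c K)" unfolding o'_def using K by (intro SUP_least ennreal_leI c_mono) auto
        then show ?thesis using em[OF open_sets[OF K(1)]] m_open[OF K(1)]
          by (metis ennreal_neq_top infinity_ennreal_def top.extremum_unique)
      qed
      have cover: "x \<in> \<Union>\<A>" if x: "x \<in> carrier G" for x
      proof -
        obtain U K where U: "openin T U" "compactin T K" "x \<in> U" "U \<subseteq> K"
          using locally_compact_T x unfolding locally_compact_space_def topspace_T by blast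
        obtain V where V: "V \<in> basis" "x \<in> V" "V \<subseteq> U" using basis(3)[OF U(1,3)] by blast
        then show ?thesis using U(2,4) unfolding \<A>_def by blast
      qed
      have "\<A> \<subseteq> basis" by (auto simp: \<A>_def)
      then have "countable \<A>" "\<A> \<subseteq> sets \<mu>" using basis(1,2) open_sets countable_subset by blast+
      moreover have "\<Union>\<A> = space \<mu>" unfolding space
        using cover basis(2) openin_carrier \<open>\<A> \<subseteq> basis\<close> by blast
      ultimately show "\<exists>A. countable A \<and> A \<subseteq> sets \<mu> \<and> \<Union> A = space \<mu> \<and> (\<forall>a\<in>A. emeasure \<mu> a \<noteq> \<infinity>)"
        by (intro exI[of _ \<A>] conjI ballI fin)
    qed
    fix g assume g: "g \<in> carrier G"
    have meas: "(\<lambda>x. x \<otimes> g) \<in> measurable \<mu> \<mu>"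
      using continuous_map_measurable[OF continuous_right_mult[OF g]]
      by (simp cong: measurable_cong_sets add: sets)
    show "distr \<mu> \<mu> (\<lambda>x. x \<otimes> g) = \<mu>"
    proof (rule measure_eqI)
      fix A assume "A \<in> sets (distr \<mu> \<mu> (\<lambda>x. x \<otimes> g))"
      then have A: "A \<in> sets \<mu>" by simp
      then have Ac: "A \<subseteq> carrier G" using sets.sets_into_space space by blast
      have pre: "(\<lambda>x. x \<otimes> g) -` A \<inter> space \<mu> = A #> inv g"
        using r_coset_preimage[OF Ac, of "inv g"] g by (auto simp: space)
      have A': "A #> inv g \<in> sets \<mu>" using measurable_sets[OF meas A] pre by simp
      have "emeasure (distr \<mu> \<mu> (\<lambda>x. x \<otimes> g)) A = m (A #> inv g)"
        using emeasure_distr[OF meas A] em[OF A'] pre by simp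
      also have "\<dots> = m A"
      proof (rule antisym)
        show "m (A #> inv g) \<le> m A" using g by (intro inv_le) auto
        have "A #> inv g #> g = A" using g Ac by (simp add: coset_mult_assoc coset_mult_one)
        then show "m A \<le> m (A #> inv g)" using inv_le[OF g, of "A #> inv g"] by simp
      qed
      finally show "emeasure (distr \<mu> \<mu> (\<lambda>x. x \<otimes> g)) A = emeasure \<mu> A" using em[OF A] by simp
    qed simp
  qed
qed

end

section \<open>Baire category\<close>

definition meager_in :: "'a topology \<Rightarrow> 'a set \<Rightarrow> bool" where
  "meager_in T A \<longleftrightarrow>
     (\<exists>\<C>. countable \<C> \<and> (\<forall>C\<in>\<C>. closedin T C \<and> T interior_of C = {}) \<and> A \<subseteq> \<Union>\<C>)"

lemma meager_in_subset: "meager_in T B \<Longrightarrow> A \<subseteq> B \<Longrightarrow> meager_in T A"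
  unfolding meager_in_def by (meson subset_trans)

lemma meager_in_empty [simp]: "meager_in T {}"
  unfolding meager_in_def by (rule exI[of _ "{}"]) auto

lemma meager_in_nowhere_dense: "closedin T C \<Longrightarrow> T interior_of C = {} \<Longrightarrow> meager_in T C"
  unfolding meager_in_def by (rule exI[of _ "{C}"]) auto

lemma meager_in_UN:
  assumes "countable I" "\<And>i. i \<in> I \<Longrightarrow> meager_in T (A i)"
  shows "meager_in T (\<Union>i\<in>I. A i)"
proof -
  have "\<forall>i\<in>I. \<exists>\<C>. countable \<C> \<and> (\<forall>C\<in>\<C>. closedin T C \<and> T interior_of C = {}) \<and> A i \<subseteq> \<Union>\<C>"
    using assms(2) unfolding meager_in_def by blast
  then obtain \<C> where \<C>: "\<And>i. i \<in> I \<Longrightarrow> countable (\<C> i)" "\<And>i. i \<in> I \<Longrightarrow> A i \<subseteq> \<Union>(\<C> i)"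
    "\<And>i C. i \<in> I \<Longrightarrow> C \<in> \<C> i \<Longrightarrow> closedin T C \<and> T interior_of C = {}"
    by metis
  have "countable (\<Union>i\<in>I. \<C> i)" using assms(1) \<C>(1) by (rule countable_UN)
  moreover have "\<forall>C\<in>(\<Union>i\<in>I. \<C> i). closedin T C \<and> T interior_of C = {}" using \<C>(3) by auto
  moreover have "(\<Union>i\<in>I. A i) \<subseteq> \<Union>(\<Union>i\<in>I. \<C> i)"
  proof
    fix x assume "x \<in> (\<Union>i\<in>I. A i)"
    then obtain i where "i \<in> I" "x \<in> A i" by blast
    then show "x \<in> \<Union>(\<Union>i\<in>I. \<C> i)" using \<C>(2)[of i] by blast
  qed
  ultimately show ?thesis unfolding meager_in_def by (intro exI[of _ "\<Union>i\<in>I. \<C> i"] conjI)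
qed

lemma meager_in_Un: "meager_in T A \<Longrightarrow> meager_in T B \<Longrightarrow> meager_in T (A \<union> B)"
  using meager_in_UN[of "{True, False}" T "\<lambda>b. if b then A else B"] by (simp add: Un_commute)

lemma meager_open_empty:
  assumes "locally_compact_space T" "regular_space T" "openin T U" "meager_in T U"
  shows "U = {}"
proof -
  obtain \<C> where \<C>: "countable \<C>" "\<And>C. C \<in> \<C> \<Longrightarrow> closedin T C \<and> T interior_of C = {}" "U \<subseteq> \<Union>\<C>"
    using assms(4) unfolding meager_in_def by blast
  have "T interior_of (\<Union>\<C>) = {}" using assms(1,2) \<C>(1,2) by (intro Baire_category_alt) auto
  then show ?thesis using interior_of_maximal[OF \<C>(3) assms(3)] by simp
qed

lemma meager_frontier:
  assumes "openin T U"
  shows "meager_in T (T closure_of U - U)"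
proof (rule meager_in_nowhere_dense)
  show "closedin T (T closure_of U - U)" using assms by (simp add: closedin_diff)
  have "W = {}" if W: "W \<subseteq> T closure_of U - U" "openin T W" for W
  proof (rule ccontr)
    assume "W \<noteq> {}"
    then obtain x where "x \<in> W" "x \<in> T closure_of U" using W by auto
    then show False using W unfolding in_closure_of by blast
  qed
  then show "T interior_of (T closure_of U - U) = {}"
    using interior_of_subset openin_interior_of by metis
qed

text \<open>The witness \<open>U\<close> is an open set that differs from \<open>A\<close> by a meager set.\<close>

definition baire_property :: "'a topology \<Rightarrow> 'a set \<Rightarrow> bool" where
  "baire_property T A \<longleftrightarrow> (\<exists>U. openin T U \<and> meager_in T (A - U) \<and> meager_in T (U - A))"

text \<open>For complements, the interior of the complement of the witness serves as the new witness: the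
  boundary of an open set is nowhere dense.\<close>

lemma baire_property_borel:
  assumes "A \<in> sets (borel_of T)"
  shows "baire_property T A"
  using assms unfolding sets_borel_of
proof induction
  case (Basic U)
  then show ?case unfolding baire_property_def by (intro exI[of _ U]) auto
next
  case Empty
  then show ?case unfolding baire_property_def by (intro exI[of _ "{}"]) auto
next
  case (Compl A)
  then obtain U where U: "openin T U" "meager_in T (A - U)" "meager_in T (U - A)"
    unfolding baire_property_def by blast
  let ?V = "topspace T - T closure_of U"
  have "meager_in T ((topspace T - A) - ?V)"
    by (rule meager_in_subset[OF meager_in_Un[OF U(3) meager_frontier[OF U(1)]]]) auto
  moreover have "meager_in T (?V - (topspace T - A))"
    using closure_of_subset[OF openin_subset[OF U(1)]] by (intro meager_in_subset[OF U(2)]) auto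
  moreover have "openin T ?V" by (simp add: openin_diff)
  ultimately show ?case unfolding baire_property_def by blast
next
  case (Union A)
  then have "\<forall>i. \<exists>U. openin T U \<and> meager_in T (A i - U) \<and> meager_in T (U - A i)"
    unfolding baire_property_def by blast
  then obtain U where U: "\<And>i::nat. openin T (U i)" "\<And>i. meager_in T (A i - U i)" "\<And>i. meager_in T (U i - A i)"
    by metis
  have m: "meager_in T (\<Union>i. A i - U i)" "meager_in T (\<Union>i. U i - A i)"
    using U by (intro meager_in_UN; simp)+
  have "meager_in T ((\<Union>i. A i) - (\<Union>i. U i))" by (rule meager_in_subset[OF m(1)]) blast
  moreover have "meager_in T ((\<Union>i. U i) - (\<Union>i. A i))" by (rule meager_in_subset[OF m(2)]) blast
  moreover have "openin T (\<Union>i. U i)" using U(1) by auto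
  ultimately show ?case unfolding baire_property_def by blast
qed

lemma nonmeager_comeager_somewhere:
  assumes "A \<in> sets (borel_of T)" "openin T U" "\<not> meager_in T (U \<inter> A)"
  obtains V where "openin T V" "V \<noteq> {}" "V \<subseteq> U" "meager_in T (V - A)"
proof -
  obtain W where W: "openin T W" "meager_in T (A - W)" "meager_in T (W - A)"
    using baire_property_borel[OF assms(1)] unfolding baire_property_def by blast
  have "U \<inter> W \<noteq> {}"
  proof
    assume "U \<inter> W = {}"
    then have "meager_in T (U \<inter> A)" by (intro meager_in_subset[OF W(2)]) auto
    then show False using assms(3) by simp
  qed
  moreover have "meager_in T (U \<inter> W - A)" by (rule meager_in_subset[OF W(3)]) auto
  ultimately show ?thesis using W(1) assms(2) by (intro that[of "U \<inter> W"]) auto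
qed

text \<open>A category analogue of the measurability part of Fubini's theorem, by induction over the product
  \<open>\<sigma>\<close>-algebra. The complement is the interesting step: since sections have the Baire property, the
  complement of a section is meager in \<open>U\<close> iff the section is non-meager in every basic open
  subset of \<open>U\<close>, and this is a countable condition.\<close>

lemma measurable_meager_sections:
  assumes T: "locally_compact_space T" "regular_space T" "second_countable T"
    and E: "E \<in> sets (borel_of T \<Otimes>\<^sub>M M)" and U: "openin T U"
  shows "{x \<in> space M. meager_in T (U \<inter> (\<lambda>g. (g, x)) -` E)} \<in> sets M"
proof -
  obtain \<B> where \<B>: "countable \<B>" "\<And>V. V \<in> \<B> \<Longrightarrow> openin T V"
    "\<And>U x. openin T U \<Longrightarrow> x \<in> U \<Longrightarrow> \<exists>V\<in>\<B>. x \<in> V \<and> V \<subseteq> U"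
    using T(3) unfolding second_countable_def by metis
  show ?thesis
    using E U unfolding sets_pair_measure
  proof (induction arbitrary: U)
    case (Basic R)
    then obtain a b where R: "R = a \<times> b" "b \<in> sets M" by auto
    have "U \<inter> (\<lambda>g. (g, x)) -` R = (if x \<in> b then U \<inter> a else {})" for x by (auto simp: R(1))
    then have "{x \<in> space M. meager_in T (U \<inter> (\<lambda>g. (g, x)) -` R)}
        = (if meager_in T (U \<inter> a) then space M else space M - b)"
      using sets.sets_into_space[OF R(2)] by auto
    then show ?case using R(2) by simp
  next
    case Empty
    then show ?case by simp
  next
    case (Compl E)
    have borel: "(\<lambda>g. (g, x)) -` E \<in> sets (borel_of T)" for x
      using Compl.hyps by (intro sets_Pair2[where ?M2.0 = M]) (simp add: sets_pair_measure)
    define I where "I = {V \<in> \<B>. V \<noteq> {} \<and> V \<subseteq> U}"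
    have "meager_in T (U - (\<lambda>g. (g, x)) -` E) \<longleftrightarrow> (\<forall>V\<in>I. \<not> meager_in T (V \<inter> (\<lambda>g. (g, x)) -` E))" for x
    proof
      assume m: "meager_in T (U - (\<lambda>g. (g, x)) -` E)"
      show "\<forall>V\<in>I. \<not> meager_in T (V \<inter> (\<lambda>g. (g, x)) -` E)"
      proof (intro ballI notI)
        fix V assume V: "V \<in> I" "meager_in T (V \<inter> (\<lambda>g. (g, x)) -` E)"
        have "meager_in T V" using V(1) by (intro meager_in_subset[OF meager_in_Un[OF V(2) m]]) (auto simp: I_def)
        then show False using meager_open_empty[OF T(1,2)] \<B>(2) V(1) by (auto simp: I_def)
      qed
    next
      assume *: "\<forall>V\<in>I. \<not> meager_in T (V \<inter> (\<lambda>g. (g, x)) -` E)"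
      show "meager_in T (U - (\<lambda>g. (g, x)) -` E)"
      proof (rule ccontr)
        let ?C = "topspace T - (\<lambda>g. (g, x)) -` E"
        assume "\<not> meager_in T (U - (\<lambda>g. (g, x)) -` E)"
        moreover have "U - (\<lambda>g. (g, x)) -` E = U \<inter> ?C" using openin_subset[OF Compl.prems] by auto
        ultimately have "\<not> meager_in T (U \<inter> ?C)" by simp
        moreover have "?C \<in> sets (borel_of T)" using sets.compl_sets[OF borel[of x]] by simp
        ultimately obtain V where V: "openin T V" "V \<noteq> {}" "V \<subseteq> U" "meager_in T (V - ?C)"
          using nonmeager_comeager_somewhere[of ?C T U] Compl.prems by metis
        obtain W where W: "W \<in> \<B>" "W \<noteq> {}" "W \<subseteq> V" using \<B>(3)[OF V(1)] V(2) by blast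
        have "meager_in T (W \<inter> (\<lambda>g. (g, x)) -` E)" using W(3) by (intro meager_in_subset[OF V(4)]) auto
        moreover have "W \<in> I" using W V(3) by (auto simp: I_def)
        ultimately show False using * by blast
      qed
    qed
    moreover have "U \<inter> (\<lambda>g. (g, x)) -` (space (borel_of T) \<times> space M - E) = U - (\<lambda>g. (g, x)) -` E"
      if "x \<in> space M" for x
      using that openin_subset[OF Compl.prems] by auto
    ultimately have "{x \<in> space M. meager_in T (U \<inter> (\<lambda>g. (g, x)) -` (space (borel_of T) \<times> space M - E))}
        = {x \<in> space M. \<forall>V\<in>I. \<not> meager_in T (V \<inter> (\<lambda>g. (g, x)) -` E)}" by auto
    moreover have "countable I" using \<B>(1) by (auto simp: I_def)
    have "{x \<in> space M. \<forall>V\<in>I. \<not> meager_in T (V \<inter> (\<lambda>g. (g, x)) -` E)} \<in> sets M"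
    proof (rule sets.sets_Collect_countable_All'[OF _ \<open>countable I\<close>])
      fix V assume "V \<in> I"
      then show "{x \<in> space M. \<not> meager_in T (V \<inter> (\<lambda>g. (g, x)) -` E)} \<in> sets M"
        using Compl.IH[of V] \<B>(2) by (intro sets.sets_Collect_neg) (auto simp: I_def)
    qed
    ultimately show ?case by simp
  next
    case (Union E)
    have "meager_in T (U \<inter> (\<lambda>g. (g, x)) -` (\<Union>i. E i)) \<longleftrightarrow> (\<forall>i. meager_in T (U \<inter> (\<lambda>g. (g, x)) -` E i))" for x
    proof
      assume "meager_in T (U \<inter> (\<lambda>g. (g, x)) -` (\<Union>i. E i))"
      then show "\<forall>i. meager_in T (U \<inter> (\<lambda>g. (g, x)) -` E i)"
        by (intro allI) (erule meager_in_subset, auto)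
    next
      assume "\<forall>i. meager_in T (U \<inter> (\<lambda>g. (g, x)) -` E i)"
      then have "meager_in T (\<Union>i. U \<inter> (\<lambda>g. (g, x)) -` E i)" by (intro meager_in_UN) auto
      then show "meager_in T (U \<inter> (\<lambda>g. (g, x)) -` (\<Union>i. E i))" by (rule meager_in_subset) auto
    qed
    then show ?case using Union.IH[OF Union.prems] by (simp add: sets.sets_Collect_countable_All)
  qed
qed

context lcsc
begin

lemma nonempty_open_not_meager: "openin T U \<Longrightarrow> U \<noteq> {} \<Longrightarrow> \<not> meager_in T U"
  using meager_open_empty locally_compact_T regular_T by blast

lemma closedin_carrier: "closedin T C \<Longrightarrow> C \<subseteq> carrier G"
  using closedin_subset by fastforce

lemma closedin_r_coset: "closedin T C \<Longrightarrow> a \<in> carrier G \<Longrightarrow> closedin T (C #> a)"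
  using closedin_continuous_map_preimage[OF continuous_right_mult, of "inv a" C]
  by (simp add: r_coset_preimage closedin_carrier)

lemma r_coset_inv_cancel: "A \<subseteq> carrier G \<Longrightarrow> g \<in> carrier G \<Longrightarrow> A #> g #> inv g = A"
  and r_coset_inv_cancel': "A \<subseteq> carrier G \<Longrightarrow> g \<in> carrier G \<Longrightarrow> A #> inv g #> g = A"
  by (simp_all add: coset_mult_assoc coset_mult_one)

lemma r_coset_mono: "A \<subseteq> B \<Longrightarrow> A #> g \<subseteq> B #> g"
  by (auto simp: r_coset_def)

lemma meager_r_coset:
  assumes "meager_in T A" "g \<in> carrier G"
  shows "meager_in T (A #> g)"
proof -
  obtain \<C> where \<C>: "countable \<C>" "\<And>C. C \<in> \<C> \<Longrightarrow> closedin T C \<and> T interior_of C = {}" "A \<subseteq> \<Union>\<C>"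
    using assms(1) unfolding meager_in_def by blast
  have "T interior_of (C #> g) = {}" if C: "C \<in> \<C>" for C
  proof -
    have c: "closedin T C" using \<C>(2)[OF C] by simp
    have "T interior_of (C #> g) #> inv g \<subseteq> C #> g #> inv g" by (rule r_coset_mono[OF interior_of_subset])
    also have "\<dots> = C" using c assms(2) closedin_carrier by (intro r_coset_inv_cancel) auto
    finally have "T interior_of (C #> g) #> inv g \<subseteq> T interior_of C"
      using assms(2) by (intro interior_of_maximal openin_r_coset openin_interior_of) auto
    then show ?thesis using \<C>(2)[OF C] by (auto simp: r_coset_def)
  qed
  then have "meager_in T (\<Union>C\<in>\<C>. C #> g)"
    using \<C>(1,2) assms(2) by (intro meager_in_UN meager_in_nowhere_dense closedin_r_coset) auto
  moreover have "A #> g \<subseteq> (\<Union>C\<in>\<C>. C #> g)" using \<C>(3) by (auto simp: r_coset_def)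
  ultimately show ?thesis by (rule meager_in_subset)
qed

text \<open>Every point of \<open>U\<close> has a basic neighbourhood inside a compact subset of \<open>U\<close>; one compact set for each
  such basic set suffices.\<close>

lemma open_sigma_compact:
  assumes "openin T U"
  obtains \<K> where "countable \<K>" "\<And>K. K \<in> \<K> \<Longrightarrow> compactin T K" "\<Union>\<K> = U"
proof -
  define I where "I = {V \<in> basis. \<exists>K. compactin T K \<and> V \<subseteq> K \<and> K \<subseteq> U}"
  have "\<forall>V\<in>I. \<exists>K. compactin T K \<and> V \<subseteq> K \<and> K \<subseteq> U" by (simp add: I_def)
  from bchoice[OF this]
  obtain K where K: "\<And>V. V \<in> I \<Longrightarrow> compactin T (K V) \<and> V \<subseteq> K V \<and> K V \<subseteq> U" by blast
  have nb: "neighbourhood_base_of (\<lambda>C. compactin T C \<and> closedin T C) T"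
    using locally_compact_regular_space_neighbourhood_base locally_compact_T regular_T by blast
  have "x \<in> (\<Union>V\<in>I. K V)" if x: "x \<in> U" for x
  proof -
    have "x \<in> topspace T" using x assms openin_subset by blast
    from bspec[OF nb[unfolded neighbourhood_base_of_def neighbourhood_base_at_def] this, rule_format, OF conjI[OF assms x]]
    obtain W C where W: "openin T W" "compactin T C" "x \<in> W" "W \<subseteq> C" "C \<subseteq> U" by (elim exE conjE)
    obtain V where "V \<in> basis" "x \<in> V" "V \<subseteq> W" using basis(3)[OF W(1,3)] by blast
    then have "V \<in> I" "x \<in> V" using W subset_trans[of V W C] by (auto simp: I_def)
    then show ?thesis using K[of V] by auto
  qed
  then have "U \<subseteq> \<Union>(K ` I)" by (rule subsetI)
  moreover have "\<Union>(K ` I) \<subseteq> U" using K by (intro UN_least) simp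
  ultimately have "\<Union>(K ` I) = U" by (rule equalityI[rotated])
  moreover have "countable (K ` I)" using basis(1) by (simp add: I_def)
  ultimately show ?thesis using K by (intro that[of "K ` I"]) auto
qed

end

section \<open>Orbits and stabilizers of measurable actions\<close>

locale lcsc_action = lcsc G T for G :: "'a monoid" (structure) and T +
  fixes M :: "'x measure" and \<phi> :: "'a \<Rightarrow> 'x \<Rightarrow> 'x"
  assumes G_space: "G_space G T M \<phi>"
begin

sublocale group_action G "space M" \<phi>
  using G_space by (simp add: G_space_def)

sublocale prob_space M
  using G_space by (simp add: G_space_def standard_prob_space_def)

lemma measurable_action: "(\<lambda>(g, x). \<phi> g x) \<in> measurable (borel_of T \<Otimes>\<^sub>M M) M"
  using G_space by (simp add: G_space_def)

lemma act_closed: "g \<in> carrier G \<Longrightarrow> x \<in> space M \<Longrightarrow> \<phi> g x \<in> space M"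
  using element_image by blast

lemma act_one: "x \<in> space M \<Longrightarrow> \<phi> \<one> x = x"
  using id_eq_one by (metis restrict_apply')

lemma act_mult: "g \<in> carrier G \<Longrightarrow> h \<in> carrier G \<Longrightarrow> x \<in> space M \<Longrightarrow> \<phi> (g \<otimes> h) x = \<phi> g (\<phi> h x)"
  using composition_rule by blast

lemma act_inv: "g \<in> carrier G \<Longrightarrow> x \<in> space M \<Longrightarrow> \<phi> (inv g) (\<phi> g x) = x"
  and act_inv': "g \<in> carrier G \<Longrightarrow> x \<in> space M \<Longrightarrow> \<phi> g (\<phi> (inv g) x) = x"
  using act_mult[of "inv g" g x] act_mult[of g "inv g" x] by (simp_all add: act_one)

lemma act_inject: "g \<in> carrier G \<Longrightarrow> x \<in> space M \<Longrightarrow> y \<in> space M \<Longrightarrow> \<phi> g x = \<phi> g y \<longleftrightarrow> x = y"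
  using act_inv by metis

lemma measurable_act: "g \<in> carrier G \<Longrightarrow> \<phi> g \<in> measurable M M"
  using measurable_comp[OF measurable_Pair1'[of g "borel_of T" M] measurable_action]
  by (simp add: comp_def)

text \<open>Finite intersections of a countable base of a Polish topology; closure under intersection is used to
  separate a point from finitely many others at once.\<close>

lemma separating_family:
  obtains \<A> where "countable \<A>" "\<A> \<subseteq> sets M" "\<And>A B. A \<in> \<A> \<Longrightarrow> B \<in> \<A> \<Longrightarrow> A \<inter> B \<in> \<A>"
    "\<And>x y. x \<in> space M \<Longrightarrow> y \<in> space M \<Longrightarrow> x \<noteq> y \<Longrightarrow> \<exists>A\<in>\<A>. x \<in> A \<and> y \<notin> A"
proof -
  obtain S where S: "completely_metrizable_space S" "second_countable S" "topspace S = space M"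
    "sets M = sets (borel_of S)"
    using G_space unfolding G_space_def standard_prob_space_def by blast
  have "Hausdorff_space S"
    using S(1) completely_metrizable_imp_metrizable_space metrizable_imp_Hausdorff_space by blast
  obtain \<B> where \<B>: "countable \<B>" "\<And>V. V \<in> \<B> \<Longrightarrow> openin S V"
    "\<And>U x. openin S U \<Longrightarrow> x \<in> U \<Longrightarrow> \<exists>V\<in>\<B>. x \<in> V \<and> V \<subseteq> U"
    using S(2) unfolding second_countable_def by metis
  define \<A> where "\<A> = (\<lambda>F. space M \<inter> \<Inter>F) ` {F. finite F \<and> F \<subseteq> \<B>}"
  have sub: "\<B> \<subseteq> sets M" using \<B>(2) openin_sets_borel_of S(4) by blast
  show ?thesis
  proof (rule that[of \<A>])
    show "countable \<A>" unfolding \<A>_def using countable_Collect_finite_subset[OF \<B>(1)] by (rule countable_image)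
    show "\<A> \<subseteq> sets M"
    proof
      fix A assume "A \<in> \<A>"
      then obtain F where F: "finite F" "F \<subseteq> \<B>" "A = space M \<inter> \<Inter>F" by (auto simp: \<A>_def)
      show "A \<in> sets M"
      proof (cases "F = {}")
        case False
        then have "\<Inter>F \<in> sets M" using F sub sets.finite_INT[of F "\<lambda>x. x" M] by auto
        then show ?thesis using F(3) by simp
      qed (use F(3) in simp)
    qed
    show "A \<inter> B \<in> \<A>" if AB: "A \<in> \<A>" "B \<in> \<A>" for A B
    proof -
      obtain E F where EF: "finite E" "E \<subseteq> \<B>" "finite F" "F \<subseteq> \<B>" "A = space M \<inter> \<Inter>E" "B = space M \<inter> \<Inter>F"
        using AB by (auto simp: \<A>_def)
      then have "A \<inter> B = space M \<inter> \<Inter>(E \<union> F)" by auto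
      then show ?thesis unfolding \<A>_def using EF by (intro image_eqI[of _ _ "E \<union> F"]) auto
    qed
    show "\<exists>A\<in>\<A>. x \<in> A \<and> y \<notin> A" if xy: "x \<in> space M" "y \<in> space M" "x \<noteq> y" for x y
    proof -
      have "\<exists>U V. openin S U \<and> openin S V \<and> x \<in> U \<and> y \<in> V \<and> disjnt U V"
        using \<open>Hausdorff_space S\<close> xy S(3) unfolding Hausdorff_space_def by simp
      then obtain U where U: "openin S U" "x \<in> U" "y \<notin> U" by (auto simp: disjnt_iff)
      obtain W where W: "W \<in> \<B>" "x \<in> W" "W \<subseteq> U" using \<B>(3)[OF U(1,2)] by blast
      have "space M \<inter> \<Inter>{W} \<in> \<A>" unfolding \<A>_def by (rule imageI) (use W(1) in auto)
      then show ?thesis using W U(3) xy(1) by (intro bexI[of _ "space M \<inter> \<Inter>{W}"]) auto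
    qed
  qed
qed

definition separators :: "'x set set" where
  "separators = (SOME \<A>. countable \<A> \<and> \<A> \<subseteq> sets M \<and> (\<forall>A\<in>\<A>. \<forall>B\<in>\<A>. A \<inter> B \<in> \<A>) \<and>
     (\<forall>x\<in>space M. \<forall>y\<in>space M. x \<noteq> y \<longrightarrow> (\<exists>A\<in>\<A>. x \<in> A \<and> y \<notin> A)))"

lemma separators: "countable separators" "A \<in> separators \<Longrightarrow> A \<in> sets M"
    "A \<in> separators \<Longrightarrow> B \<in> separators \<Longrightarrow> A \<inter> B \<in> separators"
    "x \<in> space M \<Longrightarrow> y \<in> space M \<Longrightarrow> x \<noteq> y \<Longrightarrow> \<exists>A\<in>separators. x \<in> A \<and> y \<notin> A"
proof -
  have "\<exists>\<A>. countable \<A> \<and> \<A> \<subseteq> sets M \<and> (\<forall>A\<in>\<A>. \<forall>B\<in>\<A>. A \<inter> B \<in> \<A>) \<and>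
     (\<forall>x\<in>space M. \<forall>y\<in>space M. x \<noteq> y \<longrightarrow> (\<exists>A\<in>\<A>. x \<in> A \<and> y \<notin> A))"
    by (rule separating_family) (intro exI conjI ballI impI)
  note * = someI_ex[OF this, folded separators_def]
  show "countable separators" "A \<in> separators \<Longrightarrow> A \<in> sets M"
    "A \<in> separators \<Longrightarrow> B \<in> separators \<Longrightarrow> A \<inter> B \<in> separators"
    "x \<in> space M \<Longrightarrow> y \<in> space M \<Longrightarrow> x \<noteq> y \<Longrightarrow> \<exists>A\<in>separators. x \<in> A \<and> y \<notin> A"
    using * by auto
qed

definition hits :: "'x set \<Rightarrow> 'x \<Rightarrow> 'a set" where
  "hits A x = {h \<in> carrier G. \<phi> h x \<in> A}"

lemma hits_section:
  assumes "A \<in> sets M"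
  obtains E where "E \<in> sets (borel_of T \<Otimes>\<^sub>M M)" "\<And>x. x \<in> space M \<Longrightarrow> (\<lambda>g. (g, x)) -` E = hits A x"
proof -
  let ?E = "(\<lambda>(g, x). \<phi> g x) -` A \<inter> space (borel_of T \<Otimes>\<^sub>M M)"
  have "?E \<in> sets (borel_of T \<Otimes>\<^sub>M M)" using measurable_action assms by (rule measurable_sets)
  then show ?thesis by (rule that) (auto simp: hits_def space_pair_measure)
qed

lemma hits_borel:
  assumes "A \<in> sets M" "x \<in> space M"
  shows "hits A x \<in> sets (borel_of T)"
proof -
  obtain E where E: "E \<in> sets (borel_of T \<Otimes>\<^sub>M M)" "\<And>x. x \<in> space M \<Longrightarrow> (\<lambda>g. (g, x)) -` E = hits A x"
    using hits_section[OF assms(1)] by blast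
  show ?thesis using sets_Pair2[OF E(1), of x] E(2)[OF assms(2)] by simp
qed

lemma measurable_meager_hits:
  assumes "A \<in> sets M" "openin T U"
  shows "{x \<in> space M. meager_in T (U \<inter> hits A x)} \<in> sets M"
proof -
  obtain E where E: "E \<in> sets (borel_of T \<Otimes>\<^sub>M M)" "\<And>x. x \<in> space M \<Longrightarrow> (\<lambda>g. (g, x)) -` E = hits A x"
    using hits_section[OF assms(1)] by blast
  have "{x \<in> space M. meager_in T (U \<inter> hits A x)} = {x \<in> space M. meager_in T (U \<inter> (\<lambda>g. (g, x)) -` E)}"
    using E(2) by auto
  then show ?thesis
    using measurable_meager_sections[OF locally_compact_T regular_T second_countable_T E(1) assms(2)] by simp
qed

lemma measurable_comeager_hits:
  assumes "A \<in> sets M" "openin T U"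
  shows "{x \<in> space M. meager_in T (U - hits A x)} \<in> sets M"
proof -
  have "U - hits A x = U \<inter> hits (space M - A) x" if "x \<in> space M" for x
    using that openin_carrier[OF assms(2)] act_closed by (auto simp: hits_def)
  then have "{x \<in> space M. meager_in T (U - hits A x)} = {x \<in> space M. meager_in T (U \<inter> hits (space M - A) x)}"
    by auto
  then show ?thesis using measurable_meager_hits[of "space M - A" U] assms by auto
qed

lemma hits_translate:
  assumes "g \<in> carrier G" "x \<in> space M"
  shows "hits A (\<phi> g x) = hits A x #> inv g"
proof -
  have "hits A x \<subseteq> carrier G" by (auto simp: hits_def)
  then show ?thesis using assms by (auto simp: r_coset_preimage hits_def act_mult)
qed

text \<open>Distinct points stay distinct under every \<open>h\<close>, so \<open>U\<close> is the union over the countably many separators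
  \<open>A\<close> of the sets where \<open>h x\<close> is in \<open>A\<close> and \<open>h y\<close> is not. One of these sets is non-meager, and having the
  Baire property it is comeager in an open piece of \<open>U\<close>.\<close>

lemma generic_separation:
  assumes xy: "x \<in> space M" "y \<in> space M" "x \<noteq> y" and U: "openin T U" "U \<noteq> {}"
  obtains A V where "A \<in> separators" "openin T V" "V \<noteq> {}" "V \<subseteq> U"
    "meager_in T (V - hits A x)" "meager_in T (V \<inter> hits A y)"
proof -
  have "U \<subseteq> (\<Union>A\<in>separators. U \<inter> (hits A x - hits A y))"
  proof
    fix h assume h: "h \<in> U"
    then have hG: "h \<in> carrier G" using openin_carrier U(1) by auto
    then have "\<phi> h x \<noteq> \<phi> h y" using xy act_inject by simp
    then obtain A where "A \<in> separators" "\<phi> h x \<in> A" "\<phi> h y \<notin> A"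
      using separators(4)[OF act_closed[OF hG xy(1)] act_closed[OF hG xy(2)]] by auto
    then show "h \<in> (\<Union>A\<in>separators. U \<inter> (hits A x - hits A y))" using h hG by (auto simp: hits_def)
  qed
  then have "\<not> meager_in T (\<Union>A\<in>separators. U \<inter> (hits A x - hits A y))"
    using nonempty_open_not_meager[OF U] by (auto dest: meager_in_subset)
  then obtain A where A: "A \<in> separators" "\<not> meager_in T (U \<inter> (hits A x - hits A y))"
    using meager_in_UN[OF separators(1), of T "\<lambda>A. U \<inter> (hits A x - hits A y)"] by auto
  have "A \<in> sets M" using A(1) by (rule separators(2))
  then have b: "hits A x - hits A y \<in> sets (borel_of T)" using hits_borel xy by auto
  obtain V where V: "openin T V" "V \<noteq> {}" "V \<subseteq> U" "meager_in T (V - (hits A x - hits A y))"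
    by (rule nonmeager_comeager_somewhere[OF b U(1) A(2)])
  have "meager_in T (V - hits A x)" by (rule meager_in_subset[OF V(4)]) auto
  moreover have "meager_in T (V \<inter> hits A y)" by (rule meager_in_subset[OF V(4)]) auto
  ultimately show ?thesis by (rule that[OF A(1) V(1-3)])
qed

lemma open_connecting_set:
  assumes "openin T U" "openin T V"
  shows "openin T {g \<in> carrier G. (U #> g) \<inter> V \<noteq> {}}"
proof -
  have c: "U \<subseteq> carrier G" "V \<subseteq> carrier G" using assms openin_carrier by auto
  have "{g \<in> carrier G. (U #> g) \<inter> V \<noteq> {}} = (\<Union>u\<in>U. inv u <# V)"
  proof (intro equalityI subsetI)
    fix g assume "g \<in> {g \<in> carrier G. (U #> g) \<inter> V \<noteq> {}}"
    then obtain u where u: "g \<in> carrier G" "u \<in> U" "u \<otimes> g \<in> V" by (auto simp: r_coset_def)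
    then have "g = inv u \<otimes> (u \<otimes> g)" using c by (auto simp: m_assoc[symmetric])
    then show "g \<in> (\<Union>u\<in>U. inv u <# V)" using u by (auto simp: l_coset_def)
  next
    fix g assume "g \<in> (\<Union>u\<in>U. inv u <# V)"
    then obtain u v where uv: "u \<in> U" "v \<in> V" "g = inv u \<otimes> v" by (auto simp: l_coset_def)
    then have uvc: "u \<in> carrier G" "v \<in> carrier G" using c by auto
    then have "g \<in> carrier G" "u \<otimes> g = v" using uv(3) by (auto simp: m_assoc[symmetric])
    then show "g \<in> {g \<in> carrier G. (U #> g) \<inter> V \<noteq> {}}" using uv(1,2) by (auto simp: r_coset_def)
  qed
  moreover have "openin T (\<Union>u\<in>U. inv u <# V)" using assms c by (auto intro!: openin_l_coset)
  ultimately show ?thesis by simp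
qed

text \<open>If \<open>\<phi> g x = y\<close>, then the set of \<open>h\<close> taking \<open>x\<close> into \<open>A\<close> is the \<open>g\<close>-translate of the set
  taking \<open>y\<close> into \<open>A\<close>. On the nonempty open set \<open>(U #> g) \<inter> V\<close> the first is comeager and the second
  meager, contradicting Baire's theorem.\<close>

lemma separated_if_connecting:
  assumes xy: "x \<in> space M" and g: "g \<in> carrier G" and U: "openin T U" and V: "openin T V"
    and ne: "(U #> g) \<inter> V \<noteq> {}" and m: "meager_in T (V - hits A x)" "meager_in T (U \<inter> hits A y)"
  shows "\<phi> g x \<noteq> y"
proof
  assume y: "\<phi> g x = y"
  let ?W = "(U #> g) \<inter> V"
  have Uc: "U \<subseteq> carrier G" using U openin_carrier by auto
  have "hits A x = hits A y #> g"
    using hits_translate[OF g xy, of A] g r_coset_inv_cancel'[of "hits A x" g] y by (auto simp: hits_def)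
  then have sub: "?W \<subseteq> (V - hits A x) \<union> ((U \<inter> hits A y) #> g)"
    using Uc g by (auto simp: r_coset_def hits_def)
  have "meager_in T ?W"
    by (rule meager_in_subset[OF meager_in_Un[OF m(1) meager_r_coset[OF m(2) g]] sub])
  moreover have "openin T ?W" using U V g by (intro openin_Int openin_r_coset)
  ultimately show False using nonempty_open_not_meager[OF _ ne] by simp
qed

text \<open>The converse of the previous lemma: separate \<open>\<phi> g x\<close> from \<open>y\<close> generically, then move the part that
  concerns \<open>\<phi> g x\<close> back to \<open>x\<close> by translation.\<close>

lemma connecting_if_separated:
  assumes xy: "x \<in> space M" "y \<in> space M" "g \<in> carrier G" "\<phi> g x \<noteq> y"
  obtains A U V where "A \<in> separators" "U \<in> basis" "V \<in> basis" "(U #> g) \<inter> V \<noteq> {}"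
    "meager_in T (V - hits A x)" "meager_in T (U \<inter> hits A y)"
proof -
  have c: "openin T (carrier G)" "carrier G \<noteq> {}" using openin_topspace[of T] by auto
  obtain A W where A: "A \<in> separators" "openin T W" "W \<noteq> {}"
      "meager_in T (W - hits A (\<phi> g x))" "meager_in T (W \<inter> hits A y)"
    by (rule generic_separation[OF act_closed[OF xy(3,1)] xy(2,4) c])
  then obtain h where h: "h \<in> W" "h \<in> carrier G" using openin_carrier by auto
  have "openin T (W #> g)" "h \<otimes> g \<in> W #> g" using A(2) xy(3) h by (auto simp: openin_r_coset mem_r_coset)
  from basis(3)[OF this] obtain V where V: "V \<in> basis" "h \<otimes> g \<in> V" "V \<subseteq> W #> g" by auto
  obtain U where U: "U \<in> basis" "h \<in> U" "U \<subseteq> W" using basis(3)[OF A(2) h(1)] by auto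
  have hx: "hits A x = hits A (\<phi> g x) #> g"
    using hits_translate[OF xy(3,1), of A] xy(3) r_coset_inv_cancel'[of "hits A x" g] by (auto simp: hits_def)
  have "meager_in T (V - hits A x)"
  proof (rule meager_in_subset[OF meager_r_coset[OF A(4) xy(3)]])
    show "V - hits A x \<subseteq> (W - hits A (\<phi> g x)) #> g"
      using V(3) unfolding hx by (auto simp: r_coset_def)
  qed
  moreover have "meager_in T (U \<inter> hits A y)" by (rule meager_in_subset[OF A(5)]) (use U in auto)
  moreover have "(U #> g) \<inter> V \<noteq> {}" using U(2) V(2) by (auto simp: r_coset_def)
  ultimately show ?thesis by (intro that[OF A(1) U(1) V(1)])
qed

text \<open>By the two preceding lemmas, no element of \<open>C\<close> carries \<open>x\<close> to \<open>y\<close> iff the open sets of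
  connecting elements, taken over the triples \<open>(A, U, V)\<close> that separate \<open>x\<close> from \<open>y\<close>, cover \<open>C\<close>.
  By compactness finitely many triples suffice, and there are only countably many finite sets of
  triples.\<close>

lemma compact_orbit_relation:
  assumes C: "compactin T C"
  shows "{(x, y) \<in> space M \<times> space M. \<exists>g\<in>C. \<phi> g x = y} \<in> sets (M \<Otimes>\<^sub>M M)"
proof -
  have Cc: "C \<subseteq> carrier G" using C compactin_carrier by auto
  define I where "I = separators \<times> basis \<times> basis"
  define D where "D = (\<lambda>(A :: 'x set, U, V). {g \<in> carrier G. (U #> g) \<inter> V \<noteq> {}})"
  define P where "P = (\<lambda>(A, U, V). {x \<in> space M. meager_in T (V - hits A x)} \<times> {y \<in> space M. meager_in T (U \<inter> hits A y)})"
  define F where "F = {F. finite F \<and> F \<subseteq> I \<and> C \<subseteq> (\<Union>t\<in>F. D t)}"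
  have "countable I" unfolding I_def using separators(1) basis(1) by auto
  then have "countable F"
    by (rule countable_subset[rotated, OF countable_Collect_finite_subset]) (auto simp: F_def)
  have P: "P t \<in> sets (M \<Otimes>\<^sub>M M)" if "t \<in> I" for t
    using that separators(2) basis(2) measurable_meager_hits measurable_comeager_hits by (auto simp: I_def P_def)
  have D_open: "openin T (D t)" if "t \<in> I" for t
    using that basis(2) by (auto simp: I_def D_def intro!: open_connecting_set)
  let ?S = "space M \<times> space M"
  have eq: "(\<forall>g\<in>C. \<phi> g x \<noteq> y) \<longleftrightarrow> (\<exists>K\<in>F. \<forall>t\<in>K. (x, y) \<in> P t)" if xy: "x \<in> space M" "y \<in> space M" for x y
  proof
    assume *: "\<forall>g\<in>C. \<phi> g x \<noteq> y"
    define J where "J = {t \<in> I. (x, y) \<in> P t}"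
    have "C \<subseteq> (\<Union>t\<in>J. D t)"
    proof
      fix g assume g: "g \<in> C"
      then have gc: "g \<in> carrier G" "\<phi> g x \<noteq> y" using Cc * by auto
      obtain A U V where A: "A \<in> separators" "U \<in> basis" "V \<in> basis" "(U #> g) \<inter> V \<noteq> {}"
        "meager_in T (V - hits A x)" "meager_in T (U \<inter> hits A y)"
        by (rule connecting_if_separated[OF xy gc])
      then have "(A, U, V) \<in> J" "g \<in> D (A, U, V)" using gc xy by (auto simp: J_def I_def P_def D_def)
      then show "g \<in> (\<Union>t\<in>J. D t)" by blast
    qed
    moreover have "\<forall>W\<in>D ` J. openin T W" using D_open by (auto simp: J_def)
    ultimately obtain \<F> where "finite \<F>" "\<F> \<subseteq> D ` J" "C \<subseteq> \<Union>\<F>"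
      using C unfolding compactin_def by meson
    then obtain K where "finite K" "K \<subseteq> J" "\<F> = D ` K" by (meson finite_subset_image)
    then have "K \<in> F" "\<forall>t\<in>K. (x, y) \<in> P t" using \<open>C \<subseteq> \<Union>\<F>\<close> by (auto simp: F_def J_def)
    then show "\<exists>K\<in>F. \<forall>t\<in>K. (x, y) \<in> P t" by blast
  next
    assume "\<exists>K\<in>F. \<forall>t\<in>K. (x, y) \<in> P t"
    then obtain K where K: "K \<in> F" "\<forall>t\<in>K. (x, y) \<in> P t" by blast
    show "\<forall>g\<in>C. \<phi> g x \<noteq> y"
    proof
      fix g assume g: "g \<in> C"
      then obtain t where t: "t \<in> K" "g \<in> D t" using K(1) by (auto simp: F_def)
      obtain A U V where AUV: "t = (A, U, V)" by (cases t)
      have "U \<in> basis" "V \<in> basis" using t(1) K(1) AUV by (auto simp: F_def I_def)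
      moreover have "(x, y) \<in> P t" using K(2) t(1) by blast
      ultimately show "\<phi> g x \<noteq> y"
        using t(2) g Cc xy basis(2) by (intro separated_if_connecting[of x g U V A y]) (auto simp: AUV P_def D_def)
    qed
  qed
  have eq': "(\<exists>g\<in>C. \<phi> g x = y) \<longleftrightarrow> \<not> (\<exists>K\<in>F. \<forall>t\<in>K. (x, y) \<in> P t)"
    if "x \<in> space M" "y \<in> space M" for x y using eq[OF that] by blast
  have "{(x, y) \<in> ?S. \<exists>g\<in>C. \<phi> g x = y} = ?S - (\<Union>K\<in>F. ?S \<inter> (\<Inter>t\<in>K. P t))"
  proof (rule Set.set_eqI)
    fix p :: "'x \<times> 'x"
    obtain x y where p: "p = (x, y)" by (cases p)
    show "p \<in> {(x, y) \<in> ?S. \<exists>g\<in>C. \<phi> g x = y} \<longleftrightarrow> p \<in> ?S - (\<Union>K\<in>F. ?S \<inter> (\<Inter>t\<in>K. P t))"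
      using eq'[of x y] unfolding p by (cases "x \<in> space M"; cases "y \<in> space M") simp_all
  qed
  moreover have "?S \<inter> (\<Inter>t\<in>K. P t) \<in> sets (M \<Otimes>\<^sub>M M)" if "K \<in> F" for K
  proof (cases "K = {}")
    case False
    then have "(\<Inter>t\<in>K. P t) \<in> sets (M \<Otimes>\<^sub>M M)" using that P by (intro sets.finite_INT) (auto simp: F_def)
    then show ?thesis by (simp add: sets.Int)
  qed simp
  then have "(\<Union>K\<in>F. ?S \<inter> (\<Inter>t\<in>K. P t)) \<in> sets (M \<Otimes>\<^sub>M M)"
    using \<open>countable F\<close> by (intro sets.countable_UN' image_subsetI)
  ultimately show ?thesis by (simp only:) (intro sets.Diff pair_measureI sets.top)
qed

lemma measurable_fixed_by_compact:
  assumes "compactin T C"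
  shows "{x \<in> space M. \<exists>g\<in>C. \<phi> g x = x} \<in> sets M"
proof -
  have "(\<lambda>x. (x, x)) \<in> measurable M (M \<Otimes>\<^sub>M M)" by simp
  from measurable_sets[OF this compact_orbit_relation[OF assms]]
  show ?thesis by (simp add: vimage_def Int_def conj_commute cong: conj_cong)
qed

lemma orbit_measurable:
  assumes "x \<in> space M"
  shows "orbit G \<phi> x \<in> sets M"
proof -
  obtain \<K> where \<K>: "countable \<K>" "\<And>K. K \<in> \<K> \<Longrightarrow> compactin T K" "\<Union>\<K> = carrier G"
    using open_sigma_compact[OF openin_topspace] by auto
  have "{y \<in> space M. \<exists>g\<in>K. \<phi> g x = y} \<in> sets M" if "K \<in> \<K>" for K
    using sets_Pair1[OF compact_orbit_relation[OF \<K>(2)[OF that]], of x] assms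
    by (simp add: vimage_def)
  then have "(\<Union>K\<in>\<K>. {y \<in> space M. \<exists>g\<in>K. \<phi> g x = y}) \<in> sets M" using \<K>(1) by (intro sets.countable_UN') auto
  moreover have "orbit G \<phi> x = (\<Union>K\<in>\<K>. {y \<in> space M. \<exists>g\<in>K. \<phi> g x = y})"
    using assms act_closed unfolding orbit_def \<K>(3)[symmetric] by fastforce
  ultimately show ?thesis by simp
qed

text \<open>The same description shows that the elements moving \<open>x\<close> form an open set.\<close>

lemma stabilizer_closed:
  assumes x: "x \<in> space M"
  shows "closedin T (stabilizer G \<phi> x)"
proof -
  have "\<exists>W. openin T W \<and> g \<in> W \<and> W \<subseteq> topspace T - stabilizer G \<phi> x"
    if g: "g \<in> topspace T - stabilizer G \<phi> x" for g
  proof -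
    have gc: "g \<in> carrier G" "\<phi> g x \<noteq> x" using g by (auto simp: stabilizer_def)
    obtain A U V where A: "A \<in> separators" "U \<in> basis" "V \<in> basis" "(U #> g) \<inter> V \<noteq> {}"
      "meager_in T (V - hits A x)" "meager_in T (U \<inter> hits A x)"
      by (rule connecting_if_separated[OF x x gc])
    let ?W = "{g \<in> carrier G. (U #> g) \<inter> V \<noteq> {}}"
    have "openin T ?W" using A(2,3) basis(2) open_connecting_set by simp
    moreover have "\<phi> h x \<noteq> x" if "h \<in> ?W" for h
      using separated_if_connecting[OF x, of h U V A x] that A(2,3,5,6) basis(2) by auto
    ultimately show ?thesis using gc A(4) by (intro exI[of _ ?W]) (auto simp: stabilizer_def)
  qed
  then have "openin T (topspace T - stabilizer G \<phi> x)" by (subst openin_subopen) blast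
  then show ?thesis using stabilizer_subset by (simp add: closedin_def)
qed

end

section \<open>Ergodicity and Fubini against Haar measure\<close>

context lcsc
begin

definition right_haar :: "'a measure" where
  "right_haar = (SOME \<mu>. sets \<mu> = sets (borel_of T) \<and> sigma_finite_measure \<mu> \<and> emeasure \<mu> (carrier G) \<noteq> 0 \<and>
     (\<forall>g\<in>carrier G. distr \<mu> \<mu> (\<lambda>x. x \<otimes> g) = \<mu>))"

lemma right_haar: "sets right_haar = sets (borel_of T)" "sigma_finite_measure right_haar"
    "emeasure right_haar (carrier G) \<noteq> 0"
    "g \<in> carrier G \<Longrightarrow> distr right_haar right_haar (\<lambda>x. x \<otimes> g) = right_haar"
proof -
  have "\<exists>\<mu>. sets \<mu> = sets (borel_of T) \<and> sigma_finite_measure \<mu> \<and> emeasure \<mu> (carrier G) \<noteq> 0 \<and>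
     (\<forall>g\<in>carrier G. distr \<mu> \<mu> (\<lambda>x. x \<otimes> g) = \<mu>)"
    by (rule Haar_measure) (intro exI conjI ballI)
  note * = someI_ex[OF this, folded right_haar_def]
  show "sets right_haar = sets (borel_of T)" "sigma_finite_measure right_haar"
    "emeasure right_haar (carrier G) \<noteq> 0"
    "g \<in> carrier G \<Longrightarrow> distr right_haar right_haar (\<lambda>x. x \<otimes> g) = right_haar"
    using * by auto
qed

lemma space_right_haar [simp]: "space right_haar = carrier G"
  using sets_eq_imp_space_eq[OF right_haar(1)] by simp

lemma AE_right_haar_translate:
  assumes "g \<in> carrier G" "AE h in right_haar. P h"
  shows "AE h in right_haar. P (h \<otimes> g)"
proof -
  have "(\<lambda>x. x \<otimes> g) \<in> measurable right_haar right_haar"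
    using continuous_map_measurable[OF continuous_right_mult[OF assms(1)]]
    by (simp cong: measurable_cong_sets add: right_haar(1))
  moreover have "AE h in distr right_haar right_haar (\<lambda>x. x \<otimes> g). P h"
    unfolding right_haar(4)[OF assms(1)] by (rule assms(2))
  ultimately show ?thesis by (rule AE_distrD)
qed

lemma AE_right_haar_exists:
  assumes "AE h in right_haar. P h"
  obtains h where "h \<in> carrier G" "P h"
proof -
  have "AE h in right_haar. h \<in> carrier G \<and> P h"
    using assms AE_space[of right_haar] by eventually_elim simp
  moreover have "ae_filter right_haar \<noteq> bot" using right_haar(3) by (simp add: ae_filter_eq_bot_iff)
  ultimately show ?thesis using eventually_happens that by blast
qed

end

locale ergodic_lcsc_action = lcsc_action +
  assumes measure_preserving: "measure_preserving_action G M \<phi>"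
    and ergodic: "ergodic_action G M \<phi>"
begin

sublocale haar: pair_sigma_finite right_haar M
  unfolding pair_sigma_finite_def using right_haar(2) sigma_finite_measure_axioms by simp

lemma sets_pair_haar: "sets (right_haar \<Otimes>\<^sub>M M) = sets (borel_of T \<Otimes>\<^sub>M M)"
  by (intro sets_pair_measure_cong right_haar(1) refl)

lemma AE_act:
  assumes "g \<in> carrier G" "AE x in M. P x"
  shows "AE x in M. P (\<phi> g x)"
proof -
  have eq: "distr M M (\<phi> g) = M" using measure_preserving assms(1) by (simp add: measure_preserving_action_def)
  have "AE x in distr M M (\<phi> g). P x" unfolding eq by (rule assms(2))
  then show ?thesis by (rule AE_distrD[OF measurable_act[OF assms(1)]])
qed

text \<open>The exchange of quantifiers for which Haar measure is needed: an exceptional null set for each group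
  element is traded for an exceptional null set of group elements for almost every point.\<close>

lemma AE_haar_swap:
  assumes "E \<in> sets (borel_of T \<Otimes>\<^sub>M M)" "\<And>g. g \<in> carrier G \<Longrightarrow> AE x in M. (g, x) \<in> E"
  shows "AE x in M. AE g in right_haar. (g, x) \<in> E"
proof -
  have E: "E \<in> sets (right_haar \<Otimes>\<^sub>M M)" using assms(1) sets_pair_haar by simp
  have "{p \<in> space (right_haar \<Otimes>\<^sub>M M). (fst p, snd p) \<in> E} = E"
    using sets.sets_into_space[OF E] by auto
  then have "(AE g in right_haar. AE x in M. (g, x) \<in> E) \<longleftrightarrow> (AE x in M. AE g in right_haar. (g, x) \<in> E)"
    using E by (intro haar.AE_commute) simp
  moreover have "AE g in right_haar. AE x in M. (g, x) \<in> E" by (rule AE_I2) (simp add: assms(2))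
  ultimately show ?thesis by simp
qed

lemma measurable_action_preimage:
  assumes "A \<in> sets M"
  shows "{(g, x) \<in> carrier G \<times> space M. \<phi> g x \<in> A} \<in> sets (borel_of T \<Otimes>\<^sub>M M)"
proof -
  have "{(g, x) \<in> carrier G \<times> space M. \<phi> g x \<in> A} = (\<lambda>(g, x). \<phi> g x) -` A \<inter> space (borel_of T \<Otimes>\<^sub>M M)"
    by (auto simp: space_pair_measure)
  then show ?thesis using measurable_sets[OF measurable_action assms] by simp
qed

lemma AE_orbit_AE:
  assumes "A \<in> sets M" "AE x in M. x \<in> A"
  shows "AE x in M. AE g in right_haar. \<phi> g x \<in> A"
proof -
  have "AE x in M. AE g in right_haar. (g, x) \<in> {(g, x) \<in> carrier G \<times> space M. \<phi> g x \<in> A}"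
  proof (rule AE_haar_swap[OF measurable_action_preimage[OF assms(1)]])
    fix g assume g: "g \<in> carrier G"
    show "AE x in M. (g, x) \<in> {(g, x) \<in> carrier G \<times> space M. \<phi> g x \<in> A}"
      using AE_act[OF g assms(2)] AE_space by eventually_elim (simp add: g)
  qed
  then show ?thesis by eventually_elim (auto elim: eventually_mono)
qed

lemma invariant_dichotomy:
  assumes "A \<in> sets M" "\<And>g x. g \<in> carrier G \<Longrightarrow> x \<in> A \<Longrightarrow> \<phi> g x \<in> A"
  shows "(AE x in M. x \<in> A) \<or> (AE x in M. x \<notin> A)"
proof -
  have A: "A \<subseteq> space M" using assms(1) sets.sets_into_space by blast
  have fixed: "\<phi> g ` A = A" if g: "g \<in> carrier G" for g
  proof (intro equalityI subsetI)
    fix x assume x: "x \<in> A"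
    then have "\<phi> (inv g) x \<in> A" "\<phi> g (\<phi> (inv g) x) = x" using g assms(2) A act_inv' by auto
    then show "x \<in> \<phi> g ` A" by (metis imageI)
  qed (use g assms(2) in auto)
  then have "emeasure M A = 0 \<or> emeasure M (space M - A) = 0"
    using ergodic[unfolded ergodic_action_def, THEN bspec, OF assms(1)] fixed by simp
  then show ?thesis
  proof
    assume "emeasure M A = 0"
    then have "AE x in M. x \<notin> A" using assms(1) by (intro AE_not_in) auto
    then show ?thesis ..
  next
    assume "emeasure M (space M - A) = 0"
    then have "AE x in M. x \<notin> space M - A" using assms(1) by (intro AE_not_in) auto
    then have "AE x in M. x \<in> A" using AE_space by eventually_elim auto
    then show ?thesis ..
  qed
qed

text \<open>Ergodicity is assumed for strictly invariant sets. The points whose translates lie in \<open>A\<close> for almost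
  all group elements form a strictly invariant set, by right invariance of Haar measure, and this set
  agrees with \<open>A\<close> almost everywhere.\<close>

lemma AE_invariant_dichotomy:
  assumes A: "A \<in> sets M" and inv: "\<And>g. g \<in> carrier G \<Longrightarrow> AE x in M. \<phi> g x \<in> A \<longleftrightarrow> x \<in> A"
  shows "(AE x in M. x \<in> A) \<or> (AE x in M. x \<notin> A)"
proof -
  let ?E = "{(g, x) \<in> carrier G \<times> space M. \<phi> g x \<in> A}"
  define B where "B = {x \<in> space M. AE g in right_haar. \<phi> g x \<in> A}"
  have E: "?E \<in> sets (right_haar \<Otimes>\<^sub>M M)" using measurable_action_preimage[OF A] sets_pair_haar by simp
  have eq: "{x \<in> space M. AE g in right_haar. \<phi> g x \<in> A}
      = {x \<in> space M. emeasure right_haar ((\<lambda>g. (g, x)) -` (space (right_haar \<Otimes>\<^sub>M M) - ?E)) = 0}"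
  proof (intro Collect_cong conj_cong refl)
    fix x assume x: "x \<in> space M"
    have "(\<lambda>g. (g, x)) -` (space (right_haar \<Otimes>\<^sub>M M) - ?E) \<in> sets right_haar"
      using E by (intro sets_Pair2[where ?M2.0 = M]) auto
    moreover have "(\<lambda>g. (g, x)) -` (space (right_haar \<Otimes>\<^sub>M M) - ?E) = {g \<in> space right_haar. \<phi> g x \<notin> A}"
      using x by (auto simp: space_pair_measure)
    ultimately show "(AE g in right_haar. \<phi> g x \<in> A) \<longleftrightarrow>
        emeasure right_haar ((\<lambda>g. (g, x)) -` (space (right_haar \<Otimes>\<^sub>M M) - ?E)) = 0"
      by (simp add: AE_iff_measurable[OF _ refl])
  qed
  have "(\<lambda>x. emeasure right_haar ((\<lambda>g. (g, x)) -` (space (right_haar \<Otimes>\<^sub>M M) - ?E))) \<in> borel_measurable M"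
    using E by (intro haar.measurable_emeasure_Pair2) auto
  then have B: "B \<in> sets M" unfolding B_def eq by measurable
  have "\<phi> r x \<in> B" if r: "r \<in> carrier G" and x: "x \<in> B" for r x
  proof -
    have xM: "x \<in> space M" and ae: "AE g in right_haar. \<phi> g x \<in> A" using x by (auto simp: B_def)
    have "AE g in right_haar. \<phi> (g \<otimes> r) x \<in> A" using AE_right_haar_translate[OF r ae] .
    then have "AE g in right_haar. \<phi> g (\<phi> r x) \<in> A"
      using AE_space[of right_haar] by eventually_elim (simp add: act_mult r xM)
    then show ?thesis using act_closed r xM by (simp add: B_def)
  qed
  then have dich: "(AE x in M. x \<in> B) \<or> (AE x in M. x \<notin> B)" by (rule invariant_dichotomy[OF B])
  let ?F = "{(g, x) \<in> carrier G \<times> space M. \<phi> g x \<in> A \<longleftrightarrow> x \<in> A}"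
  have "carrier G \<in> sets (borel_of T)" using sets.top[of "borel_of T"] by simp
  then have "carrier G \<times> A \<in> sets (borel_of T \<Otimes>\<^sub>M M)" using A by (rule pair_measureI)
  then have "(carrier G \<times> space M - (?E - carrier G \<times> A)) - (carrier G \<times> A - ?E) \<in> sets (borel_of T \<Otimes>\<^sub>M M)"
    using measurable_action_preimage[OF A] \<open>carrier G \<in> sets (borel_of T)\<close> A by (intro sets.Diff pair_measureI) auto
  moreover have "(carrier G \<times> space M - (?E - carrier G \<times> A)) - (carrier G \<times> A - ?E) = ?F"
    using sets.sets_into_space[OF A] by auto
  ultimately have "?F \<in> sets (borel_of T \<Otimes>\<^sub>M M)" by simp
  then have "AE x in M. AE g in right_haar. (g, x) \<in> ?F"
  proof (rule AE_haar_swap)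
    fix g assume g: "g \<in> carrier G"
    show "AE x in M. (g, x) \<in> ?F" using inv[OF g] AE_space by eventually_elim (simp add: g)
  qed
  then have iff: "AE x in M. x \<in> B \<longleftrightarrow> x \<in> A"
    using AE_space
  proof eventually_elim
    case (elim x)
    then have ae: "AE g in right_haar. \<phi> g x \<in> A \<longleftrightarrow> x \<in> A" by (auto elim: eventually_mono)
    show ?case
    proof
      assume "x \<in> B"
      then have "AE g in right_haar. \<phi> g x \<in> A" by (simp add: B_def)
      with ae have "AE g in right_haar. x \<in> A" by eventually_elim simp
      then show "x \<in> A" by (rule AE_right_haar_exists)
    next
      assume "x \<in> A"
      then show "x \<in> B" using ae elim by (auto simp: B_def elim: eventually_mono)
    qed
  qed
  from dich show ?thesis
  proof
    assume "AE x in M. x \<in> B"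
    then have "AE x in M. x \<in> A" using iff by eventually_elim simp
    then show ?thesis ..
  next
    assume "AE x in M. x \<notin> B"
    then have "AE x in M. x \<notin> A" using iff by eventually_elim simp
    then show ?thesis ..
  qed
qed

end

section \<open>Equivariant maps to a homogeneous space\<close>

locale closed_subgroup = lcsc G T for G :: "'a monoid" (structure) and T +
  fixes H :: "'a set"
  assumes subgroup_H: "subgroup H G" and closed_H: "closedin T H"
begin

lemma H_carrier: "H \<subseteq> carrier G"
  using subgroup_H subgroup.subset by blast

lemma coset_carrier: "c \<in> lcosets H \<Longrightarrow> c \<subseteq> carrier G"
  using H_carrier by (auto simp: LCOSETS_def l_coset_def)

lemma coset_nonempty: "c \<in> lcosets H \<Longrightarrow> c \<noteq> {}"
  using subgroup.one_closed[OF subgroup_H] by (auto simp: LCOSETS_def l_coset_def)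

lemma coset_eq: "c \<in> lcosets H \<Longrightarrow> t \<in> c \<Longrightarrow> c = t <# H"
  using l_repr_independence subgroup_H by (force simp: LCOSETS_def)

lemma coset_translate: "c \<in> lcosets H \<Longrightarrow> g \<in> carrier G \<Longrightarrow> g <# c \<in> lcosets H"
  using H_carrier by (auto simp: LCOSETS_def lcos_m_assoc)

lemma H_coset: "H \<in> lcosets H"
  using H_carrier by (auto simp: LCOSETS_def lcos_mult_one intro!: bexI[of _ \<one>])

lemma l_coset_assoc: "c \<in> lcosets H \<Longrightarrow> g \<in> carrier G \<Longrightarrow> h \<in> carrier G \<Longrightarrow> g <# (h <# c) = (g \<otimes> h) <# c"
  using coset_carrier by (simp add: lcos_m_assoc)

lemma l_coset_cancel:
  assumes "c \<in> lcosets H" "c' \<in> lcosets H" "g \<in> carrier G" "g <# c = g <# c'"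
  shows "c = c'"
proof -
  have cancel: "inv g <# (g <# d) = d" if "d \<in> lcosets H" for d
    using that assms(3) coset_carrier by (simp add: l_coset_assoc lcos_mult_one)
  show ?thesis using cancel[OF assms(1)] unfolding assms(4) cancel[OF assms(2)] by (rule sym)
qed

lemma closedin_coset: "c \<in> lcosets H \<Longrightarrow> closedin T c"
proof -
  assume "c \<in> lcosets H"
  then obtain t where t: "t \<in> carrier G" "c = t <# H" by (auto simp: LCOSETS_def)
  show ?thesis
    using closedin_continuous_map_preimage[OF continuous_left_mult, of "inv t" H] t closed_H H_carrier
    by (simp add: l_coset_preimage)
qed

text \<open>Cosets of a closed subgroup are closed, so a countable base tells them apart.\<close>

lemma coset_eq_iff_hits:
  assumes c: "c \<in> lcosets H" "d \<in> lcosets H"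
  shows "c = d \<longleftrightarrow> (\<forall>U\<in>basis. c \<inter> U \<noteq> {} \<longleftrightarrow> d \<inter> U \<noteq> {})"
proof
  assume *: "\<forall>U\<in>basis. c \<inter> U \<noteq> {} \<longleftrightarrow> d \<inter> U \<noteq> {}"
  obtain a where a: "a \<in> c" using coset_nonempty[OF c(1)] by auto
  have "a \<in> d"
  proof (rule ccontr)
    assume "a \<notin> d"
    then have "openin T (topspace T - d)" "a \<in> topspace T - d"
      using closedin_coset[OF c(2)] a coset_carrier[OF c(1)] by (auto simp: closedin_def)
    then obtain U where U: "U \<in> basis" "a \<in> U" "U \<subseteq> topspace T - d" using basis(3) by meson
    then have "c \<inter> U \<noteq> {}" "d \<inter> U = {}" using a by auto
    then show False using * U(1) by simp
  qed
  then show "c = d" using coset_eq[OF c(1) a] coset_eq[OF c(2)] by simp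
qed simp

end

text \<open>A measurable map to \<open>G/H\<close>, equivariant almost everywhere for each group element. The values are
  treated as closed subsets of \<open>G\<close>, and measurability is expressed by the open sets that they hit.\<close>

locale coset_valued_map = ergodic_lcsc_action G T M \<phi> + closed_subgroup G T H
  for G :: "'a monoid" (structure) and T and M :: "'b measure" and \<phi> and H +
  fixes Q :: "'b \<Rightarrow> 'a set"
  assumes Q_coset: "x \<in> space M \<Longrightarrow> Q x \<in> lcosets H"
    and Q_measurable: "openin T U \<Longrightarrow> {x \<in> space M. Q x \<inter> U \<noteq> {}} \<in> sets M"
    and Q_equivariant: "g \<in> carrier G \<Longrightarrow> AE x in M. Q (\<phi> g x) = g <# Q x"
begin

text \<open>Continuity of the multiplication turns a condition that couples \<open>g\<close> and \<open>c\<close> into a countable union of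
  products of conditions on \<open>g\<close> and on \<open>c\<close>.\<close>

lemma translated_hits_iff:
  assumes g: "g \<in> carrier G" and c: "c \<subseteq> carrier G" and U: "openin T U"
  shows "(g <# c) \<inter> U \<noteq> {} \<longleftrightarrow> (\<exists>(V, W)\<in>{(V, W) \<in> basis \<times> basis. V <#> W \<subseteq> U}. g \<in> V \<and> c \<inter> W \<noteq> {})"
proof
  assume "(g <# c) \<inter> U \<noteq> {}"
  then obtain q where q: "q \<in> c" "g \<otimes> q \<in> U" by (auto simp: l_coset_def)
  have "openin (prod_topology T T) {p \<in> topspace (prod_topology T T). (\<lambda>(x, y). x \<otimes> y) p \<in> U}"
    using continuous_mult U by (rule openin_continuous_map_preimage)
  moreover have "(g, q) \<in> {p \<in> topspace (prod_topology T T). (\<lambda>(x, y). x \<otimes> y) p \<in> U}"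
    using g q c by auto
  ultimately obtain A B where AB: "openin T A" "openin T B" "g \<in> A" "q \<in> B"
      "A \<times> B \<subseteq> {p \<in> topspace (prod_topology T T). (\<lambda>(x, y). x \<otimes> y) p \<in> U}"
    unfolding openin_prod_topology_alt by meson
  obtain V where V: "V \<in> basis" "g \<in> V" "V \<subseteq> A" using basis(3)[OF AB(1,3)] by auto
  obtain W where W: "W \<in> basis" "q \<in> W" "W \<subseteq> B" using basis(3)[OF AB(2,4)] by auto
  have "V <#> W \<subseteq> U"
  proof
    fix y assume "y \<in> V <#> W"
    then obtain v w where "v \<in> V" "w \<in> W" "y = v \<otimes> w" by (auto simp: mem_set_mult)
    then have "(v, w) \<in> A \<times> B" using V W by auto
    then show "y \<in> U" using AB(5) \<open>y = v \<otimes> w\<close> by auto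
  qed
  then show "\<exists>(V, W)\<in>{(V, W) \<in> basis \<times> basis. V <#> W \<subseteq> U}. g \<in> V \<and> c \<inter> W \<noteq> {}"
    using V W q(1) by (intro bexI[of _ "(V, W)"]) auto
next
  assume "\<exists>(V, W)\<in>{(V, W) \<in> basis \<times> basis. V <#> W \<subseteq> U}. g \<in> V \<and> c \<inter> W \<noteq> {}"
  then obtain V W q where "V <#> W \<subseteq> U" "g \<in> V" "q \<in> c" "q \<in> W" by auto
  then have "g \<otimes> q \<in> (g <# c) \<inter> U" by (auto simp: mem_l_coset mem_set_mult subset_iff)
  then show "(g <# c) \<inter> U \<noteq> {}" by auto
qed

lemma AE_haar_equivariant: "AE x in M. AE g in right_haar. Q (\<phi> g x) = g <# Q x"
proof -
  let ?X = "carrier G \<times> space M"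
  have space: "space (borel_of T \<Otimes>\<^sub>M M) = ?X" by (simp add: space_pair_measure)
  define E where "E U = {(g, x) \<in> ?X. Q (\<phi> g x) \<inter> U \<noteq> {}}" for U
  define F where "F U = {(g, x) \<in> ?X. (g <# Q x) \<inter> U \<noteq> {}}" for U
  have E: "E U \<in> sets (borel_of T \<Otimes>\<^sub>M M)" if "U \<in> basis" for U
  proof -
    have "E U = {(g, x) \<in> ?X. \<phi> g x \<in> {x \<in> space M. Q x \<inter> U \<noteq> {}}}"
      using act_closed by (auto simp: E_def)
    then show ?thesis using measurable_action_preimage[OF Q_measurable[OF basis(2)[OF that]]] by simp
  qed
  have F: "F U \<in> sets (borel_of T \<Otimes>\<^sub>M M)" if U: "U \<in> basis" for U
  proof -
    let ?I = "{(V, W) \<in> basis \<times> basis. V <#> W \<subseteq> U}"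
    let ?R = "\<lambda>(V, W). V \<times> {x \<in> space M. Q x \<inter> W \<noteq> {}}"
    have "p \<in> F U \<longleftrightarrow> p \<in> (\<Union>i\<in>?I. ?R i)" for p
    proof (cases p)
      case (Pair g x)
      show ?thesis
      proof (cases "p \<in> ?X")
        case True
        then show ?thesis
          using translated_hits_iff[of g "Q x" U] coset_carrier[OF Q_coset] basis(2)[OF U] Pair
          by (simp add: F_def split_beta)
      next
        case False
        then show ?thesis using openin_carrier[OF basis(2)] Pair by (auto simp: F_def)
      qed
    qed
    then have "F U = (\<Union>i\<in>?I. ?R i)" by blast
    moreover have "countable ?I" by (rule countable_subset[of _ "basis \<times> basis"]) (use basis(1) in auto)
    moreover have "?R i \<in> sets (borel_of T \<Otimes>\<^sub>M M)" if "i \<in> ?I" for i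
      using that basis(2) Q_measurable openin_sets_borel_of by (auto intro!: pair_measureI)
    ultimately show ?thesis by (simp only:) (intro sets.countable_UN' image_subsetI)
  qed
  let ?D = "\<Inter>U\<in>basis. (?X - (E U - F U)) - (F U - E U)"
  let ?S = "{(g, x) \<in> ?X. Q (\<phi> g x) = g <# Q x}"
  have "basis \<noteq> {}" using basis(3)[OF openin_topspace, of \<one>] by auto
  have X: "?X \<in> sets (borel_of T \<Otimes>\<^sub>M M)" using sets.top[of "borel_of T \<Otimes>\<^sub>M M"] space by simp
  have "?D \<in> sets (borel_of T \<Otimes>\<^sub>M M)"
    using E F X basis(1) \<open>basis \<noteq> {}\<close> by (intro sets.countable_INT') auto
  moreover have "p \<in> ?D \<longleftrightarrow> p \<in> ?S" for p
  proof (cases p)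
    case (Pair g x)
    show ?thesis
    proof (cases "p \<in> ?X")
      case True
      then have gx: "g \<in> carrier G" "x \<in> space M" using Pair by auto
      have "p \<in> ?D \<longleftrightarrow> (\<forall>U\<in>basis. Q (\<phi> g x) \<inter> U \<noteq> {} \<longleftrightarrow> (g <# Q x) \<inter> U \<noteq> {})"
        using gx by (auto simp: E_def F_def Pair)
      also have "\<dots> \<longleftrightarrow> Q (\<phi> g x) = g <# Q x"
        using gx by (intro coset_eq_iff_hits[symmetric] Q_coset act_closed coset_translate)
      finally show ?thesis using gx Pair by simp
    qed (use \<open>basis \<noteq> {}\<close> in auto)
  qed
  then have "?D = ?S" by blast
  ultimately have "?S \<in> sets (borel_of T \<Otimes>\<^sub>M M)" by simp
  then have "AE x in M. AE g in right_haar. (g, x) \<in> ?S"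
  proof (rule AE_haar_swap)
    fix g assume g: "g \<in> carrier G"
    show "AE x in M. (g, x) \<in> ?S" using Q_equivariant[OF g] AE_space by eventually_elim (simp add: g)
  qed
  then show ?thesis by eventually_elim (auto elim: eventually_mono)
qed

end

context coset_valued_map
begin

text \<open>The coset \<open>c\<close> is the value that \<open>Q\<close> should have at \<open>x\<close>, read off from almost all translates of
  \<open>x\<close>. Almost every point is typical with \<open>c = Q x\<close>, but in contrast to the graph of \<open>Q\<close> the
  relation is exactly equivariant. The conull set \<open>Z\<close> allows properties that hold only almost everywhere
  to be used at a translate of a typical point.\<close>

definition typical :: "'b set \<Rightarrow> 'b \<Rightarrow> 'a set \<Rightarrow> bool" where
  "typical Z x c \<longleftrightarrow> x \<in> space M \<and> c \<in> lcosets H \<and>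
     (AE g in right_haar. Q (\<phi> g x) = g <# c \<and> \<phi> g x \<in> Z)"

lemma AE_typical:
  assumes "Z \<in> sets M" "AE x in M. x \<in> Z"
  shows "AE x in M. typical Z x (Q x)"
  using AE_haar_equivariant AE_orbit_AE[OF assms] AE_space
  by eventually_elim (auto simp: typical_def Q_coset)

text \<open>Right invariance of Haar measure enters here.\<close>

lemma typical_translate:
  assumes c: "typical Z x c" and r: "r \<in> carrier G"
  shows "typical Z (\<phi> r x) (r <# c)"
proof -
  have x: "x \<in> space M" and cos: "c \<in> lcosets H" using c by (auto simp: typical_def)
  have "AE g in right_haar. Q (\<phi> (g \<otimes> r) x) = (g \<otimes> r) <# c \<and> \<phi> (g \<otimes> r) x \<in> Z"
    using c by (intro AE_right_haar_translate[OF r]) (simp add: typical_def)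
  then have "AE g in right_haar. Q (\<phi> g (\<phi> r x)) = g <# (r <# c) \<and> \<phi> g (\<phi> r x) \<in> Z"
    using AE_space[of right_haar] by eventually_elim (simp add: act_mult r x l_coset_assoc cos)
  then show ?thesis using x r cos by (simp add: typical_def act_closed coset_translate)
qed

lemma typical_common:
  assumes "typical Z x c" "typical Z y d"
  obtains g where "g \<in> carrier G" "Q (\<phi> g x) = g <# c" "\<phi> g x \<in> Z" "Q (\<phi> g y) = g <# d" "\<phi> g y \<in> Z"
proof -
  have "AE g in right_haar. Q (\<phi> g x) = g <# c \<and> \<phi> g x \<in> Z"
    "AE g in right_haar. Q (\<phi> g y) = g <# d \<and> \<phi> g y \<in> Z"
    using assms by (auto simp: typical_def)
  then have "AE g in right_haar. Q (\<phi> g x) = g <# c \<and> \<phi> g x \<in> Z \<and> Q (\<phi> g y) = g <# d \<and> \<phi> g y \<in> Z"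
    by eventually_elim simp
  then show ?thesis by (rule AE_right_haar_exists) (use that in blast)
qed

lemma typical_unique:
  assumes "typical Z x c" "typical Z x d"
  shows "c = d"
proof -
  obtain g where "g \<in> carrier G" "Q (\<phi> g x) = g <# c" "Q (\<phi> g x) = g <# d"
    by (rule typical_common[OF assms]) (rule that)
  then show ?thesis using assms by (intro l_coset_cancel[of c d g]) (auto simp: typical_def)
qed

lemma typical_stabilizer:
  assumes "typical Z x c" "g \<in> carrier G" "\<phi> g x = x"
  shows "g <# c = c"
proof (rule typical_unique[OF _ assms(1)])
  show "typical Z x (g <# c)" using typical_translate[OF assms(1,2)] unfolding assms(3) .
qed

lemma typical_base:
  assumes "typical Z x c" "t \<in> c"
  shows "typical Z (\<phi> (inv t) x) H" and "t \<in> carrier G"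
proof -
  have c: "c \<in> lcosets H" using assms(1) by (simp add: typical_def)
  show t: "t \<in> carrier G" using coset_carrier[OF c] assms(2) by auto
  have "inv t <# c = H"
    unfolding coset_eq[OF c assms(2)] using t H_carrier by (simp add: lcos_m_assoc lcos_mult_one)
  then show "typical Z (\<phi> (inv t) x) H" using typical_translate[OF assms(1), of "inv t"] t by simp
qed

section \<open>Finite fibres force a conull orbit\<close>

text \<open>The intersection of the orbit of \<open>x\<close> with the fibre over the base coset \<open>H\<close>, if \<open>Q\<close> is taken to be
  exactly equivariant along the orbit.\<close>

definition fibre_orbit :: "'b \<Rightarrow> 'b set" where
  "fibre_orbit x = (\<lambda>t. \<phi> (inv t) x) ` Q x"

lemma generic_separation_finite:
  assumes "finite F" "F \<noteq> {}" "F \<subseteq> space M" "z \<in> space M" "z \<notin> F"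
  shows "\<exists>A\<in>separators. \<exists>U. openin T U \<and> U \<noteq> {} \<and> meager_in T (U - hits A z) \<and>
     (\<forall>w\<in>F. meager_in T (U \<inter> hits A w))"
  using assms
proof (induction F rule: finite_ne_induct)
  case (singleton w)
  have "openin T (carrier G)" "carrier G \<noteq> {}" using openin_topspace[of T] by auto
  from generic_separation[OF _ _ _ this, of z w] singleton show ?case
    by (metis insert_subset singletonD singletonI)
next
  case (insert w F)
  then obtain A U where A: "A \<in> separators" "openin T U" "U \<noteq> {}" "meager_in T (U - hits A z)"
      "\<And>w. w \<in> F \<Longrightarrow> meager_in T (U \<inter> hits A w)"
    by auto
  have zw: "z \<in> space M" "w \<in> space M" "z \<noteq> w" using insert.prems by auto
  obtain B V where B: "B \<in> separators" "openin T V" "V \<noteq> {}" "V \<subseteq> U" "meager_in T (V - hits B z)"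
      "meager_in T (V \<inter> hits B w)"
    by (rule generic_separation[OF zw A(2,3)])
  have "meager_in T (V - hits (A \<inter> B) z)"
    by (rule meager_in_subset[OF meager_in_Un[OF A(4) B(5)]]) (use B(4) in \<open>auto simp: hits_def\<close>)
  moreover have "meager_in T (V \<inter> hits (A \<inter> B) v)" if v: "v \<in> insert w F" for v
  proof (cases "v = w")
    case True
    show ?thesis unfolding True by (rule meager_in_subset[OF B(6)]) (auto simp: hits_def)
  next
    case False
    then have "v \<in> F" using v by simp
    show ?thesis by (rule meager_in_subset[OF A(5)[OF \<open>v \<in> F\<close>]]) (use B(4) in \<open>auto simp: hits_def\<close>)
  qed
  ultimately show ?case using B(2,3) separators(3)[OF A(1) B(1)] by blast
qed

lemma r_coset_Diff_subset: "(A #> g) - (B #> g) \<subseteq> (A - B) #> g"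
  unfolding r_coset_def by blast

text \<open>A condition on the fibre orbit of \<open>x\<close> (see \<open>orbit_test_iff\<close>), written so that it involves only \<open>x\<close>
  and \<open>Q x\<close> and is visibly measurable. The fibre over \<open>H\<close> may be a null set, so it cannot be
  tested directly.\<close>

definition orbit_test :: "'b set \<Rightarrow> 'a set \<Rightarrow> 'b \<Rightarrow> bool" where
  "orbit_test A U x \<longleftrightarrow>
     (\<exists>V\<in>basis. meager_in T (V - hits A x) \<and> Q x \<inter> (\<Union>v\<in>V. inv v <# U) \<noteq> {})"

text \<open>For \<open>t\<close> in \<open>Q x\<close>, the set of \<open>h\<close> that take \<open>\<phi> (inv t) x\<close> into \<open>A\<close> is the right translate by \<open>t\<close> of the
  corresponding set for \<open>x\<close>. So an open set on which it is comeager corresponds to an open set on which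
  the set for \<open>x\<close> is comeager.\<close>

lemma orbit_test_iff:
  assumes x: "x \<in> space M" and U: "openin T U"
  shows "orbit_test A U x \<longleftrightarrow>
    (\<exists>z\<in>fibre_orbit x. \<exists>W. openin T W \<and> W \<noteq> {} \<and> W \<subseteq> U \<and> meager_in T (W - hits A z))"
proof
  have Qc: "Q x \<subseteq> carrier G" using Q_coset[OF x] by (rule coset_carrier)
  have Uc: "U \<subseteq> carrier G" using U by (rule openin_carrier)
  have hits: "hits A (\<phi> (inv t) x) = hits A x #> t" if "t \<in> carrier G" for t
    using hits_translate[of "inv t" x A] that x by simp
  {
    assume "orbit_test A U x"
    then obtain V t where V: "V \<in> basis" "meager_in T (V - hits A x)" "t \<in> Q x" "t \<in> (\<Union>v\<in>V. inv v <# U)"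
      unfolding orbit_test_def by blast
    then obtain v u where vu: "v \<in> V" "u \<in> U" "t = inv v \<otimes> u" by (auto simp: mem_l_coset)
    have Vo: "openin T V" using V(1) by (rule basis(2))
    have c: "v \<in> carrier G" "u \<in> carrier G" "t \<in> carrier G"
      using vu(1,2) V(3) openin_carrier[OF Vo] Uc Qc by auto
    then have "v \<otimes> t = u" using vu(3) by (simp add: m_assoc[symmetric])
    then have "u \<in> (V #> t) \<inter> U" using vu(1,2) by (auto simp: mem_r_coset)
    moreover have "openin T ((V #> t) \<inter> U)" using Vo U c by (intro openin_Int openin_r_coset)
    moreover have "meager_in T ((V #> t) \<inter> U - hits A (\<phi> (inv t) x))"
      unfolding hits[OF c(3)]
      by (rule meager_in_subset[OF meager_r_coset[OF V(2) c(3)]]) (use r_coset_Diff_subset in blast)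
    ultimately show "\<exists>z\<in>fibre_orbit x. \<exists>W. openin T W \<and> W \<noteq> {} \<and> W \<subseteq> U \<and> meager_in T (W - hits A z)"
      using V(3) unfolding fibre_orbit_def by (intro bexI[of _ "\<phi> (inv t) x"] exI[of _ "(V #> t) \<inter> U"]) auto
  }
  {
    assume "\<exists>z\<in>fibre_orbit x. \<exists>W. openin T W \<and> W \<noteq> {} \<and> W \<subseteq> U \<and> meager_in T (W - hits A z)"
    then obtain t W where t: "t \<in> Q x" "openin T W" "W \<noteq> {}" "W \<subseteq> U" "meager_in T (W - hits A (\<phi> (inv t) x))"
      unfolding fibre_orbit_def by auto
    then obtain w where w: "w \<in> W" by auto
    have c: "t \<in> carrier G" "w \<in> carrier G" using t(1) Qc w t(4) Uc by auto
    have "openin T (W #> inv t)" "w \<otimes> inv t \<in> W #> inv t"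
      using t(2) c w by (auto simp: openin_r_coset mem_r_coset)
    from basis(3)[OF this] obtain V where V: "V \<in> basis" "w \<otimes> inv t \<in> V" "V \<subseteq> W #> inv t" by auto
    have hx: "hits A x = hits A (\<phi> (inv t) x) #> inv t"
      using hits[OF c(1)] r_coset_inv_cancel[of "hits A x" t] c(1) by (auto simp: hits_def)
    have ic: "inv t \<in> carrier G" using c by simp
    have "meager_in T (V - hits A x)"
      unfolding hx
      by (rule meager_in_subset[OF meager_r_coset[OF t(5) ic]]) (use V(3) r_coset_Diff_subset in blast)
    moreover have "inv (w \<otimes> inv t) \<otimes> w = t" using c by (simp add: inv_mult_group m_assoc)
    then have "t \<in> inv (w \<otimes> inv t) <# U" using w t(4) unfolding mem_l_coset by (intro bexI[of _ w]) auto
    then have "Q x \<inter> (\<Union>v\<in>V. inv v <# U) \<noteq> {}" using t(1) V(2) by blast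
    ultimately show "orbit_test A U x" unfolding orbit_test_def using V(1) by blast
  }
qed

lemma measurable_orbit_test:
  assumes "A \<in> sets M" "openin T U"
  shows "{x \<in> space M. orbit_test A U x} \<in> sets M"
  unfolding orbit_test_def
proof (rule sets.sets_Collect_countable_Ex'[OF _ basis(1)])
  fix V assume V: "V \<in> basis"
  have "openin T (\<Union>v\<in>V. inv v <# U)"
    using openin_carrier[OF basis(2)[OF V]] assms(2) by (auto intro!: openin_Union openin_l_coset)
  then show "{x \<in> space M. meager_in T (V - hits A x) \<and> Q x \<inter> (\<Union>v\<in>V. inv v <# U) \<noteq> {}} \<in> sets M"
    by (intro sets.sets_Collect_conj measurable_comeager_hits assms basis(2)[OF V] Q_measurable)
qed

lemma fibre_orbit_invariant:
  assumes "g \<in> carrier G" "x \<in> space M" "Q (\<phi> g x) = g <# Q x"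
  shows "fibre_orbit (\<phi> g x) = fibre_orbit x"
proof -
  have "\<phi> (inv (g \<otimes> t)) (\<phi> g x) = \<phi> (inv t) x" if "t \<in> Q x" for t
  proof -
    have t: "t \<in> carrier G" using that coset_carrier[OF Q_coset[OF assms(2)]] by auto
    have "inv (g \<otimes> t) \<otimes> g = inv t" using t assms(1) by (simp add: inv_mult_group m_assoc)
    then show ?thesis using act_mult[of "inv (g \<otimes> t)" g x] t assms(1,2) by simp
  qed
  then show ?thesis unfolding fibre_orbit_def assms(3) by (force simp: l_coset_def)
qed

text \<open>For each group element \<open>g\<close> and almost every \<open>x\<close>, the points \<open>x\<close> and \<open>\<phi> g x\<close> have the same fibre orbit,
  so by ergodicity each of the countably many orbit tests is almost surely constant. If two typical points with the same test results lay in
  different orbits, their fibre orbits would be disjoint finite sets, and a test would distinguish a point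
  of the first from all points of the second.\<close>

theorem essentially_transitive_if_finite_fibres:
  assumes Z: "Z \<in> sets M" "AE x in M. x \<in> Z"
    and finite: "\<And>z. typical Z z H \<Longrightarrow> finite ((\<lambda>h. \<phi> h z) ` H)"
  shows "essentially_transitive G M \<phi>"
proof -
  have const: "\<exists>b. AE x in M. orbit_test A U x = b" if "A \<in> separators" "U \<in> basis" for A U
  proof -
    let ?B = "{x \<in> space M. orbit_test A U x}"
    have U: "openin T U" using that(2) by (rule basis(2))
    have "(AE x in M. x \<in> ?B) \<or> (AE x in M. x \<notin> ?B)"
    proof (rule AE_invariant_dichotomy)
      show "?B \<in> sets M" using separators(2)[OF that(1)] U by (rule measurable_orbit_test)
      fix g assume g: "g \<in> carrier G"
      show "AE x in M. \<phi> g x \<in> ?B \<longleftrightarrow> x \<in> ?B"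
        using Q_equivariant[OF g] AE_space
      proof eventually_elim
        case (elim x)
        then show ?case
          using fibre_orbit_invariant[OF g elim(2,1)] act_closed[OF g elim(2)]
          by (simp add: orbit_test_iff[OF _ U])
      qed
    qed
    then show ?thesis
    proof
      assume "AE x in M. x \<in> ?B"
      then have "AE x in M. orbit_test A U x = True" by eventually_elim simp
      then show ?thesis ..
    next
      assume "AE x in M. x \<notin> ?B"
      then have "AE x in M. orbit_test A U x = False" using AE_space by eventually_elim simp
      then show ?thesis ..
    qed
  qed
  then obtain b where b: "\<And>A U. A \<in> separators \<Longrightarrow> U \<in> basis \<Longrightarrow> AE x in M. orbit_test A U x = b A U"
    by metis
  have all: "AE x in M. \<forall>i\<in>separators \<times> basis. orbit_test (fst i) (snd i) x = b (fst i) (snd i)"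
    by (subst AE_ball_countable) (use separators(1) basis(1) b in auto)
  have generic: "AE x in M. x \<in> space M \<and> typical Z x (Q x) \<and>
      (\<forall>A\<in>separators. \<forall>U\<in>basis. orbit_test A U x = b A U)"
    using all AE_typical[OF Z] AE_space by eventually_elim auto
  have "ae_filter M \<noteq> bot" by (simp add: ae_filter_eq_bot_iff emeasure_space_1)
  from eventually_happens'[OF this generic] obtain x0 where x0: "x0 \<in> space M" "typical Z x0 (Q x0)"
      "\<And>A U. A \<in> separators \<Longrightarrow> U \<in> basis \<Longrightarrow> orbit_test A U x0 = b A U"
    by auto
  have fin: "finite (fibre_orbit x)" "fibre_orbit x \<subseteq> orbit G \<phi> x" "fibre_orbit x \<noteq> {}"
    if x: "x \<in> space M" "typical Z x (Q x)" for x
  proof -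
    have Qx: "Q x \<in> lcosets H" using Q_coset[OF x(1)] .
    show "fibre_orbit x \<noteq> {}" using coset_nonempty[OF Qx] by (simp add: fibre_orbit_def)
    show "fibre_orbit x \<subseteq> orbit G \<phi> x"
      using coset_carrier[OF Qx] by (auto simp: fibre_orbit_def orbit_def subset_iff)
    obtain t where t: "t \<in> Q x" using coset_nonempty[OF Qx] by auto
    have tc: "t \<in> carrier G" using t coset_carrier[OF Qx] by auto
    have "fibre_orbit x \<subseteq> (\<lambda>h. \<phi> h (\<phi> (inv t) x)) ` H"
    proof
      fix z assume "z \<in> fibre_orbit x"
      then obtain s where s: "s \<in> Q x" "z = \<phi> (inv s) x" by (auto simp: fibre_orbit_def)
      then obtain h where h: "h \<in> H" "s = t \<otimes> h" using coset_eq[OF Qx t] by (auto simp: mem_l_coset)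
      have hc: "h \<in> carrier G" using h H_carrier by auto
      have "z = \<phi> (inv h) (\<phi> (inv t) x)"
        using s(2) h(2) hc tc x(1) by (simp add: inv_mult_group act_mult)
      then show "z \<in> (\<lambda>h. \<phi> h (\<phi> (inv t) x)) ` H"
        using subgroup.m_inv_closed[OF subgroup_H h(1)] by blast
    qed
    then show "finite (fibre_orbit x)"
      using finite[OF typical_base(1)[OF x(2) t]] by (rule finite_subset)
  qed
  have "AE x in M. x \<in> orbit G \<phi> x0"
    using generic
  proof eventually_elim
    case (elim x)
    then have x: "x \<in> space M" "typical Z x (Q x)"
        "\<And>A U. A \<in> separators \<Longrightarrow> U \<in> basis \<Longrightarrow> orbit_test A U x = b A U" by auto
    show ?case
    proof (rule ccontr)
      assume no: "x \<notin> orbit G \<phi> x0"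
      obtain z where z: "z \<in> fibre_orbit x0" using fin(3)[OF x0(1,2)] by auto
      have zo: "z \<in> orbit G \<phi> x0" using z fin(2)[OF x0(1,2)] by auto
      have orbit_space: "orbit G \<phi> y \<subseteq> space M" if "y \<in> space M" for y
        using that act_closed by (auto simp: orbit_def)
      have "z \<notin> fibre_orbit x"
      proof
        assume "z \<in> fibre_orbit x"
        then have "z \<in> orbit G \<phi> x" using fin(2)[OF x(1,2)] by auto
        then have "x \<in> orbit G \<phi> z" using orbit_sym[OF x(1)] orbit_space[OF x(1)] by auto
        then have "x \<in> orbit G \<phi> x0" using orbit_trans[OF x0(1) _ x(1) zo] orbit_space[OF x0(1)] zo by auto
        then show False using no by simp
      qed
      moreover have "fibre_orbit x \<subseteq> space M" "z \<in> space M"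
        using fin(2)[OF x(1,2)] orbit_space[OF x(1)] zo orbit_space[OF x0(1)] by auto
      ultimately have "\<exists>A\<in>separators. \<exists>U. openin T U \<and> U \<noteq> {} \<and> meager_in T (U - hits A z) \<and>
          (\<forall>w\<in>fibre_orbit x. meager_in T (U \<inter> hits A w))"
        by (intro generic_separation_finite fin(1,3)[OF x(1,2)])
      then obtain A U where A: "A \<in> separators" "openin T U" "U \<noteq> {}" "meager_in T (U - hits A z)"
          "\<And>w. w \<in> fibre_orbit x \<Longrightarrow> meager_in T (U \<inter> hits A w)"
        by auto
      obtain u where "u \<in> U" using A(3) by auto
      obtain V where V: "V \<in> basis" "u \<in> V" "V \<subseteq> U" using basis(3)[OF A(2) \<open>u \<in> U\<close>] by auto
      have Vo: "openin T V" using V(1) by (rule basis(2))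
      have "meager_in T (V - hits A z)" by (rule meager_in_subset[OF A(4)]) (use V(3) in auto)
      then have "orbit_test A V x0"
        using z V(2) Vo unfolding orbit_test_iff[OF x0(1) Vo] by (intro bexI[of _ z] exI[of _ V]) auto
      then have "orbit_test A V x" using x0(3)[OF A(1) V(1)] x(3)[OF A(1) V(1)] by simp
      then obtain w W where w: "w \<in> fibre_orbit x" "openin T W" "W \<noteq> {}" "W \<subseteq> V" "meager_in T (W - hits A w)"
        unfolding orbit_test_iff[OF x(1) Vo] by auto
      have "meager_in T W"
        by (rule meager_in_subset[OF meager_in_Un[OF w(5) A(5)[OF w(1)]]]) (use w(4) V(3) in auto)
      then show False using nonempty_open_not_meager[OF w(2,3)] by simp
    qed
  qed
  then have "emeasure M (orbit G \<phi> x0) = 1"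
    using orbit_measurable[OF x0(1)] by (intro emeasure_eq_1_AE)
  then show ?thesis unfolding essentially_transitive_def using x0(1) by blast
qed

end

section \<open>Stabilizers that depend on a projection only\<close>

context lcsc
begin

lemma closed_sets_separated_by_compacts:
  obtains \<K> where "countable \<K>" "\<And>K. K \<in> \<K> \<Longrightarrow> compactin T K"
    "\<And>S S'. closedin T S \<Longrightarrow> closedin T S' \<Longrightarrow> (\<forall>K\<in>\<K>. K \<inter> S \<noteq> {} \<longleftrightarrow> K \<inter> S' \<noteq> {}) \<Longrightarrow> S = S'"
proof -
  have "\<forall>V\<in>basis. \<exists>\<K>. countable \<K> \<and> (\<forall>K\<in>\<K>. compactin T K) \<and> \<Union>\<K> = V"
  proof
    fix V assume "V \<in> basis"
    then have "openin T V" by (rule basis(2))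
    then show "\<exists>\<K>. countable \<K> \<and> (\<forall>K\<in>\<K>. compactin T K) \<and> \<Union>\<K> = V"
      by (rule open_sigma_compact) (intro exI conjI ballI)
  qed
  from bchoice[OF this]
  obtain \<K> where \<K>: "\<forall>V\<in>basis. countable (\<K> V) \<and> (\<forall>K\<in>\<K> V. compactin T K) \<and> \<Union>(\<K> V) = V" ..
  have sub: "S \<subseteq> S'" if S: "closedin T S" "closedin T S'"
      and eq: "\<forall>K\<in>(\<Union>V\<in>basis. \<K> V). K \<inter> S \<noteq> {} \<longleftrightarrow> K \<inter> S' \<noteq> {}" for S S'
  proof
    fix g assume g: "g \<in> S"
    show "g \<in> S'"
    proof (rule ccontr)
      assume "g \<notin> S'"
      then have "openin T (topspace T - S')" "g \<in> topspace T - S'"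
        using S g closedin_carrier[OF S(1)] by (auto simp: closedin_def)
      from basis(3)[OF this] obtain V where V: "V \<in> basis" "g \<in> V" "V \<subseteq> topspace T - S'" by auto
      then have "g \<in> \<Union>(\<K> V)" using \<K> by simp
      then obtain K where K: "K \<in> \<K> V" "g \<in> K" by auto
      then have "K \<subseteq> V" using \<K> V(1) by auto
      then have "K \<inter> S' = {}" using V(3) by auto
      moreover have "K \<inter> S \<noteq> {}" using K(2) g by auto
      ultimately show False using eq K(1) V(1) by auto
    qed
  qed
  show ?thesis
  proof (rule that[of "\<Union>V\<in>basis. \<K> V"])
    show "countable (\<Union>V\<in>basis. \<K> V)" using basis(1) \<K> by (intro countable_UN) auto
    show "compactin T K" if "K \<in> (\<Union>V\<in>basis. \<K> V)" for K using that \<K> by auto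
    show "S = S'" if "closedin T S" "closedin T S'"
      "\<forall>K\<in>(\<Union>V\<in>basis. \<K> V). K \<inter> S \<noteq> {} \<longleftrightarrow> K \<inter> S' \<noteq> {}" for S S'
      using sub[OF that] sub[OF that(2,1)] that(3) by (intro equalityI) auto
  qed
qed

end

context lcsc_action
begin

lemma measurable_fixed_by_closed_nontrivial:
  assumes L: "closedin T L"
  shows "{x \<in> space M. \<exists>g\<in>L - {\<one>}. \<phi> g x = x} \<in> sets M"
proof -
  have "closedin T {\<one>}" using Hausdorff_T closedin_Hausdorff_singleton by fastforce
  then have "openin T (topspace T - {\<one>})" by (simp add: closedin_def)
  then obtain \<K> where \<K>: "countable \<K>" "\<And>K. K \<in> \<K> \<Longrightarrow> compactin T K" "\<Union>\<K> = topspace T - {\<one>}"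
    by (rule open_sigma_compact) (rule that)
  have "{x \<in> space M. \<exists>g\<in>L - {\<one>}. \<phi> g x = x} = (\<Union>K\<in>\<K>. {x \<in> space M. \<exists>g\<in>L \<inter> K. \<phi> g x = x})"
  proof -
    have "L - {\<one>} = (\<Union>K\<in>\<K>. L \<inter> K)" using \<K>(3) closedin_carrier[OF L] by auto
    then show ?thesis by auto
  qed
  moreover have "{x \<in> space M. \<exists>g\<in>L \<inter> K. \<phi> g x = x} \<in> sets M" if "K \<in> \<K>" for K
    using \<K>(2)[OF that] by (intro measurable_fixed_by_compact closed_Int_compactin L)
  ultimately show ?thesis using \<K>(1) by (simp only:) (intro sets.countable_UN' image_subsetI)
qed

lemma invariant_if_commuting:
  assumes "x \<in> space M" "n \<in> carrier G" "g \<in> carrier G" "g \<otimes> n = n \<otimes> g"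
  shows "\<phi> g (\<phi> n x) = \<phi> n x \<longleftrightarrow> \<phi> g x = x"
  using assms act_mult[of g n x] act_mult[of n g x] act_inject[of n "\<phi> g x" x] act_closed by simp

end

context coset_valued_map
begin

text \<open>Since \<open>N\<close> commutes with \<open>L\<close>, the set of points fixed by some element of a compact part of \<open>L\<close> is
  invariant under \<open>N\<close>, so by hypothesis it is determined by the projection of \<open>Q x\<close> off a null set.
  Stabilizers are closed, and countably many compact sets suffice to recover a closed set from the compact
  sets that it hits; so a single null set serves for all of \<open>L\<close>.\<close>

lemma stabilizer_determined_by_projection:
  assumes L: "closedin T L" and N: "N \<subseteq> carrier G"
    and comm: "\<And>l n. l \<in> L \<Longrightarrow> n \<in> N \<Longrightarrow> l \<otimes> n = n \<otimes> l"
    and det: "\<And>A. A \<in> sets M \<Longrightarrow> (\<And>n x. n \<in> N \<Longrightarrow> x \<in> space M \<Longrightarrow> \<phi> n x \<in> A \<longleftrightarrow> x \<in> A) \<Longrightarrow>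
       \<exists>Z\<in>sets M. (AE x in M. x \<in> Z) \<and> (\<forall>x\<in>Z. \<forall>y\<in>Z. pr (Q x) = pr (Q y) \<longrightarrow> (x \<in> A \<longleftrightarrow> y \<in> A))"
  shows "\<exists>Z\<in>sets M. (AE x in M. x \<in> Z) \<and>
    (\<forall>x\<in>Z. \<forall>y\<in>Z. pr (Q x) = pr (Q y) \<longrightarrow> stabilizer G \<phi> x \<inter> L = stabilizer G \<phi> y \<inter> L)"
proof -
  obtain \<K> where \<K>: "countable \<K>" "\<And>K. K \<in> \<K> \<Longrightarrow> compactin T K"
    "\<And>S S'. closedin T S \<Longrightarrow> closedin T S' \<Longrightarrow> (\<forall>K\<in>\<K>. K \<inter> S \<noteq> {} \<longleftrightarrow> K \<inter> S' \<noteq> {}) \<Longrightarrow> S = S'"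
    by (rule closed_sets_separated_by_compacts) (rule that)
  define A where "A K = {x \<in> space M. \<exists>g\<in>L \<inter> K. \<phi> g x = x}" for K
  have Lc: "L \<subseteq> carrier G" using L by (rule closedin_carrier)
  have "\<forall>K\<in>\<K>. \<exists>Z. Z \<in> sets M \<and> (AE x in M. x \<in> Z) \<and>
      (\<forall>x\<in>Z. \<forall>y\<in>Z. pr (Q x) = pr (Q y) \<longrightarrow> (x \<in> A K \<longleftrightarrow> y \<in> A K))"
  proof
    fix K assume K: "K \<in> \<K>"
    have "A K \<in> sets M"
      unfolding A_def using \<K>(2)[OF K] by (intro measurable_fixed_by_compact closed_Int_compactin L)
    moreover have "\<phi> n x \<in> A K \<longleftrightarrow> x \<in> A K" if n: "n \<in> N" and x: "x \<in> space M" for n x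
    proof -
      have nc: "n \<in> carrier G" using n N by auto
      have "\<phi> g (\<phi> n x) = \<phi> n x \<longleftrightarrow> \<phi> g x = x" if "g \<in> L \<inter> K" for g
        using that Lc by (intro invariant_if_commuting x nc comm n) auto
      then show ?thesis using x act_closed[OF nc x] by (auto simp: A_def)
    qed
    ultimately show "\<exists>Z. Z \<in> sets M \<and> (AE x in M. x \<in> Z) \<and>
      (\<forall>x\<in>Z. \<forall>y\<in>Z. pr (Q x) = pr (Q y) \<longrightarrow> (x \<in> A K \<longleftrightarrow> y \<in> A K))"
      using det[of "A K"] unfolding Bex_def by simp
  qed
  from bchoice[OF this] obtain Z where Z: "\<forall>K\<in>\<K>. Z K \<in> sets M \<and> (AE x in M. x \<in> Z K) \<and>
      (\<forall>x\<in>Z K. \<forall>y\<in>Z K. pr (Q x) = pr (Q y) \<longrightarrow> (x \<in> A K \<longleftrightarrow> y \<in> A K))" ..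
  let ?Z = "space M - (\<Union>K\<in>\<K>. space M - Z K)"
  have "(\<Union>K\<in>\<K>. space M - Z K) \<in> sets M" using \<K>(1) Z by (intro sets.countable_UN' image_subsetI) auto
  then have Z1: "?Z \<in> sets M" by auto
  have "AE x in M. \<forall>K\<in>\<K>. x \<in> Z K" by (subst AE_ball_countable) (use \<K>(1) Z in auto)
  then have Z2: "AE x in M. x \<in> ?Z" using AE_space by eventually_elim auto
  have Z3: "stabilizer G \<phi> x \<inter> L = stabilizer G \<phi> y \<inter> L"
    if x: "x \<in> ?Z" and y: "y \<in> ?Z" and eq: "pr (Q x) = pr (Q y)" for x y
  proof (rule \<K>(3))
    have xy: "x \<in> space M" "y \<in> space M" using x y by auto
    show "closedin T (stabilizer G \<phi> x \<inter> L)" "closedin T (stabilizer G \<phi> y \<inter> L)"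
      using stabilizer_closed xy L by (auto intro: closedin_Int)
    show "\<forall>K\<in>\<K>. K \<inter> (stabilizer G \<phi> x \<inter> L) \<noteq> {} \<longleftrightarrow> K \<inter> (stabilizer G \<phi> y \<inter> L) \<noteq> {}"
    proof
      fix K assume K: "K \<in> \<K>"
      have hit: "K \<inter> (stabilizer G \<phi> v \<inter> L) \<noteq> {} \<longleftrightarrow> v \<in> A K" if "v \<in> space M" for v
        using that Lc by (auto simp: A_def stabilizer_def)
      have xyZ: "x \<in> Z K" "y \<in> Z K" using x y K by auto
      have "\<forall>x\<in>Z K. \<forall>y\<in>Z K. pr (Q x) = pr (Q y) \<longrightarrow> (x \<in> A K \<longleftrightarrow> y \<in> A K)"
        using bspec[OF Z K] by (elim conjE)
      from this[rule_format, OF xyZ eq] show "K \<inter> (stabilizer G \<phi> x \<inter> L) \<noteq> {} \<longleftrightarrow> K \<inter> (stabilizer G \<phi> y \<inter> L) \<noteq> {}"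
        unfolding hit[OF xy(1)] hit[OF xy(2)] .
    qed
  qed
  show ?thesis by (intro bexI[of _ ?Z] conjI ballI impI Z1 Z2 Z3)
qed

end

section \<open>Products of groups\<close>

lemma product_box_refine:
  assumes I: "finite I" and U: "openin (product_topology T I) U" "x \<in> U"
    and B: "\<And>i V y. i \<in> I \<Longrightarrow> openin (T i) V \<Longrightarrow> y \<in> V \<Longrightarrow> \<exists>W\<in>B i. y \<in> W \<and> W \<subseteq> V"
  obtains V where "V \<in> PiE I B" "x \<in> PiE I V" "PiE I V \<subseteq> U"
proof -
  obtain V where V: "\<And>i. i \<in> I \<Longrightarrow> openin (T i) (V i)" "x \<in> PiE I V" "PiE I V \<subseteq> U"
    using U unfolding openin_product_topology_alt by metis
  have "\<forall>i\<in>I. \<exists>W. W \<in> B i \<and> x i \<in> W \<and> W \<subseteq> V i"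
    using B V(1,2) PiE_mem by fastforce
  from bchoice[OF this] obtain W where W: "\<forall>i\<in>I. W i \<in> B i \<and> x i \<in> W i \<and> W i \<subseteq> V i" ..
  have "PiE I (restrict W I) \<subseteq> PiE I V" using W by (intro PiE_mono) simp
  then show ?thesis
    using W V(2,3) by (intro that[of "restrict W I"]) (auto simp: PiE_iff)
qed

lemma second_countable_product_topology:
  assumes I: "finite I" and T: "\<And>i. i \<in> I \<Longrightarrow> second_countable (T i)"
  shows "second_countable (product_topology T I)"
proof -
  have "\<forall>i\<in>I. \<exists>B. countable B \<and> (\<forall>V\<in>B. openin (T i) V) \<and>
      (\<forall>U x. openin (T i) U \<and> x \<in> U \<longrightarrow> (\<exists>V\<in>B. x \<in> V \<and> V \<subseteq> U))"
    using T unfolding second_countable_def by simp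
  from bchoice[OF this] obtain B where B: "\<forall>i\<in>I. countable (B i) \<and> (\<forall>V\<in>B i. openin (T i) V) \<and>
      (\<forall>U x. openin (T i) U \<and> x \<in> U \<longrightarrow> (\<exists>V\<in>B i. x \<in> V \<and> V \<subseteq> U))" ..
  show ?thesis
    unfolding second_countable_def
  proof (intro exI[of _ "PiE I ` PiE I B"] conjI ballI allI impI)
    show "countable (PiE I ` PiE I B)" using B I by (intro countable_image countable_PiE) auto
    show "openin (product_topology T I) V" if VW: "V \<in> PiE I ` PiE I B" for V
    proof -
      obtain W where W: "V = PiE I W" "W \<in> PiE I B" by (rule imageE[OF VW])
      have "openin (T i) (W i)" if "i \<in> I" for i using that PiE_mem[OF W(2) that] B by auto
      then show ?thesis unfolding W(1) using I by (simp add: openin_PiE)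
    qed
    show "\<exists>V\<in>PiE I ` PiE I B. x \<in> V \<and> V \<subseteq> U" if U: "openin (product_topology T I) U \<and> x \<in> U" for U x
    proof -
      obtain V where "V \<in> PiE I B" "x \<in> PiE I V" "PiE I V \<subseteq> U"
        by (rule product_box_refine[OF I conjunct1[OF U] conjunct2[OF U], of B]) (use B in auto)
      then show ?thesis by (intro bexI[of _ "PiE I V"]) auto
    qed
  qed
qed

lemma lcsc_group_product:
  assumes I: "finite I" and G: "\<And>i. i \<in> I \<Longrightarrow> lcsc_group (G i) (T i)"
  shows "lcsc_group (product_group I G) (product_topology T I)"
proof -
  have L: "lcsc (G i) (T i)" if "i \<in> I" for i
    using G[OF that] by (simp add: lcsc_def lcsc_axioms_def lcsc_group_def)
  have grp: "group (G i)" if "i \<in> I" for i using G[OF that] by (simp add: lcsc_group_def)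
  have top: "topspace (T i) = carrier (G i)" if "i \<in> I" for i using G[OF that] by (simp add: lcsc_group_def)
  let ?P = "product_topology T I" and ?GG = "product_group I G"
  have tsp: "topspace ?P = carrier ?GG" using top by (auto simp: PiE_iff)
  have pr: "continuous_map ?P (T i) (\<lambda>x. x i)" if "i \<in> I" for i
    using that by (rule continuous_map_product_projection)
  have mult: "continuous_map (prod_topology ?P ?P) ?P (\<lambda>(x, y). x \<otimes>\<^bsub>?GG\<^esub> y)"
    unfolding continuous_map_componentwise
  proof (intro conjI ballI)
    fix i assume i: "i \<in> I"
    have "continuous_map (prod_topology ?P ?P) (prod_topology (T i) (T i)) (\<lambda>p. (fst p i, snd p i))"
      using continuous_map_compose[OF continuous_map_fst[of ?P ?P] pr[OF i]] continuous_map_compose[OF continuous_map_snd[of ?P ?P] pr[OF i]]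
      by (simp add: continuous_map_pairwise o_def)
    from continuous_map_compose[OF this lcsc.continuous_mult[OF L[OF i]]]
    show "continuous_map (prod_topology ?P ?P) (T i) (\<lambda>p. (case p of (x, y) \<Rightarrow> x \<otimes>\<^bsub>?GG\<^esub> y) i)"
      using i by (simp add: o_def split_beta)
  qed (auto simp: split_beta)
  have "continuous_map ?P ?P (\<lambda>x. \<lambda>i\<in>I. inv\<^bsub>G i\<^esub> x i)"
    unfolding continuous_map_componentwise
  proof (intro conjI ballI)
    fix i assume i: "i \<in> I"
    from continuous_map_compose[OF pr[OF i] lcsc.continuous_inv[OF L[OF i]]]
    show "continuous_map ?P (T i) (\<lambda>x. (\<lambda>i\<in>I. inv\<^bsub>G i\<^esub> x i) i)" using i by (simp add: o_def)
  qed auto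
  then have inv: "continuous_map ?P ?P (\<lambda>x. inv\<^bsub>?GG\<^esub> x)"
    by (rule continuous_map_eq) (use tsp grp in simp)
  have "Hausdorff_space ?P" using lcsc.Hausdorff_T[OF L] by (simp add: Hausdorff_space_product_topology)
  moreover have "locally_compact_space ?P"
    using lcsc.locally_compact_T[OF L] I by (simp add: locally_compact_space_product_topology)
  moreover have "second_countable ?P"
    using lcsc.second_countable_T[OF L] I by (intro second_countable_product_topology)
  ultimately show ?thesis unfolding lcsc_group_def using tsp mult inv grp by simp
qed

lemma factor_embed_closed:
  assumes "\<And>i. i \<in> I \<Longrightarrow> group (G i)" "a \<in> carrier (G j)"
  shows "factor_embed I G j a \<in> carrier (product_group I G)"
  using assms group.is_monoid by (fastforce simp: factor_embed_def intro: monoid.one_closed)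

lemma factor_embed_one: "factor_embed I G j \<one>\<^bsub>G j\<^esub> = \<one>\<^bsub>product_group I G\<^esub>"
  by (auto simp: factor_embed_def)

lemma factor_embed_mult:
  assumes "\<And>i. i \<in> I \<Longrightarrow> group (G i)"
  shows "factor_embed I G j (a \<otimes>\<^bsub>G j\<^esub> b) =
    factor_embed I G j a \<otimes>\<^bsub>product_group I G\<^esub> factor_embed I G j b"
proof -
  have "\<one>\<^bsub>G i\<^esub> \<otimes>\<^bsub>G i\<^esub> \<one>\<^bsub>G i\<^esub> = \<one>\<^bsub>G i\<^esub>" if "i \<in> I" for i
    using assms[OF that] by (simp add: group.is_monoid monoid.l_one monoid.one_closed)
  then show ?thesis by (auto simp: factor_embed_def)
qed

lemma factor_embed_apply: "j \<in> I \<Longrightarrow> factor_embed I G j a j = a"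
  by (simp add: factor_embed_def)

section \<open>The map to the product of the homogeneous spaces\<close>

locale product_action =
  fixes I :: "'i set"
    and G :: "'i \<Rightarrow> 'g monoid" and T :: "'i \<Rightarrow> 'g topology"
    and \<nu> :: "'x measure" and \<phi> :: "('i \<Rightarrow> 'g) \<Rightarrow> 'x \<Rightarrow> 'x"
    and H :: "'i \<Rightarrow> 'g set" and haar :: "'i \<Rightarrow> 'g set measure"
    and Y :: "'i \<Rightarrow> 'y measure" and \<psi> :: "'i \<Rightarrow> ('i \<Rightarrow> 'g) \<Rightarrow> 'y \<Rightarrow> 'y"
    and p :: "'i \<Rightarrow> 'x \<Rightarrow> 'y"
  assumes finite_I: "finite I"
    and lcsc_factor: "\<And>j. j \<in> I \<Longrightarrow> lcsc_group (G j) (T j)"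
    and space: "G_space (product_group I G) (product_topology T I) \<nu> \<phi>"
    and mp: "measure_preserving_action (product_group I G) \<nu> \<phi>"
    and erg: "ergodic_action (product_group I G) \<nu> \<phi>"
    and closed_subgroup_factor: "\<And>j. j \<in> I \<Longrightarrow> subgroup (H j) (G j) \<and> closedin (T j) (H j)"
    and components: "\<And>j. j \<in> I \<Longrightarrow>
           ergodic_components (product_group I G) (product_topology T I)
             (complementary_factor I G j) \<nu> \<phi> (Y j) (\<psi> j) (p j)"
    and Haar: "\<And>j. j \<in> I \<Longrightarrow> Haar_on_cosets (G j) (T j) (H j) (haar j)"
    and isomorphic: "\<And>j. j \<in> I \<Longrightarrow>
           isomorphic_actions (G j) (Y j) (\<lambda>g. \<psi> j (factor_embed I G j g))
             (haar j) (\<lambda>g C. g <#\<^bsub>G j\<^esub> C)"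
    and just_infinite: "\<And>j N. j \<in> I \<Longrightarrow> normal N ((G j)\<lparr>carrier := H j\<rparr>) \<Longrightarrow> N \<noteq> {\<one>\<^bsub>G j\<^esub>} \<Longrightarrow>
           finite (rcosets\<^bsub>(G j)\<lparr>carrier := H j\<rparr>\<^esub> N)"
begin

abbreviation GG :: "('i \<Rightarrow> 'g) monoid" where "GG \<equiv> product_group I G"
abbreviation TT :: "('i \<Rightarrow> 'g) topology" where "TT \<equiv> product_topology T I"
abbreviation emb :: "'i \<Rightarrow> 'g \<Rightarrow> ('i \<Rightarrow> 'g)" where "emb \<equiv> factor_embed I G"

lemma lcsc_G: "j \<in> I \<Longrightarrow> lcsc (G j) (T j)"
  using lcsc_factor by (simp add: lcsc_def lcsc_axioms_def lcsc_group_def)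

lemma group_G: "j \<in> I \<Longrightarrow> group (G j)"
  using lcsc_factor by (simp add: lcsc_group_def)

lemma closed_subgroup_G: "j \<in> I \<Longrightarrow> closed_subgroup (G j) (T j) (H j)"
  using lcsc_G closed_subgroup_factor by (simp add: closed_subgroup_def closed_subgroup_axioms_def)

sublocale E: ergodic_lcsc_action GG TT \<nu> \<phi>
proof -
  have "lcsc_group GG TT" using finite_I lcsc_factor by (rule lcsc_group_product)
  then show "ergodic_lcsc_action GG TT \<nu> \<phi>"
    using space mp erg
    by (simp add: ergodic_lcsc_action_def ergodic_lcsc_action_axioms_def lcsc_action_def
        lcsc_action_axioms_def lcsc_def lcsc_axioms_def lcsc_group_def)
qed

text \<open>The isomorphisms between ergodic components and homogeneous spaces are only given to exist; one such
  pair of maps is chosen for each factor.\<close>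

definition coset_iso :: "'i \<Rightarrow> ('y \<Rightarrow> 'g set) \<times> ('g set \<Rightarrow> 'y)" where
  "coset_iso j = (SOME (F, F'). F \<in> measurable (Y j) (haar j) \<and> F' \<in> measurable (haar j) (Y j) \<and>
     (AE y in Y j. F' (F y) = y) \<and>
     (\<forall>g\<in>carrier (G j). AE y in Y j. F (\<psi> j (emb j g) y) = g <#\<^bsub>G j\<^esub> F y))"

definition F :: "'i \<Rightarrow> 'y \<Rightarrow> 'g set" where "F j = fst (coset_iso j)"
definition F' :: "'i \<Rightarrow> 'g set \<Rightarrow> 'y" where "F' j = snd (coset_iso j)"

lemma coset_map:
  assumes "j \<in> I"
  shows "F j \<in> measurable (Y j) (haar j)" "F' j \<in> measurable (haar j) (Y j)"
    "AE y in Y j. F' j (F j y) = y"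
    "g \<in> carrier (G j) \<Longrightarrow> AE y in Y j. F j (\<psi> j (emb j g) y) = g <#\<^bsub>G j\<^esub> F j y"
proof -
  have "\<exists>q. (\<lambda>(F, F'). F \<in> measurable (Y j) (haar j) \<and> F' \<in> measurable (haar j) (Y j) \<and>
     (AE y in Y j. F' (F y) = y) \<and>
     (\<forall>g\<in>carrier (G j). AE y in Y j. F (\<psi> j (emb j g) y) = g <#\<^bsub>G j\<^esub> F y)) q"
  proof -
    obtain F F' where "F \<in> measurable (Y j) (haar j)" "F' \<in> measurable (haar j) (Y j)"
      "AE y in Y j. F' (F y) = y" "\<forall>g\<in>carrier (G j). AE y in Y j. F (\<psi> j (emb j g) y) = g <#\<^bsub>G j\<^esub> F y"
      using isomorphic[OF assms] unfolding isomorphic_actions_def by (elim exE conjE) (rule that)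
    then show ?thesis by (intro exI[of _ "(F, F')"]) simp
  qed
  from someI_ex[OF this, folded coset_iso_def]
  show "F j \<in> measurable (Y j) (haar j)" "F' j \<in> measurable (haar j) (Y j)"
    "AE y in Y j. F' j (F j y) = y"
    "g \<in> carrier (G j) \<Longrightarrow> AE y in Y j. F j (\<psi> j (emb j g) y) = g <#\<^bsub>G j\<^esub> F j y"
    by (simp_all add: F_def F'_def split_beta)
qed

lemma component_map:
  assumes "j \<in> I"
  shows "p j \<in> measurable \<nu> (Y j)" "distr \<nu> (Y j) (p j) = Y j"
    "g \<in> carrier GG \<Longrightarrow> AE x in \<nu>. p j (\<phi> g x) = \<psi> j g (p j x)"
    "f \<in> Linfty \<nu> \<Longrightarrow> (\<forall>n\<in>complementary_factor I G j. AE x in \<nu>. f (\<phi> n x) = f x) \<longleftrightarrow>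
      (\<exists>h\<in>Linfty (Y j). AE x in \<nu>. f x = h (p j x))"
  using components[OF assms] unfolding ergodic_components_def by simp_all

lemma AE_p:
  assumes j: "j \<in> I" and P: "AE y in Y j. P y"
  shows "AE x in \<nu>. P (p j x)"
proof -
  have "AE y in distr \<nu> (Y j) (p j). P y" unfolding component_map(2)[OF j] by (rule P)
  then show ?thesis by (rule AE_distrD[OF component_map(1)[OF j]])
qed

definition q :: "'i \<Rightarrow> 'x \<Rightarrow> 'g set" where
  "q j x = F j (p j x)"

lemma q_measurable: "j \<in> I \<Longrightarrow> q j \<in> measurable \<nu> (haar j)"
  unfolding q_def using measurable_compose[OF component_map(1) coset_map(1)] by simp

lemma space_haar: "j \<in> I \<Longrightarrow> space (haar j) = lcosets\<^bsub>G j\<^esub> (H j)"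
  using Haar by (simp add: Haar_on_cosets_def)

lemma q_coset: "j \<in> I \<Longrightarrow> x \<in> space \<nu> \<Longrightarrow> q j x \<in> lcosets\<^bsub>G j\<^esub> (H j)"
  using measurable_space[OF q_measurable] space_haar by auto

text \<open>The union of the cosets that meet \<open>U\<close> is \<open>U <#> H\<close>, which is open.\<close>

lemma hitting_cosets_measurable:
  assumes j: "j \<in> I" and U: "openin (T j) U"
  shows "{C \<in> lcosets\<^bsub>G j\<^esub> (H j). C \<inter> U \<noteq> {}} \<in> sets (haar j)"
proof -
  interpret closed_subgroup "G j" "T j" "H j" using closed_subgroup_G[OF j] .
  let ?U = "{C \<in> lcosets\<^bsub>G j\<^esub> (H j). C \<inter> U \<noteq> {}}"
  have Uc: "U \<subseteq> carrier (G j)" using U by (rule openin_carrier)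
  have "\<Union>?U = U <#>\<^bsub>G j\<^esub> H j"
  proof (intro equalityI subsetI)
    fix a assume "a \<in> \<Union>?U"
    then obtain C u where C: "C \<in> lcosets\<^bsub>G j\<^esub> (H j)" "a \<in> C" "u \<in> C" "u \<in> U" by auto
    then have "a \<in> u <#\<^bsub>G j\<^esub> H j" using coset_eq[OF C(1,3)] by simp
    then show "a \<in> U <#>\<^bsub>G j\<^esub> H j" using C(4) by (auto simp: mem_l_coset mem_set_mult)
  next
    fix a assume "a \<in> U <#>\<^bsub>G j\<^esub> H j"
    then obtain u h where u: "u \<in> U" "h \<in> H j" "a = u \<otimes>\<^bsub>G j\<^esub> h" by (auto simp: mem_set_mult)
    have "u <#\<^bsub>G j\<^esub> H j \<in> lcosets\<^bsub>G j\<^esub> (H j)" using u(1) Uc by (auto simp: LCOSETS_def)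
    moreover have "u \<in> u <#\<^bsub>G j\<^esub> H j" using lcos_self[OF _ subgroup_H] u(1) Uc by auto
    moreover have "a \<in> u <#\<^bsub>G j\<^esub> H j" using u by (auto simp: mem_l_coset)
    ultimately show "a \<in> \<Union>?U" using u(1) by auto
  qed
  then have "openin (T j) (\<Union>?U)" using openin_set_mult_right[OF U H_carrier] by simp
  moreover have "sets (haar j) = sigma_sets (lcosets\<^bsub>G j\<^esub> (H j)) {U. U \<subseteq> lcosets\<^bsub>G j\<^esub> (H j) \<and> openin (T j) (\<Union>U)}"
    using Haar[OF j] by (simp add: Haar_on_cosets_def sets_measure_of Pow_def Collect_mono)
  ultimately show ?thesis by auto
qed

lemma q_hits_measurable:
  assumes "j \<in> I" "openin (T j) U"
  shows "{x \<in> space \<nu>. q j x \<inter> U \<noteq> {}} \<in> sets \<nu>"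
proof -
  have "{x \<in> space \<nu>. q j x \<inter> U \<noteq> {}} = q j -` {C \<in> lcosets\<^bsub>G j\<^esub> (H j). C \<inter> U \<noteq> {}} \<inter> space \<nu>"
    using q_coset[OF assms(1)] by auto
  then show ?thesis using measurable_sets[OF q_measurable hitting_cosets_measurable] assms by simp
qed

lemma indicator_Linfty:
  assumes "A \<in> sets M"
  shows "(indicator A :: _ \<Rightarrow> complex) \<in> Linfty M"
proof -
  have "AE x in M. norm (indicator A x :: complex) \<le> 1" by (rule AE_I2) (simp add: indicator_def)
  then show ?thesis using assms unfolding Linfty_def by auto
qed

text \<open>Indicators of sets of cosets pulled back along \<open>q\<close> are functions on the space of ergodic components and
  hence invariant under the complementary factor; countably many of them determine the coset.\<close>

lemma q_invariant:
  assumes j: "j \<in> I" and n: "n \<in> complementary_factor I G j"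
  shows "AE x in \<nu>. q j (\<phi> n x) = q j x"
proof -
  interpret closed_subgroup "G j" "T j" "H j" using closed_subgroup_G[OF j] .
  have nc: "n \<in> carrier GG" using n by (simp add: complementary_factor_def)
  have "AE x in \<nu>. q j (\<phi> n x) \<inter> U \<noteq> {} \<longleftrightarrow> q j x \<inter> U \<noteq> {}" if U: "U \<in> basis" for U
  proof -
    define B where "B = {C \<in> lcosets\<^bsub>G j\<^esub> (H j). C \<inter> U \<noteq> {}}"
    have B: "B \<in> sets (haar j)"
      unfolding B_def by (rule hitting_cosets_measurable[OF j basis(2)[OF U]])
    let ?h = "indicator (F j -` B \<inter> space (Y j)) :: 'y \<Rightarrow> complex"
    let ?f = "indicator (q j -` B \<inter> space \<nu>) :: 'x \<Rightarrow> complex"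
    have "?h \<in> Linfty (Y j)" by (rule indicator_Linfty[OF measurable_sets[OF coset_map(1)[OF j] B]])
    moreover have "AE x in \<nu>. ?f x = ?h (p j x)"
      using measurable_space[OF component_map(1)[OF j]] by (intro AE_I2) (simp add: indicator_def q_def)
    ultimately have "\<forall>n\<in>complementary_factor I G j. AE x in \<nu>. ?f (\<phi> n x) = ?f x"
      using component_map(4)[OF j indicator_Linfty[OF measurable_sets[OF q_measurable[OF j] B]]] by blast
    then have "AE x in \<nu>. ?f (\<phi> n x) = ?f x" using n by simp
    then show ?thesis
      using AE_space
    proof eventually_elim
      case (elim x)
      then have "\<phi> n x \<in> space \<nu>" using E.act_closed[OF nc] by simp
      then show ?case using elim q_coset[OF j] by (auto simp: B_def indicator_def split: if_splits)
    qed
  qed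
  then have "AE x in \<nu>. \<forall>U\<in>basis. q j (\<phi> n x) \<inter> U \<noteq> {} \<longleftrightarrow> q j x \<inter> U \<noteq> {}"
    by (subst AE_ball_countable) (use basis(1) in auto)
  then show ?thesis
    using AE_space
  proof eventually_elim
    case (elim x)
    then show ?case using coset_eq_iff_hits[of "q j (\<phi> n x)" "q j x"] q_coset[OF j] E.act_closed[OF nc] by simp
  qed
qed

lemma emb_carrier: "j \<in> I \<Longrightarrow> a \<in> carrier (G j) \<Longrightarrow> emb j a \<in> carrier GG"
  using factor_embed_closed[of I G a j] group_G by blast

text \<open>Equivariance under the \<open>j\<close>-th factor comes from the isomorphism with the homogeneous space, and the
  remaining part of \<open>g\<close> lies in the complementary factor.\<close>

lemma q_equivariant:
  assumes j: "j \<in> I" and g: "g \<in> carrier GG"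
  shows "AE x in \<nu>. q j (\<phi> g x) = g j <#\<^bsub>G j\<^esub> q j x"
proof -
  interpret group "G j" using group_G[OF j] .
  have gj: "g j \<in> carrier (G j)" using g j by auto
  define e where "e = emb j (g j)"
  define n where "n = inv\<^bsub>GG\<^esub> e \<otimes>\<^bsub>GG\<^esub> g"
  have e: "e \<in> carrier GG" unfolding e_def using emb_carrier[OF j gj] .
  have nc: "n \<in> carrier GG" unfolding n_def by (intro E.m_closed E.inv_closed e g)
  have "e \<otimes>\<^bsub>GG\<^esub> n = (e \<otimes>\<^bsub>GG\<^esub> inv\<^bsub>GG\<^esub> e) \<otimes>\<^bsub>GG\<^esub> g"
    unfolding n_def by (rule E.m_assoc[symmetric, OF e E.inv_closed[OF e] g])
  also have "\<dots> = g" unfolding E.r_inv[OF e] by (rule E.l_one[OF g])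
  finally have en: "e \<otimes>\<^bsub>GG\<^esub> n = g" .
  have "n j = \<one>\<^bsub>G j\<^esub>"
    using j gj e group_G unfolding n_def by (simp add: inv_product_group e_def factor_embed_apply)
  then have n: "n \<in> complementary_factor I G j" using nc by (simp add: complementary_factor_def)
  have "AE y in \<nu>. F j (\<psi> j e (p j y)) = g j <#\<^bsub>G j\<^esub> F j (p j y)"
    using AE_p[OF j coset_map(4)[OF j gj]] by (simp add: e_def)
  then have "AE y in \<nu>. q j (\<phi> e y) = g j <#\<^bsub>G j\<^esub> q j y"
    using component_map(3)[OF j e] by eventually_elim (simp add: q_def)
  from E.AE_act[OF nc this] q_invariant[OF j n] AE_space
  show ?thesis
  proof eventually_elim
    case (elim x)
    then show ?case using E.act_mult[OF e nc elim(3)] unfolding en by simp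
  qed
qed

definition HH :: "('i \<Rightarrow> 'g) set" where "HH = PiE I H"
definition Q :: "'x \<Rightarrow> ('i \<Rightarrow> 'g) set" where "Q x = PiE I (\<lambda>j. q j x)"

lemma PiE_l_coset:
  assumes g: "g \<in> carrier GG" and C: "\<And>j. j \<in> I \<Longrightarrow> C j \<subseteq> carrier (G j)"
  shows "g <#\<^bsub>GG\<^esub> PiE I C = PiE I (\<lambda>j. g j <#\<^bsub>G j\<^esub> C j)"
proof (intro equalityI subsetI)
  fix y assume "y \<in> g <#\<^bsub>GG\<^esub> PiE I C"
  then show "y \<in> PiE I (\<lambda>j. g j <#\<^bsub>G j\<^esub> C j)"
    by (auto simp: l_coset_def PiE_iff)
next
  fix y assume y: "y \<in> PiE I (\<lambda>j. g j <#\<^bsub>G j\<^esub> C j)"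
  then have "\<forall>j\<in>I. \<exists>c. c \<in> C j \<and> y j = g j \<otimes>\<^bsub>G j\<^esub> c" by (force simp: l_coset_def PiE_iff)
  from bchoice[OF this] obtain c where c: "\<forall>j\<in>I. c j \<in> C j \<and> y j = g j \<otimes>\<^bsub>G j\<^esub> c j" ..
  have "y = g \<otimes>\<^bsub>GG\<^esub> restrict c I"
    unfolding mult_product_group using c y by (intro ext) (simp add: PiE_iff extensional_def)
  moreover have "restrict c I \<in> PiE I C" using c by auto
  ultimately show "y \<in> g <#\<^bsub>GG\<^esub> PiE I C" unfolding E.mem_l_coset by blast
qed

sublocale C: coset_valued_map GG TT \<nu> \<phi> HH Q
proof -
  have H: "subgroup (H j) (G j)" "H j \<subseteq> carrier (G j)" if "j \<in> I" for j
    using closed_subgroup_factor[OF that] subgroup.subset by auto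
  have HH1: "subgroup HH GG"
    unfolding HH_def using PiE_subgroup_product_group[of I G H] group_G H by simp
  have HH2: "closedin TT HH"
    unfolding HH_def using closed_subgroup_factor by (simp add: closedin_product_topology)
  have Q1: "Q x \<in> lcosets\<^bsub>GG\<^esub> HH" if x: "x \<in> space \<nu>" for x
  proof -
    have "\<forall>j\<in>I. \<exists>a. a \<in> carrier (G j) \<and> q j x = a <#\<^bsub>G j\<^esub> H j"
    proof
      fix j assume "j \<in> I"
      from q_coset[OF this x] show "\<exists>a. a \<in> carrier (G j) \<and> q j x = a <#\<^bsub>G j\<^esub> H j"
        by (auto simp: LCOSETS_def)
    qed
    from bchoice[OF this] obtain a where a: "\<forall>j\<in>I. a j \<in> carrier (G j) \<and> q j x = a j <#\<^bsub>G j\<^esub> H j" ..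
    have ac: "restrict a I \<in> carrier GG" using a by auto
    have "restrict a I <#\<^bsub>GG\<^esub> HH = PiE I (\<lambda>j. restrict a I j <#\<^bsub>G j\<^esub> H j)"
      unfolding HH_def using ac H(2) by (rule PiE_l_coset)
    also have "\<dots> = Q x" unfolding Q_def using a by (intro PiE_cong) simp
    finally have "Q x = restrict a I <#\<^bsub>GG\<^esub> HH" by (rule sym)
    then show ?thesis unfolding LCOSETS_def using ac by blast
  qed
  have Q2: "{x \<in> space \<nu>. Q x \<inter> U \<noteq> {}} \<in> sets \<nu>" if U: "openin TT U" for U
  proof -
    define B where "B j = lcsc.basis (T j)" for j
    have B: "countable (B j)" "\<And>V. V \<in> B j \<Longrightarrow> openin (T j) V"
      "\<And>V y. openin (T j) V \<Longrightarrow> y \<in> V \<Longrightarrow> \<exists>W\<in>B j. y \<in> W \<and> W \<subseteq> V" if "j \<in> I" for j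
      unfolding B_def using lcsc.basis[OF lcsc_G[OF that]] by auto
    define W where "W = {V \<in> PiE I B. PiE I V \<subseteq> U}"
    have "countable (PiE I B)" using B(1) finite_I by (intro countable_PiE)
    then have "countable W" by (rule countable_subset[rotated]) (auto simp: W_def)
    have "Q x \<inter> U \<noteq> {} \<longleftrightarrow> (\<exists>V\<in>W. \<forall>j\<in>I. q j x \<inter> V j \<noteq> {})" for x
    proof
      assume "Q x \<inter> U \<noteq> {}"
      then obtain y where y: "y \<in> Q x" "y \<in> U" by auto
      obtain V where V: "V \<in> PiE I B" "y \<in> PiE I V" "PiE I V \<subseteq> U"
        by (rule product_box_refine[OF finite_I U y(2), of B]) (use B(3) in auto)
      have "q j x \<inter> V j \<noteq> {}" if "j \<in> I" for j
      proof -
        have "y j \<in> q j x \<inter> V j" using y(1) V(2) that by (auto simp: Q_def PiE_iff)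
        then show ?thesis by blast
      qed
      then show "\<exists>V\<in>W. \<forall>j\<in>I. q j x \<inter> V j \<noteq> {}" using V by (intro bexI[of _ V]) (auto simp: W_def)
    next
      assume "\<exists>V\<in>W. \<forall>j\<in>I. q j x \<inter> V j \<noteq> {}"
      then obtain V where V: "V \<in> W" "\<forall>j\<in>I. q j x \<inter> V j \<noteq> {}" by auto
      then have "\<forall>j\<in>I. \<exists>y. y \<in> q j x \<inter> V j" by (simp add: disjoint_iff)
      from bchoice[OF this] obtain y where y: "\<forall>j\<in>I. y j \<in> q j x \<inter> V j" ..
      then have "restrict y I \<in> Q x \<inter> PiE I V" by (auto simp: Q_def)
      moreover have "PiE I V \<subseteq> U" using V(1) by (simp add: W_def)
      ultimately show "Q x \<inter> U \<noteq> {}" by blast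
    qed
    moreover have "{x \<in> space \<nu>. \<exists>V\<in>W. \<forall>j\<in>I. q j x \<inter> V j \<noteq> {}} \<in> sets \<nu>"
    proof (rule sets.sets_Collect_countable_Ex'[OF _ \<open>countable W\<close>])
      fix V assume V: "V \<in> W"
      show "{x \<in> space \<nu>. \<forall>j\<in>I. q j x \<inter> V j \<noteq> {}} \<in> sets \<nu>"
      proof (rule sets.sets_Collect_countable_All')
        fix j assume j: "j \<in> I"
        then have "V j \<in> B j" using V by (auto simp: W_def)
        then show "{x \<in> space \<nu>. q j x \<inter> V j \<noteq> {}} \<in> sets \<nu>" using j B(2) by (intro q_hits_measurable) auto
      qed (rule countable_finite[OF finite_I])
    qed
    ultimately show ?thesis by simp
  qed
  have Q3: "AE x in \<nu>. Q (\<phi> g x) = g <#\<^bsub>GG\<^esub> Q x" if g: "g \<in> carrier GG" for g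
  proof -
    have "AE x in \<nu>. \<forall>j\<in>I. q j (\<phi> g x) = g j <#\<^bsub>G j\<^esub> q j x"
      by (subst AE_ball_countable) (use q_equivariant g finite_I countable_finite in auto)
    then show ?thesis
      using AE_space
    proof eventually_elim
      case (elim x)
      have "q j x \<subseteq> carrier (G j)" if "j \<in> I" for j
        using closed_subgroup.coset_carrier[OF closed_subgroup_G[OF that] q_coset[OF that elim(2)]] .
      then show ?case unfolding Q_def using elim(1) by (subst PiE_l_coset[OF g]) (auto intro!: PiE_cong)
    qed
  qed
  show "coset_valued_map GG TT \<nu> \<phi> HH Q"
    by (intro coset_valued_map.intro closed_subgroup.intro closed_subgroup_axioms.intro
        coset_valued_map_axioms.intro E.ergodic_lcsc_action_axioms E.lcsc_axioms HH1 HH2 Q1 Q2 Q3)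
qed

text \<open>The \<open>j\<close>-th factor as a closed normal subgroup of the product.\<close>

definition L :: "'i \<Rightarrow> ('i \<Rightarrow> 'g) set" where
  "L j = PiE I (\<lambda>i. if i = j then carrier (G i) else {\<one>\<^bsub>G i\<^esub>})"

lemma L_carrier: "L j \<subseteq> carrier GG"
proof -
  have "\<one>\<^bsub>G i\<^esub> \<in> carrier (G i)" if "i \<in> I" for i
    using group_G[OF that] by (simp add: group.is_monoid monoid.one_closed)
  then show ?thesis unfolding L_def carrier_product_group by (intro PiE_mono) simp
qed

lemma emb_L: "j \<in> I \<Longrightarrow> a \<in> carrier (G j) \<Longrightarrow> emb j a \<in> L j"
  by (auto simp: L_def factor_embed_def)

lemma L_emb:
  assumes "j \<in> I" "g \<in> L j"
  shows "emb j (g j) = g"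
proof
  fix i
  show "emb j (g j) i = g i"
    using assms by (cases "i \<in> I"; cases "i = j") (auto simp: L_def factor_embed_def PiE_iff extensional_def)
qed

lemma closedin_L: "closedin TT (L j)"
proof -
  have "closedin (T i) (carrier (G i))" "closedin (T i) {\<one>\<^bsub>G i\<^esub>}" if "i \<in> I" for i
  proof -
    interpret lcsc "G i" "T i" using lcsc_G[OF that] .
    show "closedin (T i) (carrier (G i))" using closedin_topspace[of "T i"] by simp
    show "closedin (T i) {\<one>\<^bsub>G i\<^esub>}" using Hausdorff_T closedin_Hausdorff_singleton by fastforce
  qed
  then show ?thesis unfolding L_def by (simp add: closedin_product_topology)
qed

lemma L_conj:
  assumes j: "j \<in> I" and h: "h \<in> carrier GG" and g: "g \<in> L j"
  shows "h \<otimes>\<^bsub>GG\<^esub> g \<otimes>\<^bsub>GG\<^esub> inv\<^bsub>GG\<^esub> h \<in> L j"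
proof -
  have "h i \<otimes>\<^bsub>G i\<^esub> g i \<otimes>\<^bsub>G i\<^esub> inv\<^bsub>G i\<^esub> h i \<in> (if i = j then carrier (G i) else {\<one>\<^bsub>G i\<^esub>})"
    if i: "i \<in> I" for i
  proof -
    interpret group "G i" using group_G[OF i] .
    have hi: "h i \<in> carrier (G i)" and gi: "g i \<in> (if i = j then carrier (G i) else {\<one>\<^bsub>G i\<^esub>})"
      using h g i by (auto simp: L_def PiE_iff)
    have "g i \<in> carrier (G i)" using gi by (simp split: if_splits)
    then have "h i \<otimes>\<^bsub>G i\<^esub> g i \<otimes>\<^bsub>G i\<^esub> inv\<^bsub>G i\<^esub> h i \<in> carrier (G i)" using hi by simp
    then show ?thesis using hi gi by (cases "i = j") simp_all
  qed
  then show ?thesis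
    using h group_G by (simp add: inv_product_group L_def PiE_iff)
qed

lemma L_commutes:
  assumes j: "j \<in> I" and l: "l \<in> L j" and n: "n \<in> complementary_factor I G j"
  shows "l \<otimes>\<^bsub>GG\<^esub> n = n \<otimes>\<^bsub>GG\<^esub> l"
proof -
  have "l i \<otimes>\<^bsub>G i\<^esub> n i = n i \<otimes>\<^bsub>G i\<^esub> l i" if i: "i \<in> I" for i
  proof -
    interpret group "G i" using group_G[OF i] .
    have li: "l i \<in> (if i = j then carrier (G i) else {\<one>\<^bsub>G i\<^esub>})" and ni: "n i \<in> carrier (G i)"
      using l n i by (auto simp: L_def complementary_factor_def PiE_iff)
    have "l i \<in> carrier (G i)" using li by (simp split: if_splits)
    moreover have "n i = \<one>\<^bsub>G i\<^esub> \<or> l i = \<one>\<^bsub>G i\<^esub>"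
      using n li by (cases "i = j") (simp_all add: complementary_factor_def)
    ultimately show ?thesis using ni by auto
  qed
  then show ?thesis by (auto intro!: restrict_ext)
qed

definition pr :: "'i \<Rightarrow> ('i \<Rightarrow> 'g) set \<Rightarrow> 'g set" where
  "pr j c = (\<lambda>g. g j) ` c"

lemma pr_Q:
  assumes "j \<in> I" "x \<in> space \<nu>"
  shows "pr j (Q x) = q j x"
  using C.coset_nonempty[OF C.Q_coset[OF assms(2)]] assms(1)
  by (simp add: pr_def Q_def image_projection_PiE)

lemma pr_l_coset: "j \<in> I \<Longrightarrow> pr j (g <#\<^bsub>GG\<^esub> c) = g j <#\<^bsub>G j\<^esub> pr j c"
  by (simp add: pr_def l_coset_def UNION_singleton_eq_range image_image)

text \<open>The indicator of an invariant set is a function of the ergodic component, and the isomorphism with the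
  homogeneous space recovers the component from its coset.\<close>

lemma invariant_sets_determined:
  assumes j: "j \<in> I" and A: "A \<in> sets \<nu>"
    and inv: "\<And>n x. n \<in> complementary_factor I G j \<Longrightarrow> x \<in> space \<nu> \<Longrightarrow> \<phi> n x \<in> A \<longleftrightarrow> x \<in> A"
  shows "\<exists>Z\<in>sets \<nu>. (AE x in \<nu>. x \<in> Z) \<and>
    (\<forall>x\<in>Z. \<forall>y\<in>Z. pr j (Q x) = pr j (Q y) \<longrightarrow> (x \<in> A \<longleftrightarrow> y \<in> A))"
proof -
  let ?f = "indicator A :: 'x \<Rightarrow> complex"
  have "\<forall>n\<in>complementary_factor I G j. AE x in \<nu>. ?f (\<phi> n x) = ?f x"
    using inv by (intro ballI AE_I2) (simp add: indicator_def)
  then obtain h where h: "h \<in> Linfty (Y j)" "AE x in \<nu>. ?f x = h (p j x)"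
    using component_map(4)[OF j indicator_Linfty[OF A]] by auto
  define h' where "h' C = h (F' j C)" for C
  have "h \<in> borel_measurable (Y j)" using h(1) by (simp add: Linfty_def)
  from measurable_compose[OF q_measurable[OF j] measurable_compose[OF coset_map(2)[OF j] this]]
  have h': "(\<lambda>x. h' (q j x)) \<in> borel_measurable \<nu>" unfolding h'_def .
  let ?Z = "{x \<in> space \<nu>. ?f x = h' (q j x)}"
  have "?Z \<in> sets \<nu>" using A h' by measurable
  moreover have "AE x in \<nu>. F' j (F j (p j x)) = p j x" using AE_p[OF j coset_map(3)[OF j]] .
  then have "AE x in \<nu>. x \<in> ?Z" using h(2) AE_space by eventually_elim (simp add: h'_def q_def)
  moreover have "x \<in> A \<longleftrightarrow> y \<in> A" if "x \<in> ?Z" "y \<in> ?Z" "pr j (Q x) = pr j (Q y)" for x y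
  proof -
    have "q j x = q j y" using that pr_Q[OF j] by simp
    then have "?f x = ?f y" using that by simp
    then show ?thesis by (cases "x \<in> A"; cases "y \<in> A") simp_all
  qed
  ultimately show ?thesis by (intro bexI[of _ ?Z] conjI ballI impI)
qed

lemma stabilizer_determined:
  obtains Z where "Z \<in> sets \<nu>" "AE x in \<nu>. x \<in> Z"
    "\<And>j x y. j \<in> I \<Longrightarrow> x \<in> Z \<Longrightarrow> y \<in> Z \<Longrightarrow> pr j (Q x) = pr j (Q y) \<Longrightarrow>
      stabilizer GG \<phi> x \<inter> L j = stabilizer GG \<phi> y \<inter> L j"
proof -
  have "\<forall>j\<in>I. \<exists>Z. Z \<in> sets \<nu> \<and> (AE x in \<nu>. x \<in> Z) \<and>
    (\<forall>x\<in>Z. \<forall>y\<in>Z. pr j (Q x) = pr j (Q y) \<longrightarrow>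
      stabilizer GG \<phi> x \<inter> L j = stabilizer GG \<phi> y \<inter> L j)"
  proof
    fix j assume j: "j \<in> I"
    have N: "complementary_factor I G j \<subseteq> carrier GG" by (auto simp: complementary_factor_def)
    have "\<exists>Z\<in>sets \<nu>. (AE x in \<nu>. x \<in> Z) \<and>
      (\<forall>x\<in>Z. \<forall>y\<in>Z. pr j (Q x) = pr j (Q y) \<longrightarrow>
        stabilizer GG \<phi> x \<inter> L j = stabilizer GG \<phi> y \<inter> L j)"
    proof (rule C.stabilizer_determined_by_projection[OF closedin_L N])
      fix A assume "A \<in> sets \<nu>"
        "\<And>n x. n \<in> complementary_factor I G j \<Longrightarrow> x \<in> space \<nu> \<Longrightarrow> \<phi> n x \<in> A \<longleftrightarrow> x \<in> A"
      then show "\<exists>Z\<in>sets \<nu>. (AE x in \<nu>. x \<in> Z) \<and>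
          (\<forall>x\<in>Z. \<forall>y\<in>Z. pr j (Q x) = pr j (Q y) \<longrightarrow> (x \<in> A \<longleftrightarrow> y \<in> A))"
        by (rule invariant_sets_determined[OF j])
    qed (rule L_commutes[OF j])
    then show "\<exists>Z. Z \<in> sets \<nu> \<and> (AE x in \<nu>. x \<in> Z) \<and>
      (\<forall>x\<in>Z. \<forall>y\<in>Z. pr j (Q x) = pr j (Q y) \<longrightarrow>
        stabilizer GG \<phi> x \<inter> L j = stabilizer GG \<phi> y \<inter> L j)"
      unfolding Bex_def .
  qed
  from bchoice[OF this] obtain Z where Z: "\<forall>j\<in>I. Z j \<in> sets \<nu> \<and> (AE x in \<nu>. x \<in> Z j) \<and>
    (\<forall>x\<in>Z j. \<forall>y\<in>Z j. pr j (Q x) = pr j (Q y) \<longrightarrow>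
      stabilizer GG \<phi> x \<inter> L j = stabilizer GG \<phi> y \<inter> L j)" ..
  let ?Z = "space \<nu> - (\<Union>j\<in>I. space \<nu> - Z j)"
  show ?thesis
  proof (rule that[of ?Z])
    have "(\<Union>j\<in>I. space \<nu> - Z j) \<in> sets \<nu>" using finite_I Z by (intro sets.finite_UN) auto
    then show "?Z \<in> sets \<nu>" by auto
    have "AE x in \<nu>. \<forall>j\<in>I. x \<in> Z j"
      by (subst AE_ball_countable) (use Z finite_I countable_finite in auto)
    then show "AE x in \<nu>. x \<in> ?Z" using AE_space by eventually_elim auto
    fix j x y assume j: "j \<in> I" and x: "x \<in> ?Z" "y \<in> ?Z" and eq: "pr j (Q x) = pr j (Q y)"
    have xy: "x \<in> Z j" "y \<in> Z j" using x j by auto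
    have "\<forall>x\<in>Z j. \<forall>y\<in>Z j. pr j (Q x) = pr j (Q y) \<longrightarrow>
      stabilizer GG \<phi> x \<inter> L j = stabilizer GG \<phi> y \<inter> L j"
      using bspec[OF Z j] by (elim conjE)
    from this[rule_format, OF xy eq] show "stabilizer GG \<phi> x \<inter> L j = stabilizer GG \<phi> y \<inter> L j" .
  qed
qed

lemma stabilizer_conj:
  assumes "g \<in> carrier GG" "s \<in> carrier GG" "x \<in> space \<nu>"
  shows "\<phi> (g \<otimes>\<^bsub>GG\<^esub> s \<otimes>\<^bsub>GG\<^esub> inv\<^bsub>GG\<^esub> g) (\<phi> g x) = \<phi> g x \<longleftrightarrow> \<phi> s x = x"
proof -
  have "\<phi> (g \<otimes>\<^bsub>GG\<^esub> s \<otimes>\<^bsub>GG\<^esub> inv\<^bsub>GG\<^esub> g) (\<phi> g x) = \<phi> (g \<otimes>\<^bsub>GG\<^esub> s) (\<phi> (inv\<^bsub>GG\<^esub> g) (\<phi> g x))"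
    using assms by (intro E.act_mult E.m_closed E.inv_closed E.act_closed)
  also have "\<dots> = \<phi> g (\<phi> s x)" unfolding E.act_inv[OF assms(1,3)] by (rule E.act_mult[OF assms])
  finally show ?thesis using E.act_inject[OF assms(1) E.act_closed[OF assms(2,3)] assms(3)] by simp
qed

text \<open>The points with nontrivial stabilizer in the \<open>j\<close>-th factor form a measurable set, and an invariant one
  because the factor is normal.\<close>

lemma free_or_nontrivial_stabilizers:
  assumes j: "j \<in> I"
  shows "essentially_free (G j) \<nu> (\<lambda>g. \<phi> (emb j g)) \<or> (AE x in \<nu>. \<exists>g\<in>L j - {\<one>\<^bsub>GG\<^esub>}. \<phi> g x = x)"
proof -
  let ?D = "{x \<in> space \<nu>. \<exists>g\<in>L j - {\<one>\<^bsub>GG\<^esub>}. \<phi> g x = x}"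
  have "(AE x in \<nu>. x \<in> ?D) \<or> (AE x in \<nu>. x \<notin> ?D)"
  proof (rule E.invariant_dichotomy)
    show "?D \<in> sets \<nu>" by (rule E.measurable_fixed_by_closed_nontrivial[OF closedin_L])
    fix h x assume h: "h \<in> carrier GG" and "x \<in> ?D"
    then obtain g where g: "x \<in> space \<nu>" "g \<in> L j" "g \<noteq> \<one>\<^bsub>GG\<^esub>" "\<phi> g x = x" by auto
    have gc: "g \<in> carrier GG" using g(2) L_carrier by (rule subsetD[rotated])
    let ?g = "h \<otimes>\<^bsub>GG\<^esub> g \<otimes>\<^bsub>GG\<^esub> inv\<^bsub>GG\<^esub> h"
    have "?g \<in> L j" using j h g(2) by (rule L_conj)
    moreover have "\<phi> ?g (\<phi> h x) = \<phi> h x" using stabilizer_conj[OF h gc g(1)] g(4) by (rule iffD2)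
    moreover have "?g \<noteq> \<one>\<^bsub>GG\<^esub>"
    proof
      assume "?g = \<one>\<^bsub>GG\<^esub>"
      from E.inv_equality[OF this E.inv_closed[OF h] E.m_closed[OF h gc]]
      have "h \<otimes>\<^bsub>GG\<^esub> g = h" unfolding E.inv_inv[OF h] by (rule sym)
      then show False using g(3) unfolding E.l_cancel_one[OF h gc] by simp
    qed
    ultimately show "\<phi> h x \<in> ?D" using E.act_closed[OF h g(1)] by blast
  qed
  then show ?thesis
  proof
    assume "AE x in \<nu>. x \<in> ?D"
    then have "AE x in \<nu>. \<exists>g\<in>L j - {\<one>\<^bsub>GG\<^esub>}. \<phi> g x = x" by eventually_elim simp
    then show ?thesis ..
  next
    assume "AE x in \<nu>. x \<notin> ?D"
    then have "AE x in \<nu>. stabilizer (G j) (\<lambda>g. \<phi> (emb j g)) x = {\<one>\<^bsub>G j\<^esub>}"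
      using AE_space
    proof eventually_elim
      case (elim x)
      have one: "\<one>\<^bsub>G j\<^esub> \<in> carrier (G j)" using group_G[OF j] group.is_monoid monoid.one_closed by blast
      have only: "a = \<one>\<^bsub>G j\<^esub>" if a: "a \<in> carrier (G j)" "\<phi> (emb j a) x = x" for a
      proof (rule ccontr)
        assume "a \<noteq> \<one>\<^bsub>G j\<^esub>"
        then have "emb j a \<noteq> \<one>\<^bsub>GG\<^esub>"
          using factor_embed_apply[OF j, of G a] j by (metis one_product_group restrict_apply')
        then show False using elim emb_L[OF j a(1)] a(2) by auto
      qed
      have fix_one: "\<phi> (emb j \<one>\<^bsub>G j\<^esub>) x = x" unfolding factor_embed_one by (rule E.act_one[OF elim(2)])
      show ?case
      proof (intro equalityI subsetI)
        fix a assume "a \<in> stabilizer (G j) (\<lambda>g. \<phi> (emb j g)) x"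
        then have "a \<in> carrier (G j)" "\<phi> (emb j a) x = x" by (simp_all only: stabilizer_def mem_Collect_eq)
        then show "a \<in> {\<one>\<^bsub>G j\<^esub>}" using only by simp
      next
        fix a assume "a \<in> {\<one>\<^bsub>G j\<^esub>}"
        then have "a = \<one>\<^bsub>G j\<^esub>" by simp
        then show "a \<in> stabilizer (G j) (\<lambda>g. \<phi> (emb j g)) x"
          using one fix_one by (simp only: stabilizer_def mem_Collect_eq)
      qed
    qed
    then show ?thesis by (simp add: essentially_free_def)
  qed
qed

end

section \<open>Stabilizers over the base coset\<close>

context product_action
begin

text \<open>Some group element takes both points into \<open>Z\<close>, where the stabilizers agree, and it conjugates the
  stabilizers of the original points to those of the translates.\<close>

lemma typical_stabilizers_agree:
  assumes Z: "\<And>x y. x \<in> Z \<Longrightarrow> y \<in> Z \<Longrightarrow> pr j (Q x) = pr j (Q y) \<Longrightarrow>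
      stabilizer GG \<phi> x \<inter> L j = stabilizer GG \<phi> y \<inter> L j"
    and j: "j \<in> I" and c: "C.typical Z x c" and d: "C.typical Z y d" and eq: "pr j c = pr j d"
  shows "stabilizer GG \<phi> x \<inter> L j \<subseteq> stabilizer GG \<phi> y"
proof
  fix s assume "s \<in> stabilizer GG \<phi> x \<inter> L j"
  then have s: "s \<in> carrier GG" "\<phi> s x = x" "s \<in> L j" by (simp_all add: stabilizer_def)
  have xy: "x \<in> space \<nu>" "y \<in> space \<nu>" using c d by (simp_all add: C.typical_def)
  obtain g where g: "g \<in> carrier GG" "Q (\<phi> g x) = g <#\<^bsub>GG\<^esub> c" "\<phi> g x \<in> Z"
      "Q (\<phi> g y) = g <#\<^bsub>GG\<^esub> d" "\<phi> g y \<in> Z"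
    by (rule C.typical_common[OF c d]) (rule that)
  let ?s = "g \<otimes>\<^bsub>GG\<^esub> s \<otimes>\<^bsub>GG\<^esub> inv\<^bsub>GG\<^esub> g"
  have "pr j (Q (\<phi> g x)) = pr j (Q (\<phi> g y))" unfolding g(2,4) pr_l_coset[OF j] eq ..
  from Z[OF g(3,5) this]
  have same: "stabilizer GG \<phi> (\<phi> g x) \<inter> L j = stabilizer GG \<phi> (\<phi> g y) \<inter> L j" .
  have "?s \<in> L j" using L_conj[OF j g(1) s(3)] .
  moreover have "?s \<in> carrier GG" using calculation L_carrier by (rule subsetD[rotated])
  moreover have "\<phi> ?s (\<phi> g x) = \<phi> g x" using stabilizer_conj[OF g(1) s(1) xy(1)] s(2) by (rule iffD2)
  ultimately have "?s \<in> stabilizer GG \<phi> (\<phi> g x) \<inter> L j" unfolding stabilizer_def by blast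
  then have "\<phi> ?s (\<phi> g y) = \<phi> g y" unfolding same by (simp only: stabilizer_def mem_Collect_eq Int_iff)
  then have "\<phi> s y = y" using stabilizer_conj[OF g(1) s(1) xy(2)] by (rule iffD1[rotated])
  then show "s \<in> stabilizer GG \<phi> y" unfolding stabilizer_def using s(1) by blast
qed

text \<open>Suppose that no factor acts essentially freely. Typical points over the coset \<open>HH\<close> then all have the
  same, nontrivial, stabilizer in the \<open>j\<close>-th factor. It lies in \<open>H j\<close> and is normal there because \<open>HH\<close>
  permutes these points, so it has finite index. Hence the orbits of the single groups \<open>H j\<close> on these points
  are finite, and then so are those of \<open>HH\<close>, one factor at a time.\<close>

theorem free_or_transitive:
  "(\<exists>j\<in>I. essentially_free (G j) \<nu> (\<lambda>g. \<phi> (emb j g))) \<or> essentially_transitive GG \<nu> \<phi>"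
proof (rule disjCI)
  assume "\<not> essentially_transitive GG \<nu> \<phi>"
  show "\<exists>j\<in>I. essentially_free (G j) \<nu> (\<lambda>g. \<phi> (emb j g))"
  proof (rule ccontr)
    assume not_free: "\<not> (\<exists>j\<in>I. essentially_free (G j) \<nu> (\<lambda>g. \<phi> (emb j g)))"
    obtain Z where Z: "Z \<in> sets \<nu>" "AE x in \<nu>. x \<in> Z"
      "\<And>j x y. j \<in> I \<Longrightarrow> x \<in> Z \<Longrightarrow> y \<in> Z \<Longrightarrow> pr j (Q x) = pr j (Q y) \<Longrightarrow>
        stabilizer GG \<phi> x \<inter> L j = stabilizer GG \<phi> y \<inter> L j"
      by (rule stabilizer_determined) (rule that)
    have agree: "\<phi> s y = y"
      if "j \<in> I" "C.typical Z x c" "C.typical Z y d" "pr j c = pr j d" "s \<in> L j" "\<phi> s x = x" for j x y c d s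
    proof -
      have "s \<in> stabilizer GG \<phi> x \<inter> L j" unfolding stabilizer_def using that(5,6) L_carrier[of j] by blast
      then have "s \<in> stabilizer GG \<phi> y"
        using typical_stabilizers_agree[OF Z(3)[OF that(1)] that(1-4)] by (rule subsetD[rotated])
      then show ?thesis by (simp only: stabilizer_def mem_Collect_eq)
    qed
    have "AE x in \<nu>. \<exists>g\<in>L j - {\<one>\<^bsub>GG\<^esub>}. \<phi> g x = x" if "j \<in> I" for j
      using free_or_nontrivial_stabilizers[OF that] not_free that by simp
    then have "AE x in \<nu>. \<forall>j\<in>I. \<exists>g\<in>L j - {\<one>\<^bsub>GG\<^esub>}. \<phi> g x = x"
      by (subst AE_ball_countable) (simp_all add: finite_I countable_finite)
    then have generic: "AE x in \<nu>. x \<in> space \<nu> \<and> C.typical Z x (Q x) \<and> (\<forall>j\<in>I. \<exists>g\<in>L j - {\<one>\<^bsub>GG\<^esub>}. \<phi> g x = x)"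
      using C.AE_typical[OF Z(1,2)] AE_space by eventually_elim (intro conjI)
    have "ae_filter \<nu> \<noteq> bot" by (simp add: ae_filter_eq_bot_iff E.emeasure_space_1)
    from eventually_happens'[OF this generic] obtain x where x: "x \<in> space \<nu>" "C.typical Z x (Q x)"
        "\<forall>j\<in>I. \<exists>g\<in>L j - {\<one>\<^bsub>GG\<^esub>}. \<phi> g x = x"
      by (elim exE conjE) (rule that)
    obtain t where t: "t \<in> Q x" using C.coset_nonempty[OF C.Q_coset[OF x(1)]] by auto
    let ?z = "\<phi> (inv\<^bsub>GG\<^esub> t) x"
    have tc: "t \<in> carrier GG" and z: "C.typical Z ?z HH"
      using C.typical_base[OF x(2) t] by simp_all
    have itc: "inv\<^bsub>GG\<^esub> t \<in> carrier GG" using tc by (rule E.inv_closed)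
    (* x itself need not lie over HH: its stabilizer is conjugated to the base point first *)
    have nontrivial: "\<exists>g\<in>L j - {\<one>\<^bsub>GG\<^esub>}. \<phi> g w = w" if j: "j \<in> I" and w: "C.typical Z w HH" for j w
    proof -
      obtain g where g: "g \<in> L j" "g \<noteq> \<one>\<^bsub>GG\<^esub>" "\<phi> g x = x" using x(3) j by auto
      have gc: "g \<in> carrier GG" using g(1) L_carrier by (rule subsetD[rotated])
      let ?g = "inv\<^bsub>GG\<^esub> t \<otimes>\<^bsub>GG\<^esub> g \<otimes>\<^bsub>GG\<^esub> inv\<^bsub>GG\<^esub> (inv\<^bsub>GG\<^esub> t)"
      have gL: "?g \<in> L j" by (rule L_conj[OF j itc g(1)])
      have gz: "\<phi> ?g ?z = ?z" using stabilizer_conj[OF itc gc x(1)] g(3) by (rule iffD2)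
      have "?g \<noteq> \<one>\<^bsub>GG\<^esub>"
      proof
        assume "?g = \<one>\<^bsub>GG\<^esub>"
        from E.inv_equality[OF this E.inv_closed[OF itc] E.m_closed[OF itc gc]]
        have "inv\<^bsub>GG\<^esub> t \<otimes>\<^bsub>GG\<^esub> g = inv\<^bsub>GG\<^esub> t" unfolding E.inv_inv[OF itc] by (rule sym)
        then show False using g(2) unfolding E.l_cancel_one[OF itc gc] by simp
      qed
      moreover have "\<phi> ?g w = w" by (rule agree[OF j z w refl gL gz])
      ultimately show ?thesis using gL by blast
    qed
    have H_sub: "subgroup (H j) (G j)" "H j \<subseteq> carrier (G j)" if "j \<in> I" for j
      using closed_subgroup_factor[OF that] subgroup.subset by auto
    have translate: "C.typical Z (\<phi> h w) HH" if "C.typical Z w HH" "h \<in> HH" for h w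
    proof -
      have h: "h \<in> carrier GG" using that(2) C.H_carrier by blast
      have "h <#\<^bsub>GG\<^esub> HH = HH" using C.coset_eq[OF C.H_coset that(2)] by (rule sym)
      then show ?thesis using C.typical_translate[OF that(1) h] by simp
    qed
    have emb_HH: "emb j a \<in> HH" if "j \<in> I" "a \<in> H j" for j a
      using that subgroup.one_closed[OF H_sub(1)] by (auto simp: HH_def factor_embed_def)
    have step: "finite ((\<lambda>a. \<phi> (emb j a) w) ` H j)" if j: "j \<in> I" and w: "C.typical Z w HH" for j w
    proof -
      interpret Gj: group "G j" using group_G[OF j] .
      have wM: "w \<in> space \<nu>" using w by (simp add: C.typical_def)
      let ?N = "{a \<in> carrier (G j). \<phi> (emb j a) w = w}"
      let ?H = "(G j)\<lparr>carrier := H j\<rparr>"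
      have N_fix: "\<phi> (emb j a) v = v" if "a \<in> ?N" "C.typical Z v HH" for a v
        using agree[OF j w that(2) refl emb_L[OF j]] that(1) by simp
      have N_H: "?N \<subseteq> H j"
      proof
        fix a assume a: "a \<in> ?N"
        then have ec: "emb j a \<in> carrier GG" using emb_carrier[OF j] by simp
        have "emb j a <#\<^bsub>GG\<^esub> HH = HH" using a by (intro C.typical_stabilizer[OF w ec]) simp
        then have "emb j a \<in> HH" using E.lcos_self[OF ec C.subgroup_H] by simp
        then show "a \<in> H j" using j PiE_mem[of "emb j a" I H j] by (simp add: HH_def factor_embed_apply)
      qed
      have emb_mult: "\<phi> (emb j (a \<otimes>\<^bsub>G j\<^esub> b)) v = \<phi> (emb j a) (\<phi> (emb j b) v)"
        if "a \<in> carrier (G j)" "b \<in> carrier (G j)" "v \<in> space \<nu>" for a b v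
        using E.act_mult[OF emb_carrier[OF j that(1)] emb_carrier[OF j that(2)] that(3)]
          factor_embed_mult[of I G j a b] group_G by simp
      have emb_one: "\<phi> (emb j \<one>\<^bsub>G j\<^esub>) v = v" if "v \<in> space \<nu>" for v
        unfolding factor_embed_one by (rule E.act_one[OF that])
      have subN: "subgroup ?N (G j)"
      proof (rule Gj.subgroupI)
        show "?N \<noteq> {}" using emb_one[OF wM] by auto
        fix a assume a: "a \<in> ?N"
        have "\<phi> (emb j (inv\<^bsub>G j\<^esub> a)) w = \<phi> (emb j (inv\<^bsub>G j\<^esub> a)) (\<phi> (emb j a) w)" using a by simp
        also have "\<dots> = \<phi> (emb j (inv\<^bsub>G j\<^esub> a \<otimes>\<^bsub>G j\<^esub> a)) w" using a wM by (intro emb_mult[symmetric]) auto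
        also have "\<dots> = w" using a emb_one[OF wM] by simp
        finally show "inv\<^bsub>G j\<^esub> a \<in> ?N" using a by simp
        fix b assume "b \<in> ?N"
        then show "a \<otimes>\<^bsub>G j\<^esub> b \<in> ?N" using a emb_mult[of a b w] wM by simp
      qed auto
      have "normal ?N ?H"
      proof (rule group.normal_invI)
        show grp: "group ?H" using Gj.subgroup_imp_group[OF H_sub(1)[OF j]] .
        show "subgroup ?N ?H" using Gj.subgroup_incl[OF subN H_sub(1)[OF j] N_H] .
        fix h a assume "h \<in> carrier ?H" and a: "a \<in> ?N"
        then have h: "h \<in> H j" by simp
        then have hc: "h \<in> carrier (G j)" and ihH: "inv\<^bsub>G j\<^esub> h \<in> H j"
          using H_sub[OF j] subgroup.m_inv_closed by auto
        have ac: "a \<in> carrier (G j)" using a by simp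
        let ?v = "\<phi> (emb j (inv\<^bsub>G j\<^esub> h)) w"
        have vM: "?v \<in> space \<nu>" using E.act_closed[OF emb_carrier[OF j] wM] hc by simp
        have "\<phi> (emb j (h \<otimes>\<^bsub>G j\<^esub> a \<otimes>\<^bsub>G j\<^esub> inv\<^bsub>G j\<^esub> h)) w = \<phi> (emb j (h \<otimes>\<^bsub>G j\<^esub> a)) ?v"
          using hc ac wM by (intro emb_mult) auto
        also have "\<dots> = \<phi> (emb j h) (\<phi> (emb j a) ?v)" using hc ac vM by (intro emb_mult)
        also have "\<phi> (emb j a) ?v = ?v" by (rule N_fix[OF a translate[OF w emb_HH[OF j ihH]]])
        also have "\<phi> (emb j h) ?v = \<phi> (emb j (h \<otimes>\<^bsub>G j\<^esub> inv\<^bsub>G j\<^esub> h)) w"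
          using hc wM by (intro emb_mult[symmetric]) auto
        also have "\<dots> = w" using hc emb_one[OF wM] by simp
        finally have "h \<otimes>\<^bsub>G j\<^esub> a \<otimes>\<^bsub>G j\<^esub> inv\<^bsub>G j\<^esub> h \<in> ?N" using hc ac by simp
        then show "h \<otimes>\<^bsub>?H\<^esub> a \<otimes>\<^bsub>?H\<^esub> inv\<^bsub>?H\<^esub> h \<in> ?N"
          using Gj.m_inv_consistent[OF H_sub(1)[OF j] h] by simp
      qed
      moreover have "?N \<noteq> {\<one>\<^bsub>G j\<^esub>}"
      proof
        assume triv: "?N = {\<one>\<^bsub>G j\<^esub>}"
        obtain g where g: "g \<in> L j" "g \<noteq> \<one>\<^bsub>GG\<^esub>" "\<phi> g w = w" using nontrivial[OF j w] by auto
        have "g j \<in> ?N" using g(1,3) L_emb[OF j g(1)] L_carrier[of j] j by auto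
        then have "g j = \<one>\<^bsub>G j\<^esub>" using triv by simp
        then have "g = \<one>\<^bsub>GG\<^esub>" using L_emb[OF j g(1)] factor_embed_one[of I G j] by simp
        then show False using g(2) by simp
      qed
      ultimately have fin: "finite (rcosets\<^bsub>?H\<^esub> ?N)" by (rule just_infinite[OF j])
      (* the right factor r acts first and leads to another point over HH, which ?N fixes as well *)
      have const: "(\<lambda>a. \<phi> (emb j a) w) ` R \<subseteq> {\<phi> (emb j r) w}" if r: "r \<in> H j" "R = ?N #>\<^bsub>?H\<^esub> r" for R r
      proof
        fix v assume "v \<in> (\<lambda>a. \<phi> (emb j a) w) ` R"
        then obtain n where n: "n \<in> ?N" "v = \<phi> (emb j (n \<otimes>\<^bsub>G j\<^esub> r)) w"
          unfolding r(2) by (auto simp: r_coset_def)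
        have "v = \<phi> (emb j n) (\<phi> (emb j r) w)"
          unfolding n(2) using n(1) r(1) H_sub(2)[OF j] wM by (intro emb_mult) auto
        also have "\<dots> = \<phi> (emb j r) w" by (rule N_fix[OF n(1) translate[OF w emb_HH[OF j r(1)]]])
        finally show "v \<in> {\<phi> (emb j r) w}" by simp
      qed
      have "finite ((\<lambda>a. \<phi> (emb j a) w) ` R)" if R: "R \<in> rcosets\<^bsub>?H\<^esub> ?N" for R
      proof -
        obtain r where "r \<in> H j" "R = ?N #>\<^bsub>?H\<^esub> r" using R by (auto simp: RCOSETS_def)
        then show ?thesis by (rule finite_subset[OF const]) simp
      qed
      then have "finite (\<Union>R\<in>rcosets\<^bsub>?H\<^esub> ?N. (\<lambda>a. \<phi> (emb j a) w) ` R)" using fin by simp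
      moreover have "(\<lambda>a. \<phi> (emb j a) w) ` H j \<subseteq> (\<Union>R\<in>rcosets\<^bsub>?H\<^esub> ?N. (\<lambda>a. \<phi> (emb j a) w) ` R)"
      proof
        fix v assume "v \<in> (\<lambda>a. \<phi> (emb j a) w) ` H j"
        then obtain a where a: "a \<in> H j" "v = \<phi> (emb j a) w" by auto
        have "\<one>\<^bsub>G j\<^esub> \<in> ?N" using emb_one[OF wM] by simp
        then have "\<one>\<^bsub>G j\<^esub> \<otimes>\<^bsub>G j\<^esub> a \<in> ?N #>\<^bsub>?H\<^esub> a" unfolding r_coset_def by auto
        moreover have "\<one>\<^bsub>G j\<^esub> \<otimes>\<^bsub>G j\<^esub> a = a" using a(1) H_sub(2)[OF j] by auto
        ultimately have "a \<in> ?N #>\<^bsub>?H\<^esub> a" by simp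
        moreover have "?N #>\<^bsub>?H\<^esub> a \<in> rcosets\<^bsub>?H\<^esub> ?N" unfolding RCOSETS_def using a(1) by auto
        ultimately show "v \<in> (\<Union>R\<in>rcosets\<^bsub>?H\<^esub> ?N. (\<lambda>a. \<phi> (emb j a) w) ` R)" using a(2) by blast
      qed
      ultimately show ?thesis by (rule finite_subset[rotated])
    qed
    (* induction over the set J of coordinates in which h may be nontrivial *)
    have "finite ((\<lambda>h. \<phi> h w) ` {h \<in> HH. \<forall>i\<in>I - J. h i = \<one>\<^bsub>G i\<^esub>})"
      if "finite J" "J \<subseteq> I" "C.typical Z w HH" for J w
      using that
    proof (induction J)
      case empty
      have "{h \<in> HH. \<forall>i\<in>I - {}. h i = \<one>\<^bsub>G i\<^esub>} \<subseteq> {\<one>\<^bsub>GG\<^esub>}"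
        by (auto simp: HH_def PiE_iff extensional_def)
      then show ?case by (rule finite_imageI[OF finite_subset]) simp
    next
      case (insert j J)
      let ?S = "\<lambda>J. {h \<in> HH. \<forall>i\<in>I - J. h i = \<one>\<^bsub>G i\<^esub>}"
      have j: "j \<in> I" and wM: "w \<in> space \<nu>" using insert.prems by (simp_all add: C.typical_def)
      have fin: "finite ((\<lambda>h. \<phi> h w) ` ?S J)" using insert by simp
      have "(\<lambda>h. \<phi> h w) ` ?S (insert j J) \<subseteq> (\<Union>v\<in>(\<lambda>h. \<phi> h w) ` ?S J. (\<lambda>a. \<phi> (emb j a) v) ` H j)"
      proof
        fix v assume "v \<in> (\<lambda>h. \<phi> h w) ` ?S (insert j J)"
        then obtain h where h: "h \<in> HH" "\<forall>i\<in>I - insert j J. h i = \<one>\<^bsub>G i\<^esub>" "v = \<phi> h w" by auto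
        define h' where "h' = h(j := \<one>\<^bsub>G j\<^esub>)"
        have "h' \<in> HH" using h(1) j subgroup.one_closed[OF H_sub(1)[OF j]]
          by (auto simp: h'_def HH_def PiE_iff extensional_def)
        moreover have "\<forall>i\<in>I - J. h' i = \<one>\<^bsub>G i\<^esub>" using h(2) by (auto simp: h'_def)
        ultimately have h'S: "h' \<in> ?S J" by simp
        have hj: "h j \<in> H j" using h(1) j by (auto simp: HH_def)
        have hic: "h i \<in> carrier (G i)" if "i \<in> I" for i
          using h(1) H_sub(2)[OF that] that by (auto simp: HH_def)
        have "emb j (h j) \<otimes>\<^bsub>GG\<^esub> h' = h"
        proof (rule ext)
          fix i
          show "(emb j (h j) \<otimes>\<^bsub>GG\<^esub> h') i = h i"
          proof (cases "i \<in> I")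
            case True
            have "monoid (G i)" using group_G[OF True] by (rule group.is_monoid)
            from monoid.r_one[OF this hic[OF True]] monoid.l_one[OF this hic[OF True]]
            show ?thesis using True by (cases "i = j") (simp_all add: factor_embed_def h'_def)
          next
            case False
            then show ?thesis using h(1) by (simp add: HH_def PiE_iff extensional_def)
          qed
        qed
        then have "v = \<phi> (emb j (h j)) (\<phi> h' w)"
          using E.act_mult[of "emb j (h j)" h' w] emb_carrier[OF j hic[OF j]] C.H_carrier h'S wM h(3) by auto
        then show "v \<in> (\<Union>v\<in>(\<lambda>h. \<phi> h w) ` ?S J. (\<lambda>a. \<phi> (emb j a) v) ` H j)" using h'S hj by blast
      qed
      moreover have "finite (\<Union>v\<in>(\<lambda>h. \<phi> h w) ` ?S J. (\<lambda>a. \<phi> (emb j a) v) ` H j)"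
        using fin
      proof (rule finite_UN_I)
        fix v assume "v \<in> (\<lambda>h. \<phi> h w) ` ?S J"
        then obtain h where "h \<in> HH" "v = \<phi> h w" by auto
        then have "C.typical Z v HH" using translate[OF insert.prems(2)] by simp
        then show "finite ((\<lambda>a. \<phi> (emb j a) v) ` H j)" by (rule step[OF j])
      qed
      ultimately show ?case by (rule finite_subset)
    qed
    from this[OF finite_I order_refl]
    have "finite ((\<lambda>h. \<phi> h w) ` HH)" if "C.typical Z w HH" for w using that by simp
    from C.essentially_transitive_if_finite_fibres[OF Z(1,2) this]
    show False using \<open>\<not> essentially_transitive GG \<nu> \<phi>\<close> by simp
  qed
qed

end

theorem corollary9p6:
  fixes k :: nat
    and G :: "nat \<Rightarrow> 'g monoid" and T :: "nat \<Rightarrow> 'g topology"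
    and \<nu> :: "'x measure" and \<phi> :: "(nat \<Rightarrow> 'g) \<Rightarrow> 'x \<Rightarrow> 'x"
    and H :: "nat \<Rightarrow> 'g set" and haar :: "nat \<Rightarrow> 'g set measure"
    and Y :: "nat \<Rightarrow> 'y measure" and \<psi> :: "nat \<Rightarrow> (nat \<Rightarrow> 'g) \<Rightarrow> 'y \<Rightarrow> 'y"
    and p :: "nat \<Rightarrow> 'x \<Rightarrow> 'y"
  defines "GG \<equiv> product_group {1..k} G" and "TT \<equiv> product_topology T {1..k}"
  assumes "k \<ge> 2"
    and "\<And>j. j \<in> {1..k} \<Longrightarrow> lcsc_group (G j) (T j)"
    and "\<And>j. j \<in> {1..k} \<Longrightarrow> property_T (G j) (T j)"
    and "G_space GG TT \<nu> \<phi>"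
    and "measure_preserving_action GG \<nu> \<phi>"
    and "ergodic_action GG \<nu> \<phi>"
    and "\<And>j. j \<in> {1..k} \<Longrightarrow> subgroup (H j) (G j) \<and> closedin (T j) (H j)"
    and "\<And>j. j \<in> {1..k} \<Longrightarrow>
           ergodic_components GG TT (complementary_factor {1..k} G j) \<nu> \<phi> (Y j) (\<psi> j) (p j)"
    and "\<And>j. j \<in> {1..k} \<Longrightarrow> Haar_on_cosets (G j) (T j) (H j) (haar j)"
    and "\<And>j. j \<in> {1..k} \<Longrightarrow>
           isomorphic_actions (G j) (Y j) (\<lambda>g. \<psi> j (factor_embed {1..k} G j g))
             (haar j) (\<lambda>g C. g <#\<^bsub>G j\<^esub> C)"
    and "\<And>j N. j \<in> {1..k} \<Longrightarrow> normal N ((G j)\<lparr>carrier := H j\<rparr>) \<Longrightarrow> N \<noteq> {\<one>\<^bsub>G j\<^esub>} \<Longrightarrow>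
           finite (rcosets\<^bsub>(G j)\<lparr>carrier := H j\<rparr>\<^esub> N)"
  shows "(\<exists>j\<in>{1..k}. essentially_free (G j) \<nu> (\<lambda>g. \<phi> (factor_embed {1..k} G j g)))
         \<or> essentially_transitive GG \<nu> \<phi>"
proof -
  interpret product_action "{1..k}" G T \<nu> \<phi> H haar Y \<psi> p
    using assms unfolding GG_def TT_def by unfold_locales auto
  show ?thesis unfolding GG_def by (rule free_or_transitive)
qed

end
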